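(* Assume $d-m\ge2$. Let $$\Sigma_m=Q_mT_m^{-1}Q_m^{\top}+(S_\perp^{-1})_{11}q_\parallel q_\parallel^{\top}-q_\parallel q_\perp^{\top}-q_\perp q_\parallel^{\top}+\sigma_u\,uu^{\top}+\omega(m)P_{\mathrm{rest}}$$ (notation in context). Let $\hat u=S_\perp^{-1}e_1/\sqrt{e_1^{\top}S_\perp^{-2}e_1}\in\mathbb{R}^{d-m}$, so $u=Q_{m,\perp}\hat u$, let $V\in\mathbb{R}^{(d-m)\times(d-m-1)}$ be any isometry such that $[\,\hat u\ \ V\,]$ is orthogonal, and set $c=V^{\top}S_\perp^{-1}\hat u\in\mathbb{R}^{d-m-1}$ and $D=V^{\top}S_\perp^{-1}V\in\mathbb{R}^{(d-m-1)\times(d-m-1)}$. Then: (i) (Exact error identity) The resolved block and the boundary coupling of $\Sigma_m$ are exact, and $$\Sigma_m-A^{-1}=Q_{m,\perp}[\,\hat u\ \ V\,]\,E\,[\,\hat u\ \ V\,]^{\top}Q_{m,\perp}^{\top},\qquad E=\begin{pmatrix}0&-c^{\top}\\-c&\omega(m)I_{d-m-1}-D\end{pmatrix}.$$ The error is supported on $\mathrm{range}(P_m^\perp)$, its $(u,u)$ entry vanishes, and $\mathrm{tr}(\Sigma_m-A^{-1})=0$. (ii) (Bulk spectrum and mean) The eigenvalues $\delta_1\ge\cdots\ge\delta_{d-m-1}>0$ of $D$ interlace those of $S_\perp^{-1}$, hence $\delta_i\in[1/\mu_1^S,\,1/\mu_{d-m}^S]$, and $\omega(m)=\frac{1}{d-m-1}\mathrm{tr}(D)$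 is exactly their mean. (iii) (Cross term) With $p_k=(S_\perp^{-k})_{11}$, $$\|c\|_2^2=\frac{p_4}{p_2}-\Bigl(\frac{p_3}{p_2}\Bigr)^2,\qquad \|c\|_2\le\tfrac12\,\omega(m)\bigl(\kappa_S^\perp(m)-1\bigr).$$ (iv) (Error bounds) $$\|\Sigma_m-A^{-1}\|_2\le\tfrac32\,\omega(m)\bigl(\kappa_S^\perp(m)-1\bigr),\qquad \|\Sigma_m-A^{-1}\|_F\le\tfrac12\,\omega(m)\bigl(\kappa_S^\perp(m)-1\bigr)\sqrt{d-m+1},$$ and conversely $\|c\|_2\le\|\Sigma_m-A^{-1}\|_2$. (v) (Exactness) $\Sigma_m=A^{-1}$ if and only if $c=0$ and $D=\omega(m)I$, i.e. if and only if $\hat u$ (the coordinate vector of $u$) is an eigenvector of $S_\perp$ and $S_\perp$ acts as a multiple of the identity on the orthogonal complement of $\hat u$ in $\mathbb{R}^{d-m}$ (equivalently, of $u$ within $\mathrm{range}(P_m^\perp)$). In particular this holds whenever $\kappa_S^\perp(m)=1$.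
   Context: $A\in\mathbb{R}^{d\times d}$ is symmetric positive definite and $1\le m<d$. Starting from a unit vector $q_1=v_{\mathrm{ref}}/\|v_{\mathrm{ref}}\|_2$, $m$ steps of the Lanczos algorithm (exact arithmetic, no breakdown before step $m$) produce $Q_m=[q_1,\dots,q_m]\in\mathbb{R}^{d\times m}$ with orthonormal columns, a symmetric tridiagonal positive definite matrix $T_m=Q_m^{\top}AQ_m$, a scalar $\beta_m\ge0$, and a unit vector $q_{m+1}\perp\mathrm{range}(Q_m)$ (any such unit vector if $\beta_m=0$) with $AQ_m=Q_mT_m+\beta_mq_{m+1}e_m^{\top}$. $Q_{m,\perp}\in\mathbb{R}^{d\times(d-m)}$ has orthonormal columns spanning the orthogonal complement of $\mathrm{range}(Q_m)$, with first column $q_{m+1}$; $P_m^\perp=I_d-Q_mQ_m^{\top}$; $T_{m,\perp}=Q_{m,\perp}^{\top}AQ_{m,\perp}$. $e_m\in\mathbb{R}^m$ is the last and $e_1\in\mathbb{R}^{d-m}$ the first coordinate vector. $\gamma=\beta_m^2(T_m^{-1})_{mm}$ and $S_\perp=T_{m,\perp}-\gamma e_1e_1^{\top}$, which is symmetric positive definite (it is the Schur complement of $T_m$ in $A$), with eigenvalues $\mu_1^S\ge\cdots\ge\mu_{d-m}^S>0$ and $\kappa_S^\perp(m)=\mu_1^S/\mu_{d-m}^S$. Further $$q_\parallel=\beta_mQ_mT_m^{-1}e_m,\quad q_\perp=Q_{m,\perp}S_\perp^{-1}e_1,\quad u=\frac{q_\perp}{\|q_\perp\|_2},\quad \sigma_u=\frac{e_1^{\top}S_\perp^{-3}e_1}{e_1^{\top}S_\perp^{-2}e_1},$$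 $$\omega(m)=\frac{\mathrm{tr}(S_\perp^{-1})-\sigma_u}{d-m-1},\quad P_{\mathrm{rest}}=I_d-Q_mQ_m^{\top}-uu^{\top}.$$ "The resolved block and the boundary coupling are exact" means $Q_m^{\top}\Sigma_mQ_m=Q_m^{\top}A^{-1}Q_m$ and $Q_m^{\top}\Sigma_mQ_{m,\perp}=Q_m^{\top}A^{-1}Q_{m,\perp}$. Interlacing means $s_i\ge\delta_i\ge s_{i+1}$ for the eigenvalues $s_1\ge\cdots\ge s_{d-m}$ of $S_\perp^{-1}$. *)

theory Defs
  imports
    "Jordan_Normal_Form.Char_Poly"
    "Jordan_Normal_Form.Gauss_Jordan_Elimination"
    "Jordan_Normal_Form.Matrix_Kernel"
    "Jordan_Normal_Form.VS_Connect"
begin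

definition l2_norm :: "real vec \<Rightarrow> real" where
  "l2_norm v = sqrt (v \<bullet> v)"

definition spectral_norm :: "real mat \<Rightarrow> real" where
  "spectral_norm M = Sup {l2_norm (M *\<^sub>v x) | x. x \<in> carrier_vec (dim_col M) \<and> l2_norm x \<le> 1}"

definition frobenius_norm :: "real mat \<Rightarrow> real" where
  "frobenius_norm M = sqrt (\<Sum>i<dim_row M. \<Sum>j<dim_col M. (M $$ (i,j))\<^sup>2)"

definition mat_trace :: "real mat \<Rightarrow> real" where
  "mat_trace M = (\<Sum>i<dim_row M. M $$ (i,i))"

definition outer_prod :: "real vec \<Rightarrow> real vec \<Rightarrow> real mat" where
  "outer_prod v w = mat (dim_vec v) (dim_vec w) (\<lambda>(i,j). v $ i * w $ j)"

(* Unspecified for singular M; only applied to matrices that are invertible. *)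
definition inv_mat :: "real mat \<Rightarrow> real mat" where
  "inv_mat M = the (mat_inverse M)"

definition sym_pos_def :: "nat \<Rightarrow> real mat \<Rightarrow> bool" where
  "sym_pos_def n M \<longleftrightarrow> M \<in> carrier_mat n n \<and> M\<^sup>T = M \<and>
     (\<forall>x \<in> carrier_vec n. x \<noteq> 0\<^sub>v n \<longrightarrow> 0 < x \<bullet> (M *\<^sub>v x))"

(* Unlike orthogonal_mat of Jordan_Normal_Form, this requires columns of norm 1. *)
definition orthonormal_cols :: "real mat \<Rightarrow> bool" where
  "orthonormal_cols M \<longleftrightarrow> M\<^sup>T * M = 1\<^sub>m (dim_col M)"

(* Real eigenvalues with algebraic multiplicity, in nonincreasing order; entry i (from 0)
   is the (i+1)-st largest. For a symmetric matrix these are all the eigenvalues. *)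
definition eigenvalues_desc :: "real mat \<Rightarrow> real list" where
  "eigenvalues_desc M = rev (sorted_list_of_multiset (proots (char_poly M)))"

(* m steps of the Lanczos iteration without breakdown before step m. The vectors q 1, q 2, ...
   are the Lanczos vectors; q 0 and \<beta> 0 are the usual zero initialisation of the three-term
   recurrence. If \<beta> m = 0 then q (m + 1) is any unit vector orthogonal to q 1, ..., q m. *)
definition lanczos ::
  "real mat \<Rightarrow> real vec \<Rightarrow> nat \<Rightarrow> (nat \<Rightarrow> real vec) \<Rightarrow> (nat \<Rightarrow> real) \<Rightarrow> (nat \<Rightarrow> real) \<Rightarrow> bool" where
  "lanczos A v_ref m q \<alpha> \<beta> \<longleftrightarrow>
     q 0 = 0\<^sub>v (dim_row A) \<and> \<beta> 0 = 0 \<and>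
     q 1 = (1 / l2_norm v_ref) \<cdot>\<^sub>v v_ref \<and>
     (\<forall>j \<in> {1..m}.
        let r = A *\<^sub>v q j - \<alpha> j \<cdot>\<^sub>v q j - \<beta> (j - 1) \<cdot>\<^sub>v q (j - 1) in
        \<alpha> j = q j \<bullet> (A *\<^sub>v q j) \<and>
        \<beta> j = l2_norm r \<and>
        (\<beta> j \<noteq> 0 \<longrightarrow> q (j + 1) = (1 / \<beta> j) \<cdot>\<^sub>v r)) \<and>
     (\<forall>j \<in> {1..<m}. \<beta> j \<noteq> 0) \<and>
     (\<beta> m = 0 \<longrightarrow> q (m + 1) \<in> carrier_vec (dim_row A) \<and> l2_norm (q (m + 1)) = 1 \<and>
        (\<forall>j \<in> {1..m}. q j \<bullet> q (m + 1) = 0))"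

end

theory Submission
  imports Defs "HOL-Analysis.L2_Norm" "HOL-Combinatorics.List_Permutation"
begin

text \<open>
  The Lanczos recurrence makes the coupling block \<open>Q\<^sup>T A Q\<^sub>\<bottom>\<close> the rank-one matrix
  \<open>\<beta>\<^sub>m e\<^sub>m e\<^sub>1\<^sup>T\<close>, so block elimination writes \<open>A\<^sup>-\<^sup>1\<close> as the first four terms of
  \<open>\<Sigma>\<^sub>m\<close> plus \<open>Q\<^sub>\<bottom> S\<^sup>-\<^sup>1 Q\<^sub>\<bottom>\<^sup>T\<close>. The error is therefore the difference of \<open>S\<^sup>-\<^sup>1\<close> and the
  mean-field matrix \<open>\<sigma> h h\<^sup>T + \<omega> (1 - h h\<^sup>T)\<close>, seen through the isometry \<open>Q\<^sub>\<bottom>\<close>.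
  In the basis \<open>[h V]\<close> its diagonal block is \<open>\<omega> - D\<close>, where \<open>D\<close> is a compression of \<open>S\<^sup>-\<^sup>1\<close> whose
  spectrum interlaces with that of \<open>S\<^sup>-\<^sup>1\<close> and has mean \<open>\<omega>\<close>, and its off-diagonal block is a standard deviation of the
  spectral measure of \<open>S\<^sup>-\<^sup>1\<close> at \<open>h\<close>. Popoviciu's inequality bounds this deviation and the one of the spectrum of \<open>D\<close>
  by half the length of \<open>[1/\<mu>\<^sub>1, 1/\<mu>\<^sub>n]\<close>, and that length is \<open>(\<kappa> - 1) / \<mu>\<^sub>1 \<le> \<omega> (\<kappa> - 1)\<close>.
\<close>

subsection \<open>Norms, isometries and matrix algebra\<close>

text \<open>The constants come from bounding the blocks of \<open>E\<close> separately. Let L be the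
  length of the interval. The off-diagonal blocks contribute at most ||c|| <= L/2 to the operator
  norm. For the diagonal block only |omega - delta_i| <= L is at hand, since omega is the mean of
  the delta_i and need not be the midpoint of the interval; together this gives 3/2. In the
  Frobenius norm the vector c occurs twice, and the d-m-1 squared deviations from the mean are on
  average at most (L/2)^2, which gives d-m+1 terms of that size. Replacing L by omega (kappa - 1)
  works because omega averages numbers that are all at least 1/mu_1. \<open>eigenvalues_desc\<close>
  is defined through the roots of the characteristic polynomial. To say anything about its i-th
  entry, an orthogonal diagonalisation is needed whose diagonal is in exactly that order; this is
  why the spectral theorem comes first and in a sorted form. \<open>spectral_norm\<close> is a
  supremum over reals, so even its lower bound ||c|| depends on having an upper bound
  beforehand.\<close>

lemma l2_norm_eq_L2_set:
  "l2_norm v = L2_set (\<lambda>i. v $ i) {..<dim_vec v}"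
  by (simp add: l2_norm_def L2_set_def scalar_prod_def power2_eq_square atLeast0LessThan)

lemma scalar_self_nonneg [simp]: "0 \<le> (v :: real vec) \<bullet> v"
  by (simp add: scalar_prod_def sum_nonneg)

lemma l2_norm_nonneg [simp]: "0 \<le> l2_norm v"
  by (simp add: l2_norm_def)

lemma l2_norm_sq: "(l2_norm v)\<^sup>2 = v \<bullet> v"
  by (simp add: l2_norm_def)

lemma scalar_self_eq_0_iff:
  assumes "(v :: real vec) \<in> carrier_vec n"
  shows "v \<bullet> v = 0 \<longleftrightarrow> v = 0\<^sub>v n"
  using assms by (auto simp: scalar_prod_def sum_nonneg_eq_0_iff intro!: eq_vecI)

lemma scalar_self_pos:
  assumes "(v :: real vec) \<in> carrier_vec n" "v \<noteq> 0\<^sub>v n"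
  shows "0 < v \<bullet> v"
  using scalar_self_eq_0_iff[OF assms(1)] assms(2) scalar_self_nonneg[of v] by linarith

lemma l2_norm_zero [simp]: "l2_norm (0\<^sub>v n) = 0"
  by (simp add: l2_norm_def)

lemma l2_norm_eq_0_iff: "v \<in> carrier_vec n \<Longrightarrow> l2_norm v = 0 \<longleftrightarrow> v = 0\<^sub>v n"
  by (simp add: l2_norm_def scalar_self_eq_0_iff)

lemma l2_norm_smult: "l2_norm (k \<cdot>\<^sub>v v) = \<bar>k\<bar> * l2_norm v"
  by (simp add: l2_norm_def real_sqrt_mult flip: mult.assoc)

lemma l2_norm_triangle:
  assumes "v \<in> carrier_vec n" "w \<in> carrier_vec n"
  shows "l2_norm (v + w) \<le> l2_norm v + l2_norm w"
  using assms L2_set_triangle_ineq[of "\<lambda>i. v $ i" "\<lambda>i. w $ i" "{..<n}"]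
  by (auto simp: l2_norm_eq_L2_set cong: L2_set_cong_simp)

lemma scalar_mult_mat_vec:
  assumes "(M :: real mat) \<in> carrier_mat k n" "x \<in> carrier_vec k" "y \<in> carrier_vec n"
  shows "x \<bullet> (M *\<^sub>v y) = (M\<^sup>T *\<^sub>v x) \<bullet> y"
  using transpose_vec_mult_scalar[OF assms(1,3,2)] by simp

lemma mult_mat_unit_vec:
  assumes "(M :: real mat) \<in> carrier_mat k n" "i < n"
  shows "M *\<^sub>v unit_vec n i = col M i"
  using assms by (auto intro!: eq_vecI)

lemma eq_mat_by_mult_vec:
  assumes "M \<in> carrier_mat k n" "(N :: real mat) \<in> carrier_mat k n"
    and "\<And>x. x \<in> carrier_vec n \<Longrightarrow> M *\<^sub>v x = N *\<^sub>v x"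
  shows "M = N"
proof (rule mat_col_eqI)
  fix i assume "i < dim_col N"
  then show "col M i = col N i"
    using assms(3)[of "unit_vec n i"] mult_mat_unit_vec[OF assms(1), of i] mult_mat_unit_vec[OF assms(2), of i] assms by auto
qed (use assms in auto)

subsection \<open>The spectral theorem for real symmetric matrices\<close>

text \<open>The fundamental theorem of algebra supplies an eigenvector x + iy over the complex
  numbers. Symmetry forces its eigenvalue to be real, and then whichever of x and y is nonzero is a
  real eigenvector.\<close>

lemma symmetric_eigenvector_exists:
  assumes B: "(B :: real mat) \<in> carrier_mat n n" and sym: "B\<^sup>T = B" and n: "0 < n"
  obtains v l where "v \<in> carrier_vec n" "v \<bullet> v = 1" "B *\<^sub>v v = l \<cdot>\<^sub>v v"
proof -
  let ?C = "map_mat complex_of_real B"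
  have C: "?C \<in> carrier_mat n n" using B by auto
  have "\<not> constant (poly (char_poly ?C))"
    using degree_monic_char_poly[OF C] n by (simp add: constant_degree)
  then obtain z where "poly (char_poly ?C) z = 0"
    using fundamental_theorem_of_algebra by blast
  then have "eigenvalue ?C z" using eigenvalue_root_char_poly[OF C] by simp
  then obtain w where w: "w \<in> carrier_vec n" "w \<noteq> 0\<^sub>v n" "?C *\<^sub>v w = z \<cdot>\<^sub>v w"
    using C by (auto simp: eigenvalue_def eigenvector_def)
  define x where "x = map_vec Re w"
  define y where "y = map_vec Im w"
  have x: "x \<in> carrier_vec n" and y: "y \<in> carrier_vec n"
    using w(1) by (auto simp: x_def y_def)
  have comp: "(\<Sum>j<n. complex_of_real (B $$ (i,j)) * w $ j) = z * w $ i" if "i < n" for i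
    using arg_cong[OF w(3), of "\<lambda>v. v $ i"] that B w(1)
    by (simp add: scalar_prod_def atLeast0LessThan)
  have Bx: "B *\<^sub>v x = Re z \<cdot>\<^sub>v x - Im z \<cdot>\<^sub>v y"
  proof (rule eq_vecI)
    fix i assume "i < dim_vec (Re z \<cdot>\<^sub>v x - Im z \<cdot>\<^sub>v y)"
    then show "(B *\<^sub>v x) $ i = (Re z \<cdot>\<^sub>v x - Im z \<cdot>\<^sub>v y) $ i"
      using arg_cong[OF comp, of i Re] B w(1) by (simp add: scalar_prod_def x_def y_def atLeast0LessThan)
  qed (use B x y in auto)
  have By: "B *\<^sub>v y = Re z \<cdot>\<^sub>v y + Im z \<cdot>\<^sub>v x"
  proof (rule eq_vecI)
    fix i assume "i < dim_vec (Re z \<cdot>\<^sub>v y + Im z \<cdot>\<^sub>v x)"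
    then show "(B *\<^sub>v y) $ i = (Re z \<cdot>\<^sub>v y + Im z \<cdot>\<^sub>v x) $ i"
      using arg_cong[OF comp, of i Im] B w(1) by (simp add: scalar_prod_def x_def y_def atLeast0LessThan)
  qed (use B x y in auto)
  have nz: "x \<noteq> 0\<^sub>v n \<or> y \<noteq> 0\<^sub>v n"
  proof (rule ccontr)
    assume neg: "\<not> (x \<noteq> 0\<^sub>v n \<or> y \<noteq> 0\<^sub>v n)"
    have "w $ i = 0" if "i < n" for i
    proof -
      have "x $ i = 0" "y $ i = 0" using neg that by auto
      then show ?thesis using that w(1) by (simp add: x_def y_def complex_eq_iff)
    qed
    then show False using w(1,2) by (auto intro: eq_vecI)
  qed
  \<comment> \<open>Inserting \<open>Bx\<close> and \<open>By\<close>, the terms with Re z agree on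
    both sides, while the terms with Im z add up to a multiple of |x|^2 + |y|^2 > 0.\<close>
  have "x \<bullet> (B *\<^sub>v y) = (B *\<^sub>v x) \<bullet> y"
    using scalar_mult_mat_vec[OF B x y] sym by simp
  then have "Im z * (x \<bullet> x + y \<bullet> y) = 0"
    unfolding Bx By using x y
    by (simp add: scalar_prod_add_distrib[of _ n] minus_scalar_prod_distrib[of _ n] algebra_simps comm_scalar_prod[of y n x])
  moreover have "x \<bullet> x + y \<bullet> y > 0"
    using nz scalar_self_pos[OF x] scalar_self_pos[OF y]
    by (metis add_nonneg_pos add_pos_nonneg scalar_self_nonneg)
  ultimately have "Im z = 0" by simp
  then have "B *\<^sub>v x = Re z \<cdot>\<^sub>v x" "B *\<^sub>v y = Re z \<cdot>\<^sub>v y"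
    using Bx By x y by auto
  then obtain v where v: "v \<in> carrier_vec n" "v \<noteq> 0\<^sub>v n" "B *\<^sub>v v = Re z \<cdot>\<^sub>v v"
    using nz x y by blast
  have "l2_norm v \<noteq> 0" using v l2_norm_eq_0_iff by blast
  show ?thesis
  proof (rule that[of "(1 / l2_norm v) \<cdot>\<^sub>v v" "Re z"])
    show "((1 / l2_norm v) \<cdot>\<^sub>v v) \<bullet> ((1 / l2_norm v) \<cdot>\<^sub>v v) = 1"
      using \<open>l2_norm v \<noteq> 0\<close> by (simp add: l2_norm_smult flip: l2_norm_sq)
    show "B *\<^sub>v ((1 / l2_norm v) \<cdot>\<^sub>v v) = Re z \<cdot>\<^sub>v ((1 / l2_norm v) \<cdot>\<^sub>v v)"
      using v B by (simp add: mult_mat_vec smult_smult_assoc mult.commute)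
  qed (use v in auto)
qed

text \<open>The reflection in the hyperplane orthogonal to v - e_0 exchanges the two unit vectors.
  Being symmetric and its own inverse, it is a convenient change of basis for deflation.\<close>

lemma householder_reflection:
  assumes v: "(v :: real vec) \<in> carrier_vec n" "v \<bullet> v = 1" and n: "0 < n"
  obtains H where "H \<in> carrier_mat n n" "H\<^sup>T = H" "H * H = 1\<^sub>m n" "H *\<^sub>v unit_vec n 0 = v"
proof (cases "v = unit_vec n 0")
  case True
  then show ?thesis by (intro that[of "1\<^sub>m n"]) auto
next
  case False
  define w where "w = v - unit_vec n 0"
  define k where "k = 2 / (w \<bullet> w)"
  define H where "H = 1\<^sub>m n - k \<cdot>\<^sub>m outer_prod w w"
  have w: "w \<in> carrier_vec n" using v by (simp add: w_def)
  have "w \<noteq> 0\<^sub>v n"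
  proof
    assume w0: "w = 0\<^sub>v n"
    have "v $ i = unit_vec n 0 $ i" if "i < n" for i
    proof -
      have "w $ i = 0" using that by (simp add: w0)
      then show ?thesis using that v(1) by (cases "i = 0") (auto simp: w_def)
    qed
    then show False using False v(1) by (auto intro: eq_vecI)
  qed
  then have ww: "0 < w \<bullet> w" using w by (rule scalar_self_pos[rotated])
  have H: "H \<in> carrier_mat n n" using w by (auto simp: H_def outer_prod_def)
  have Hx: "H *\<^sub>v x = x - (k * (w \<bullet> x)) \<cdot>\<^sub>v w" if x: "x \<in> carrier_vec n" for x
  proof (rule eq_vecI)
    fix i assume i: "i < dim_vec (x - (k * (w \<bullet> x)) \<cdot>\<^sub>v w)"
    have "(H *\<^sub>v x) $ i = (\<Sum>j<n. (if i = j then x $ j else 0) - k * w $ i * (w $ j * x $ j))"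
      using i x w H by (auto simp: H_def outer_prod_def scalar_prod_def atLeast0LessThan left_diff_distrib intro!: sum.cong)
    also have "\<dots> = x $ i - k * w $ i * (\<Sum>j<n. w $ j * x $ j)"
      using i w by (simp add: sum_subtractf sum_distrib_left)
    finally show "(H *\<^sub>v x) $ i = (x - (k * (w \<bullet> x)) \<cdot>\<^sub>v w) $ i"
      using i x w by (simp add: scalar_prod_def atLeast0LessThan)
  qed (use x H w in auto)
  have "H * H = 1\<^sub>m n"
  proof (rule eq_mat_by_mult_vec[of _ n n])
    fix x :: "real vec" assume x: "x \<in> carrier_vec n"
    have "w \<bullet> (x - (k * (w \<bullet> x)) \<cdot>\<^sub>v w) = - (w \<bullet> x)"
      using x w ww by (simp add: scalar_prod_minus_distrib[of _ n] k_def)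
    then have "H *\<^sub>v (H *\<^sub>v x) = x"
      using x w Hx[OF x] Hx[of "x - (k * (w \<bullet> x)) \<cdot>\<^sub>v w"] by (auto intro!: eq_vecI)
    then show "H * H *\<^sub>v x = 1\<^sub>m n *\<^sub>v x" using H x by (simp add: assoc_mult_mat_vec[of _ n n _ n])
  qed (use H in auto)
  moreover have "H\<^sup>T = H" using w by (auto simp: H_def outer_prod_def intro!: eq_matI)
  moreover have "H *\<^sub>v unit_vec n 0 = v"
  proof -
    \<comment> \<open>Both \<open>v\<close> and e_0 have norm 1, so w.w = -2 (w.e_0). The
      coefficient of \<open>w\<close> in H e_0 is then +1, and e_0 + w = v.\<close>
    have "w \<bullet> w = 2 - 2 * v $ 0"
      using v n unfolding w_def
      by (simp add: scalar_prod_minus_distrib[of _ n] minus_scalar_prod_distrib[of _ n] )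
    moreover have "w \<bullet> unit_vec n 0 = v $ 0 - 1"
      using v n unfolding w_def by (simp add: minus_scalar_prod_distrib[of _ n])
    ultimately have "k * (w \<bullet> unit_vec n 0) = - 1"
      using ww by (simp add: k_def field_simps)
    then show ?thesis using Hx[of "unit_vec n 0"] w v by (auto simp: w_def intro!: eq_vecI)
  qed
  ultimately show ?thesis using H by (intro that)
qed

text \<open>Deflation: conjugating by the reflection \<open>H\<close> that takes e_0 to a unit
  eigenvector clears the first column, and by symmetry the first row, off the diagonal. The
  induction hypothesis applies to the remaining block \<open>C'\<close>; its eigenvectors are padded
  with a leading 0 and carried back by \<open>H\<close>.\<close>

lemma symmetric_orthonormal_eigenvectors:
  fixes B :: "real mat"
  assumes "B \<in> carrier_mat n n" "B\<^sup>T = B"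
  shows "\<exists>v l. (\<forall>i<n. v i \<in> carrier_vec n \<and> B *\<^sub>v v i = l i \<cdot>\<^sub>v v i) \<and>
    (\<forall>i<n. \<forall>j<n. v i \<bullet> v j = (if i = j then 1 else 0))"
  using assms
proof (induction n arbitrary: B)
  case 0
  then show ?case by auto
next
  case (Suc n B)
  note B = Suc.prems(1) and sym = Suc.prems(2)
  obtain v0 l0 where v0: "v0 \<in> carrier_vec (Suc n)" "v0 \<bullet> v0 = 1" "B *\<^sub>v v0 = l0 \<cdot>\<^sub>v v0"
    using symmetric_eigenvector_exists[OF B sym] by blast
  obtain H where H: "H \<in> carrier_mat (Suc n) (Suc n)" "H\<^sup>T = H" "H * H = 1\<^sub>m (Suc n)"
    "H *\<^sub>v unit_vec (Suc n) 0 = v0"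
    using householder_reflection[OF v0(1,2)] by blast
  define C where "C = H * B * H"
  define C' where "C' = mat n n (\<lambda>(i,j). C $$ (Suc i, Suc j))"
  have C: "C \<in> carrier_mat (Suc n) (Suc n)" using H(1) B by (simp add: C_def)
  have HH: "H *\<^sub>v (H *\<^sub>v x) = x" if "x \<in> carrier_vec (Suc n)" for x
    using H that by (simp flip: assoc_mult_mat_vec[of _ "Suc n" "Suc n"])
  have Hsc: "(H *\<^sub>v x) \<bullet> (H *\<^sub>v y) = x \<bullet> y" if "x \<in> carrier_vec (Suc n)" "y \<in> carrier_vec (Suc n)" for x y
    using scalar_mult_mat_vec[OF H(1), of "H *\<^sub>v x" y] that H HH by simp
  have C_sym: "C\<^sup>T = C"
    using H B sym by (simp add: C_def transpose_mult[of _ "Suc n" "Suc n" _ "Suc n"]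
        assoc_mult_mat[of _ "Suc n" "Suc n" _ "Suc n" _ "Suc n"])
  have "C *\<^sub>v unit_vec (Suc n) 0 = H *\<^sub>v (B *\<^sub>v v0)"
    using H B v0 by (simp add: C_def assoc_mult_mat_vec[of _ "Suc n" "Suc n" _ "Suc n"])
  also have "\<dots> = l0 \<cdot>\<^sub>v unit_vec (Suc n) 0"
    using HH[of "unit_vec (Suc n) 0"] H v0 by (simp add: mult_mat_vec[of _ "Suc n" "Suc n"])
  finally have col0: "C $$ (i, 0) = (if i = 0 then l0 else 0)" if "i < Suc n" for i
    using that mult_mat_unit_vec[OF C, of 0] C by (auto dest: arg_cong[of _ _ "\<lambda>v. v $ i"])
  have row0: "C $$ (0, j) = (if j = 0 then l0 else 0)" if "j < Suc n" for j
    using arg_cong[OF C_sym, of "\<lambda>M. M $$ (j,0)"] that C col0[of j] by simp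
  have C': "C' \<in> carrier_mat n n" by (simp add: C'_def)
  have "C'\<^sup>T = C'"
  proof (rule eq_matI)
    fix i j assume "i < dim_row C'" "j < dim_col C'"
    then show "C'\<^sup>T $$ (i,j) = C' $$ (i,j)"
      using arg_cong[OF C_sym, of "\<lambda>M. M $$ (Suc i, Suc j)"] C by (simp add: C'_def)
  qed (auto simp: C'_def)
  then obtain v l where vl: "\<And>i. i < n \<Longrightarrow> v i \<in> carrier_vec n" "\<And>i. i < n \<Longrightarrow> C' *\<^sub>v v i = l i \<cdot>\<^sub>v v i"
      "\<And>i j. i < n \<Longrightarrow> j < n \<Longrightarrow> v i \<bullet> v j = (if i = j then 1 else 0)"
    using Suc.IH[OF C'] by blast
  have Cv: "C *\<^sub>v vCons 0 x = vCons 0 (C' *\<^sub>v x)" if "x \<in> carrier_vec n" for x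
  proof (rule eq_vecI)
    fix i assume i: "i < dim_vec (vCons 0 (C' *\<^sub>v x))"
    then have "(C *\<^sub>v vCons 0 x) $ i = (\<Sum>j<n. C $$ (i, Suc j) * x $ j)"
      using C that C' by (simp add: scalar_prod_def atLeast0LessThan sum.lessThan_Suc_shift del: sum.lessThan_Suc)
    also have "\<dots> = vCons 0 (C' *\<^sub>v x) $ i"
      using i that row0 by (cases i) (auto simp: C'_def scalar_prod_def atLeast0LessThan vec_index_vCons)
    finally show "(C *\<^sub>v vCons 0 x) $ i = vCons 0 (C' *\<^sub>v x) $ i" .
  qed (use C C' in auto)
  define w where "w i = (case i of 0 \<Rightarrow> unit_vec (Suc n) 0 | Suc i \<Rightarrow> vCons 0 (v i))" for i
  define k where "k i = (case i of 0 \<Rightarrow> l0 | Suc i \<Rightarrow> l i)" for i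
  have u0: "unit_vec (Suc n) 0 = vCons (1::real) (0\<^sub>v n)"
    by (rule eq_vecI) (auto simp: vec_index_vCons)
  have w: "w i \<in> carrier_vec (Suc n)" if "i < Suc n" for i
    using that vl(1) by (auto simp: w_def split: nat.split)
  have Cw: "C *\<^sub>v w i = k i \<cdot>\<^sub>v w i" if "i < Suc n" for i
  proof (cases i)
    case 0
    then show ?thesis using \<open>C *\<^sub>v unit_vec (Suc n) 0 = H *\<^sub>v (B *\<^sub>v v0)\<close> \<open>H *\<^sub>v (B *\<^sub>v v0) = l0 \<cdot>\<^sub>v unit_vec (Suc n) 0\<close>
      by (simp add: w_def k_def)
  next
    case (Suc j)
    then show ?thesis using Cv vl that
      by (auto simp: w_def k_def vec_index_vCons intro!: eq_vecI)
  qed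
  have ww: "w i \<bullet> w j = (if i = j then 1 else 0)" if "i < Suc n" "j < Suc n" for i j
    using that vl(1,3) by (auto simp: w_def u0 split: nat.splits)
  have BH: "B *\<^sub>v (H *\<^sub>v x) = H *\<^sub>v (C *\<^sub>v x)" if "x \<in> carrier_vec (Suc n)" for x
    using H B that HH by (simp add: C_def assoc_mult_mat_vec[of _ "Suc n" "Suc n" _ "Suc n"])
  show ?case
    apply (intro exI[of _ "\<lambda>i. H *\<^sub>v w i"] exI[of _ k])
    using w ww Hsc H BH Cw by (auto simp: mult_mat_vec[of _ "Suc n" "Suc n"])
qed

lemma isometry_scalar_prod:
  assumes "(M :: real mat) \<in> carrier_mat k n" "M\<^sup>T * M = 1\<^sub>m n" "x \<in> carrier_vec n" "y \<in> carrier_vec n"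
  shows "(M *\<^sub>v x) \<bullet> (M *\<^sub>v y) = x \<bullet> y"
  using scalar_mult_mat_vec[of M k n "M *\<^sub>v x" y] assms
  by (simp flip: assoc_mult_mat_vec[of _ n k])

lemma isometry_l2_norm:
  assumes "M \<in> carrier_mat k n" "M\<^sup>T * M = 1\<^sub>m n" "x \<in> carrier_vec n"
  shows "l2_norm (M *\<^sub>v x) = l2_norm x"
  using isometry_scalar_prod[OF assms assms(3)] by (simp add: l2_norm_def)

text \<open>\<open>M M\<^sup>T x\<close> is the orthogonal projection of x, and |x - M M^T x|^2 =
  |x|^2 - |M^T x|^2 is nonnegative.\<close>

lemma isometry_transpose_l2_norm_le:
  assumes M: "M \<in> carrier_mat k n" "M\<^sup>T * M = 1\<^sub>m n" and x: "x \<in> carrier_vec k"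
  shows "l2_norm (M\<^sup>T *\<^sub>v x) \<le> l2_norm x"
proof -
  define y where "y = M\<^sup>T *\<^sub>v x"
  have y: "y \<in> carrier_vec n" using M x by (simp add: y_def)
  have My: "M *\<^sub>v y \<in> carrier_vec k" using M y by simp
  have a: "(M *\<^sub>v y) \<bullet> (M *\<^sub>v y) = y \<bullet> y" using isometry_scalar_prod[OF M y y] .
  have b: "x \<bullet> (M *\<^sub>v y) = y \<bullet> y"
    using scalar_mult_mat_vec[OF M(1) x y] by (simp add: y_def)
  have "0 \<le> (x - M *\<^sub>v y) \<bullet> (x - M *\<^sub>v y)" by simp
  also have "\<dots> = x \<bullet> x - y \<bullet> y"
    using x My a b comm_scalar_prod[OF x My]
    by (simp add: scalar_prod_minus_distrib[of _ k] minus_scalar_prod_distrib[of _ k])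
  finally show ?thesis by (simp add: l2_norm_def y_def)
qed

lemma trace_mult_comm:
  assumes "A \<in> carrier_mat n k" "B \<in> carrier_mat k n"
  shows "mat_trace (A * B) = mat_trace (B * A)"
proof -
  have "mat_trace (A * B) = (\<Sum>i<n. \<Sum>j<k. A $$ (i,j) * B $$ (j,i))"
    using assms by (simp add: mat_trace_def scalar_prod_def atLeast0LessThan)
  also have "\<dots> = (\<Sum>j<k. \<Sum>i<n. B $$ (j,i) * A $$ (i,j))"
    by (subst sum.swap) (simp add: mult.commute)
  also have "\<dots> = mat_trace (B * A)"
    using assms by (simp add: mat_trace_def scalar_prod_def atLeast0LessThan)
  finally show ?thesis .
qed

lemma frobenius_norm_eq_trace:
  "frobenius_norm M = sqrt (mat_trace (M\<^sup>T * M))"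
  unfolding frobenius_norm_def mat_trace_def
  by (simp add: scalar_prod_def atLeast0LessThan power2_eq_square) (rule sum.swap)

text \<open>The diagonal \<open>l\<close> is a function in arbitrary order, so that one
  \<open>U\<close> can diagonalise a matrix, its inverse and its shifts at once, although these sort
  their eigenvalues differently.\<close>

definition spectral_decomp :: "nat \<Rightarrow> real mat \<Rightarrow> real mat \<Rightarrow> (nat \<Rightarrow> real) \<Rightarrow> bool" where
  "spectral_decomp n B U l \<longleftrightarrow> U \<in> carrier_mat n n \<and> U\<^sup>T * U = 1\<^sub>m n \<and> U * U\<^sup>T = 1\<^sub>m n \<and>
     B = U * mat_diag n l * U\<^sup>T"

lemma mat_diag_mult_vec:
  "x \<in> carrier_vec n \<Longrightarrow> mat_diag n l *\<^sub>v x = vec n (\<lambda>i. l i * x $ i)" for l :: "nat \<Rightarrow> real"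
  by (rule eq_vecI) (auto simp: mat_diag_def scalar_prod_def if_distrib[of "\<lambda>a. a * _"] cong: if_cong)

lemma diag_mat_mat_diag: "diag_mat (mat_diag n l) = map l [0..<n]"
  by (auto simp: diag_mat_def mat_diag_def)

text \<open>Similar matrices share their characteristic polynomial, and that of a diagonal matrix is
  a product of linear factors whose multiset of roots can be read off. This links
  \<open>eigenvalues_desc\<close> to any orthogonal diagonalisation.\<close>

lemma eigenvalues_desc_spectral:
  assumes "spectral_decomp n B U l"
  shows "eigenvalues_desc B = rev (sort (map l [0..<n]))"
proof -
  have "similar_mat B (mat_diag n l)"
    using assms by (intro similar_matI[of _ _ U "U\<^sup>T" n]) (auto simp: spectral_decomp_def)
  then have "char_poly B = char_poly (mat_diag n l)" by (rule char_poly_similar)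
  also have "\<dots> = (\<Prod>a\<leftarrow>map l [0..<n]. [:- a, 1:])"
    using char_poly_upper_triangular[of "mat_diag n l" n]
    by (simp add: diag_mat_mat_diag) (auto simp: upper_triangular_def mat_diag_def)
  finally have *: "char_poly B = (\<Prod>a\<leftarrow>map l [0..<n]. [:- a, 1:])" .
  have "proots (\<Prod>a\<leftarrow>as. [:- a, 1:]) = mset as" for as :: "real list"
  proof (induction as)
    case (Cons a as)
    have "(\<Prod>a\<leftarrow>as. [:- a, 1:]) \<noteq> 0" by (auto simp: prod_list_zero_iff)
    then show ?case using Cons by (simp add: proots_mult del: mult_pCons_left)
  qed auto
  then show ?thesis by (simp only: eigenvalues_desc_def * sorted_list_of_multiset_mset)
qed

lemma spectral_mult_vec:
  assumes "spectral_decomp n B U l" "x \<in> carrier_vec n"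
  shows "B *\<^sub>v x = U *\<^sub>v vec n (\<lambda>i. l i * (U\<^sup>T *\<^sub>v x) $ i)"
  using assms mat_diag_mult_vec[of "U\<^sup>T *\<^sub>v x" n l]
  by (auto simp: spectral_decomp_def assoc_mult_mat_vec[of _ n n _ n])

text \<open>The squared coordinates of \<open>U\<^sup>T x\<close> are the weights of the spectral
  measure of \<open>B\<close> at x; the three sums are its first, second and zeroth moments.\<close>

lemma spectral_quadratic_form:
  assumes sd: "spectral_decomp n B U l" and x: "x \<in> carrier_vec n"
  shows "x \<bullet> (B *\<^sub>v x) = (\<Sum>i<n. l i * ((U\<^sup>T *\<^sub>v x) $ i)\<^sup>2)"
    and "(B *\<^sub>v x) \<bullet> (B *\<^sub>v x) = (\<Sum>i<n. (l i)\<^sup>2 * ((U\<^sup>T *\<^sub>v x) $ i)\<^sup>2)"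
    and "x \<bullet> x = (\<Sum>i<n. ((U\<^sup>T *\<^sub>v x) $ i)\<^sup>2)"
proof -
  have U: "U \<in> carrier_mat n n" "U\<^sup>T * U = 1\<^sub>m n" "U * U\<^sup>T = 1\<^sub>m n" using sd by (auto simp: spectral_decomp_def)
  have x': "U *\<^sub>v (U\<^sup>T *\<^sub>v x) = x" using U x by (simp flip: assoc_mult_mat_vec[of _ n n])
  have *: "(U *\<^sub>v y) \<bullet> (U *\<^sub>v z) = y \<bullet> z" if "y \<in> carrier_vec n" "z \<in> carrier_vec n" for y z
    using isometry_scalar_prod[OF U(1,2) that] .
  show "x \<bullet> (B *\<^sub>v x) = (\<Sum>i<n. l i * ((U\<^sup>T *\<^sub>v x) $ i)\<^sup>2)"
    using *[of "U\<^sup>T *\<^sub>v x" "vec n (\<lambda>i. l i * (U\<^sup>T *\<^sub>v x) $ i)"] U x x' spectral_mult_vec[OF sd x]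
    by (simp add: scalar_prod_def atLeast0LessThan power2_eq_square mult_ac)
  show "(B *\<^sub>v x) \<bullet> (B *\<^sub>v x) = (\<Sum>i<n. (l i)\<^sup>2 * ((U\<^sup>T *\<^sub>v x) $ i)\<^sup>2)"
    using U x spectral_mult_vec[OF sd x]
    by (simp add: *) (simp add: scalar_prod_def atLeast0LessThan power2_eq_square mult_ac)
  show "x \<bullet> x = (\<Sum>i<n. ((U\<^sup>T *\<^sub>v x) $ i)\<^sup>2)"
    using *[of "U\<^sup>T *\<^sub>v x" "U\<^sup>T *\<^sub>v x"] U x x'
    by (simp add: scalar_prod_def atLeast0LessThan power2_eq_square)
qed

lemma spectral_trace:
  assumes sd: "spectral_decomp n B U l"
  shows "mat_trace B = (\<Sum>i<n. l i)"
proof -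
  have U: "U \<in> carrier_mat n n" "U\<^sup>T * U = 1\<^sub>m n" "B = U * mat_diag n l * U\<^sup>T"
    using sd by (auto simp: spectral_decomp_def)
  have "mat_trace B = mat_trace (U\<^sup>T * (U * mat_diag n l))"
    using trace_mult_comm[of "U * mat_diag n l" n n "U\<^sup>T"] U by (simp add: mult_carrier_mat[of _ n n])
  also have "U\<^sup>T * (U * mat_diag n l) = mat_diag n l"
    using assoc_mult_mat[of "U\<^sup>T" n n U n "mat_diag n l" n] U left_mult_one_mat[OF mat_diag_dim[of n l]] by simp
  also have "mat_trace (mat_diag n l) = (\<Sum>i<n. l i)" by (simp add: mat_trace_def mat_diag_def)
  finally show ?thesis .
qed

text \<open>Permuting an orthonormal eigenbasis puts its eigenvalues into nonincreasing order. Only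
  then can the i-th column be associated with the i-th entry of
  \<open>eigenvalues_desc\<close>.\<close>

lemma symmetric_spectral_decomp:
  assumes B: "(B :: real mat) \<in> carrier_mat n n" "B\<^sup>T = B"
  shows "\<exists>U. spectral_decomp n B U (\<lambda>i. eigenvalues_desc B ! i)"
    and "length (eigenvalues_desc B) = n"
    and "\<And>i j. i \<le> j \<Longrightarrow> j < n \<Longrightarrow> eigenvalues_desc B ! j \<le> eigenvalues_desc B ! i"
proof -
  obtain v l where vl: "\<And>i. i < n \<Longrightarrow> v i \<in> carrier_vec n" "\<And>i. i < n \<Longrightarrow> B *\<^sub>v v i = l i \<cdot>\<^sub>v v i"
      "\<And>i j. i < n \<Longrightarrow> j < n \<Longrightarrow> v i \<bullet> v j = (if i = j then 1 else 0)"
    using symmetric_orthonormal_eigenvectors[OF B] by blast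
  define es where "es = map l [0..<n]"
  define s where "s = rev (sort es)"
  have len: "length s = n" "length es = n" by (auto simp: s_def es_def)
  \<comment> \<open>Equal multisets yield the bijection \<open>f\<close> that sorts the eigenvalues;
    \<open>U\<close> takes its columns in the order given by \<open>f\<close>.\<close>
  have "mset s = mset es" by (simp add: s_def)
  then obtain f where f: "bij_betw f {..<n} {..<n}" "\<And>i. i < n \<Longrightarrow> s ! i = es ! (f i)"
    using permutation_Ex_bij[of s es] len by auto
  have fn: "f i < n" if "i < n" for i using f(1) that by (auto simp: bij_betw_def)
  have finj: "f i = f j \<longleftrightarrow> i = j" if "i < n" "j < n" for i j
    using f(1) that by (auto simp: bij_betw_def inj_on_def)
  have sl: "s ! i = l (f i)" if "i < n" for i using f(2)[OF that] fn[OF that] by (simp add: es_def)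
  define U where "U = mat n n (\<lambda>(i,j). v (f j) $ i)"
  have U: "U \<in> carrier_mat n n" by (simp add: U_def)
  have colU: "col U j = v (f j)" if "j < n" for j
    using that vl(1)[OF fn[OF that]] by (auto simp: U_def intro!: eq_vecI)
  have UU: "U\<^sup>T * U = 1\<^sub>m n"
    by (rule eq_matI) (use U colU vl(3) fn finj in auto)
  have UU': "U * U\<^sup>T = 1\<^sub>m n"
    using mat_mult_left_right_inverse[OF _ U UU] U by simp
  have "B * U = U * mat_diag n (\<lambda>i. s ! i)"
  proof (rule eq_matI)
    fix i j assume "i < dim_row (U * mat_diag n (\<lambda>i. s ! i))" "j < dim_col (U * mat_diag n (\<lambda>i. s ! i))"
    then have ij: "i < n" "j < n" using U by (auto simp: mat_diag_def)
    have "(B * U) $$ (i,j) = (B *\<^sub>v v (f j)) $ i" using ij B U colU by simp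
    also have "\<dots> = v (f j) $ i * s ! j" using ij vl(1)[OF fn[OF ij(2)]] vl(2)[OF fn[OF ij(2)]] sl by simp
    also have "\<dots> = (U * mat_diag n (\<lambda>i. s ! i)) $$ (i,j)"
      using ij by (simp add: mat_diag_mult_right[OF U]) (simp add: U_def)
    finally show "(B * U) $$ (i,j) = (U * mat_diag n (\<lambda>i. s ! i)) $$ (i,j)" .
  qed (use B U in \<open>auto simp: mat_diag_def\<close>)
  then have "B * U * U\<^sup>T = U * mat_diag n (\<lambda>i. s ! i) * U\<^sup>T" by simp
  then have "B = U * mat_diag n (\<lambda>i. s ! i) * U\<^sup>T"
    using B U UU' by (simp add: assoc_mult_mat[of B n n U n "U\<^sup>T" n])
  then have sd: "spectral_decomp n B U (\<lambda>i. s ! i)" using U UU UU' by (simp add: spectral_decomp_def)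
  have "map (\<lambda>i. s ! i) [0..<n] = s" using map_nth[of s] len by simp
  moreover have "sort s = sort es"
    by (rule properties_for_sort) (simp_all add: s_def)
  ultimately have *: "eigenvalues_desc B = s"
    using eigenvalues_desc_spectral[OF sd] by (simp only: s_def)
  show "\<exists>U. spectral_decomp n B U (\<lambda>i. eigenvalues_desc B ! i)" using sd * by auto
  show "length (eigenvalues_desc B) = n" using * len by simp
  show "eigenvalues_desc B ! j \<le> eigenvalues_desc B ! i" if "i \<le> j" "j < n" for i j
  proof -
    have "sorted_wrt (\<ge>) s" unfolding s_def by (simp add: sorted_wrt_rev)
    then show ?thesis using that len * by (cases "i = j") (auto simp: sorted_wrt_iff_nth_less)
  qed
qed

subsection \<open>Cauchy interlacing\<close>

text \<open>A homogeneous system with more unknowns than equations. This replaces the count of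
  intersecting subspaces in the min-max argument: support in \<open>I\<close> and zeros on
  \<open>K\<close> stand for membership in the two subspaces.\<close>

lemma exists_supported_vector_with_zeros:
  assumes G: "(G :: real mat) \<in> carrier_mat n k" and I: "I \<subseteq> {..<k}" and K: "K \<subseteq> {..<n}"
    and card: "card K < card I"
  obtains y where "y \<in> carrier_vec k" "y \<noteq> 0\<^sub>v k" "\<And>c. c < k \<Longrightarrow> c \<notin> I \<Longrightarrow> y $ c = 0"
    "\<And>r. r \<in> K \<Longrightarrow> (G *\<^sub>v y) $ r = 0"
proof -
  have fin: "finite I" "finite K" using I K finite_subset by auto
  then obtain f where f: "f ` K \<subseteq> I" "inj_on f K" using card_le_inj[of K I] card by auto
  have "f ` K \<noteq> I" using card card_image[OF f(2)] by auto
  then obtain a where a: "a \<in> I" "a \<notin> f ` K" using f by auto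
  define M where "M = mat k k (\<lambda>(b,c). if b \<notin> I then if b = c then 1 else 0
    else if b \<in> f ` K then G $$ (inv_into K f b, c) else 0)"
  have M: "M \<in> carrier_mat k k" by (simp add: M_def)
  have ak: "a < k" using a I by auto
  have "row M a = 0\<^sub>v k" using a ak by (auto simp: M_def)
  have "det (M\<^sup>T) = 0"
  proof -
    have "M\<^sup>T *\<^sub>v unit_vec k a = 0\<^sub>v k"
      using mult_mat_unit_vec[of "M\<^sup>T" k k a] ak M \<open>row M a = 0\<^sub>v k\<close> by simp
    then show ?thesis using det_0_iff_vec_prod_zero[of "M\<^sup>T" k] M ak
      by (metis transpose_carrier_mat unit_vec_carrier unit_vec_nonzero)
  qed
  then have "det M = 0" using det_transpose[OF M] by simp
  then obtain y where y: "y \<in> carrier_vec k" "y \<noteq> 0\<^sub>v k" "M *\<^sub>v y = 0\<^sub>v k"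
    using det_0_iff_vec_prod_zero[OF M] by auto
  have row: "row M b \<bullet> y = 0" if "b < k" for b
    using arg_cong[OF y(3), of "\<lambda>v. v $ b"] that M by simp
  show ?thesis
  proof (rule that[OF y(1,2)])
    fix c assume c: "c < k" "c \<notin> I"
    then have "row M c = unit_vec k c" by (auto simp: M_def)
    then show "y $ c = 0" using row[OF c(1)] c y(1) by simp
  next
    fix r assume r: "r \<in> K"
    then have fr: "f r < k" "f r \<in> I" using f I by auto
    have "row M (f r) = row G r"
      by (rule eq_vecI) (use r fr f(2) G K in \<open>auto simp: M_def inv_into_f_f\<close>)
    then show "(G *\<^sub>v y) $ r = 0" using row[OF fr(1)] r K G by auto
  qed
qed

text \<open>In eigencoordinates of both matrices, \<open>G\<close> is an isometry taking the
  diagonal form of \<open>t\<close> to that of \<open>l\<close>. A nonzero y chosen with suitable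
  zeros in y and in \<open>G y\<close> lets the two forms be compared with a single eigenvalue on
  each side.\<close>

lemma cauchy_interlacing:
  assumes B: "spectral_decomp n B U l" and V: "V \<in> carrier_mat n k" "V\<^sup>T * V = 1\<^sub>m k"
    and D: "spectral_decomp k (V\<^sup>T * B * V) Z t"
    and l: "\<And>i j. i \<le> j \<Longrightarrow> j < n \<Longrightarrow> l j \<le> l i" and t: "\<And>i j. i \<le> j \<Longrightarrow> j < k \<Longrightarrow> t j \<le> t i"
    and i: "i < k" and kn: "k \<le> n"
  shows "t i \<le> l i" "l (n - k + i) \<le> t i"
proof -
  have U: "U \<in> carrier_mat n n" "U\<^sup>T * U = 1\<^sub>m n" "U * U\<^sup>T = 1\<^sub>m n" and Bc: "B \<in> carrier_mat n n"
    using B by (auto simp: spectral_decomp_def)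
  have Z: "Z \<in> carrier_mat k k" "Z\<^sup>T * Z = 1\<^sub>m k" using D by (auto simp: spectral_decomp_def)
  define G where "G = U\<^sup>T * (V * Z)"
  have G: "G \<in> carrier_mat n k" using U V Z by (simp add: G_def)
  have eq: "(\<Sum>c<k. t c * (y $ c)\<^sup>2) = (\<Sum>r<n. l r * ((G *\<^sub>v y) $ r)\<^sup>2)"
    "(\<Sum>c<k. (y $ c)\<^sup>2) = (\<Sum>r<n. ((G *\<^sub>v y) $ r)\<^sup>2)" if y: "y \<in> carrier_vec k" for y
  proof -
    define z where "z = Z *\<^sub>v y"
    have z: "z \<in> carrier_vec k" "Z\<^sup>T *\<^sub>v z = y"
      using Z y assoc_mult_mat_vec[of "Z\<^sup>T" k k Z k y] by (auto simp: z_def)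
    have "G *\<^sub>v y = U\<^sup>T *\<^sub>v (V * Z *\<^sub>v y)"
      unfolding G_def by (rule assoc_mult_mat_vec[of _ n n _ k]) (use U V Z y in auto)
    also have "V * Z *\<^sub>v y = V *\<^sub>v z"
      unfolding z_def by (rule assoc_mult_mat_vec[of _ n k _ k]) (use V Z y in auto)
    finally have Gy: "G *\<^sub>v y = U\<^sup>T *\<^sub>v (V *\<^sub>v z)" .
    have Vz: "V *\<^sub>v z \<in> carrier_vec n" using V z by simp
    have "V\<^sup>T * B * V *\<^sub>v z = V\<^sup>T *\<^sub>v (B *\<^sub>v (V *\<^sub>v z))"
      using V Bc z mult_carrier_mat[OF Bc V(1)]
      by (simp add: assoc_mult_mat_vec[of "V\<^sup>T" k n "B * V" k])
    then have "z \<bullet> (V\<^sup>T * B * V *\<^sub>v z) = (V *\<^sub>v z) \<bullet> (B *\<^sub>v (V *\<^sub>v z))"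
      using scalar_mult_mat_vec[of "V\<^sup>T" k n z "B *\<^sub>v (V *\<^sub>v z)"] V Bc z by simp
    then show "(\<Sum>c<k. t c * (y $ c)\<^sup>2) = (\<Sum>r<n. l r * ((G *\<^sub>v y) $ r)\<^sup>2)"
      using spectral_quadratic_form(1)[OF D z(1)] spectral_quadratic_form(1)[OF B Vz] unfolding z(2) Gy by simp
    show "(\<Sum>c<k. (y $ c)\<^sup>2) = (\<Sum>r<n. ((G *\<^sub>v y) $ r)\<^sup>2)"
      using spectral_quadratic_form(3)[OF D z(1)] spectral_quadratic_form(3)[OF B Vz]
        isometry_scalar_prod[OF V z(1) z(1)] unfolding z(2) Gy by simp
  qed
  have pos: "0 < (\<Sum>c<k. (y $ c)\<^sup>2)" if "y \<in> carrier_vec k" "y \<noteq> 0\<^sub>v k" for y :: "real vec"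
    using scalar_self_pos[OF that] that by (simp add: scalar_prod_def atLeast0LessThan power2_eq_square)
  \<comment> \<open>There are i+1 free coordinates and i equations. On the support of y every
    \<open>t c\<close> is at least \<open>t i\<close>, and on the support of \<open>G y\<close>
    every \<open>l r\<close> is at most \<open>l i\<close>.\<close>
  obtain y where y: "y \<in> carrier_vec k" "y \<noteq> 0\<^sub>v k" "\<And>c. c < k \<Longrightarrow> c \<notin> {..i} \<Longrightarrow> y $ c = 0"
    "\<And>r. r \<in> {..<i} \<Longrightarrow> (G *\<^sub>v y) $ r = 0"
    by (rule exists_supported_vector_with_zeros[OF G, of "{..i}" "{..<i}"]) (use i kn in auto)
  have "t i * (\<Sum>c<k. (y $ c)\<^sup>2) \<le> (\<Sum>c<k. t c * (y $ c)\<^sup>2)"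
    unfolding sum_distrib_left
  proof (rule sum_mono)
    fix c assume "c \<in> {..<k}"
    then show "t i * (y $ c)\<^sup>2 \<le> t c * (y $ c)\<^sup>2"
      using t[of c i] y(3)[of c] i by (cases "c \<le> i") (auto intro!: mult_right_mono)
  qed
  also have "\<dots> \<le> l i * (\<Sum>r<n. ((G *\<^sub>v y) $ r)\<^sup>2)"
    unfolding eq(1)[OF y(1)] sum_distrib_left
  proof (rule sum_mono)
    fix r assume "r \<in> {..<n}"
    then show "l r * ((G *\<^sub>v y) $ r)\<^sup>2 \<le> l i * ((G *\<^sub>v y) $ r)\<^sup>2"
      using l[of i r] y(4)[of r] by (cases "i \<le> r") (auto intro!: mult_right_mono)
  qed
  finally show "t i \<le> l i" using pos[OF y(1,2)] by (simp add: eq(2)[OF y(1)])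
  \<comment> \<open>Now there are k-i free coordinates; the indices above n-k+i number k-i-1, one
    fewer. Both comparisons are reversed.\<close>
  obtain y where y: "y \<in> carrier_vec k" "y \<noteq> 0\<^sub>v k" "\<And>c. c < k \<Longrightarrow> c \<notin> {i..<k} \<Longrightarrow> y $ c = 0"
    "\<And>r. r \<in> {n - k + i<..<n} \<Longrightarrow> (G *\<^sub>v y) $ r = 0"
    by (rule exists_supported_vector_with_zeros[OF G, of "{i..<k}" "{n - k + i<..<n}"]) (use i kn in auto)
  have "l (n - k + i) * (\<Sum>r<n. ((G *\<^sub>v y) $ r)\<^sup>2) \<le> (\<Sum>r<n. l r * ((G *\<^sub>v y) $ r)\<^sup>2)"
    unfolding sum_distrib_left
  proof (rule sum_mono)
    fix r assume "r \<in> {..<n}"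
    then show "l (n - k + i) * ((G *\<^sub>v y) $ r)\<^sup>2 \<le> l r * ((G *\<^sub>v y) $ r)\<^sup>2"
      using l[of r "n - k + i"] y(4)[of r] i kn by (cases "r \<le> n - k + i") (auto intro!: mult_right_mono)
  qed
  also have "\<dots> \<le> t i * (\<Sum>c<k. (y $ c)\<^sup>2)"
    unfolding eq(1)[OF y(1), symmetric] sum_distrib_left
  proof (rule sum_mono)
    fix c assume "c \<in> {..<k}"
    then show "t c * (y $ c)\<^sup>2 \<le> t i * (y $ c)\<^sup>2"
      using t[of i c] y(3)[of c] by (cases "i \<le> c") (auto intro!: mult_right_mono)
  qed
  finally show "l (n - k + i) \<le> t i" using pos[OF y(1,2)] by (simp add: eq(2)[OF y(1)])
qed

section \<open>Matrix algebra under dimension equations\<close>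

lemma mult_assoc_dim:
  "dim_col A = dim_row B \<Longrightarrow> dim_col B = dim_row C \<Longrightarrow> A * B * C = A * (B * C :: real mat)"
  by (rule assoc_mult_mat[of _ "dim_row A" "dim_row B" _ "dim_row C" _ "dim_col C"]) auto

lemma mult_vec_assoc_dim:
  "dim_col A = dim_row B \<Longrightarrow> dim_col B = dim_vec v \<Longrightarrow> A * B *\<^sub>v v = A *\<^sub>v (B *\<^sub>v v :: real vec)"
  by (rule assoc_mult_mat_vec[of _ "dim_row A" "dim_row B" _ "dim_vec v"]) auto

lemma transpose_mult_dim:
  "dim_col A = dim_row B \<Longrightarrow> (A * B)\<^sup>T = B\<^sup>T * (A\<^sup>T :: real mat)"
  by (rule transpose_mult[of _ "dim_row A" "dim_row B" _ "dim_col B"]) auto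

lemma transpose_minus_dim:
  "dim_row A = dim_row B \<Longrightarrow> dim_col A = dim_col B \<Longrightarrow> (A - B)\<^sup>T = A\<^sup>T - (B\<^sup>T :: real mat)"
  by (rule eq_matI) auto

lemma minus_mult_dim:
  "dim_row A = dim_row B \<Longrightarrow> dim_col A = dim_col B \<Longrightarrow> dim_col A = dim_row C \<Longrightarrow>
    (A - B) * C = A * C - B * (C :: real mat)"
  by (rule minus_mult_distrib_mat[of _ "dim_row A" "dim_col A" _ _ "dim_col C"]) auto

lemma mult_minus_dim:
  "dim_row B = dim_row C \<Longrightarrow> dim_col B = dim_col C \<Longrightarrow> dim_col A = dim_row B \<Longrightarrow>
    A * (B - C) = A * B - A * (C :: real mat)"
  by (rule mult_minus_distrib_mat[of _ "dim_row A" "dim_col A" _ "dim_col C"]) auto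

lemma add_mult_dim:
  "dim_row A = dim_row B \<Longrightarrow> dim_col A = dim_col B \<Longrightarrow> dim_col A = dim_row C \<Longrightarrow>
    (A + B) * C = A * C + B * (C :: real mat)"
  by (rule add_mult_distrib_mat[of _ "dim_row A" "dim_col A" _ _ "dim_col C"]) auto

lemma mult_add_dim:
  "dim_row B = dim_row C \<Longrightarrow> dim_col B = dim_col C \<Longrightarrow> dim_col A = dim_row B \<Longrightarrow>
    A * (B + C) = A * B + A * (C :: real mat)"
  by (rule mult_add_distrib_mat[of _ "dim_row A" "dim_col A" _ "dim_col C"]) auto

lemma smult_mult_dim: "dim_col A = dim_row B \<Longrightarrow> (k \<cdot>\<^sub>m A) * B = k \<cdot>\<^sub>m (A * B :: real mat)"
  by (rule mult_smult_assoc_mat[of _ "dim_row A" "dim_col A" _ "dim_col B"]) auto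

lemma mult_smult_dim: "dim_col A = dim_row B \<Longrightarrow> A * (k \<cdot>\<^sub>m B) = k \<cdot>\<^sub>m (A * B :: real mat)"
  by (rule mult_smult_distrib[of _ "dim_row A" "dim_col A" _ "dim_col B"]) auto

text \<open>The premises are equations between dimensions, which simplification settles from the
  known sizes; carrier premises would require naming the inner dimensions at each use.\<close>

lemmas mat_dim_distribs = minus_mult_dim mult_minus_dim add_mult_dim mult_add_dim smult_mult_dim mult_smult_dim

lemma minus_mult_vec_dim:
  "dim_row A = dim_row B \<Longrightarrow> dim_col A = dim_col B \<Longrightarrow> dim_col A = dim_vec x \<Longrightarrow>
    (A - B) *\<^sub>v x = A *\<^sub>v x - B *\<^sub>v (x :: real vec)"
  by (intro minus_mult_distrib_mat_vec[of _ "dim_row A" "dim_col A"] carrier_matI carrier_vecI) simp_all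

lemma add_mult_vec_dim:
  "dim_row A = dim_row B \<Longrightarrow> dim_col A = dim_col B \<Longrightarrow> dim_col A = dim_vec x \<Longrightarrow>
    (A + B) *\<^sub>v x = A *\<^sub>v x + B *\<^sub>v (x :: real vec)"
  by (intro add_mult_distrib_mat_vec[of _ "dim_row A" "dim_col A"] carrier_matI carrier_vecI) simp_all

lemma smult_mult_vec_dim:
  "dim_col A = dim_vec x \<Longrightarrow> (k \<cdot>\<^sub>m A) *\<^sub>v x = k \<cdot>\<^sub>v (A *\<^sub>v (x :: real vec))"
  by (rule eq_vecI) (auto simp: scalar_prod_def sum_distrib_left mult.assoc)

lemma mult_vec_smult_dim:
  "dim_col A = dim_vec x \<Longrightarrow> A *\<^sub>v (k \<cdot>\<^sub>v x) = k \<cdot>\<^sub>v (A *\<^sub>v (x :: real vec))"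
  by (rule mult_mat_vec[of _ "dim_row A" "dim_col A"]) auto

subsection \<open>Outer products, inverses, positive definiteness\<close>

lemma outer_prod_dim [simp]:
  "dim_row (outer_prod v w) = dim_vec v" "dim_col (outer_prod v w) = dim_vec w"
  by (auto simp: outer_prod_def)

lemma outer_prod_index [simp]:
  "i < dim_vec v \<Longrightarrow> j < dim_vec w \<Longrightarrow> outer_prod v w $$ (i,j) = v $ i * w $ j"
  by (auto simp: outer_prod_def)

lemma transpose_outer_prod: "(outer_prod v w)\<^sup>T = outer_prod w v"
  by (auto simp: outer_prod_def)

lemma mult_outer_prod: "dim_col M = dim_vec v \<Longrightarrow> M * outer_prod v w = outer_prod (M *\<^sub>v v) w"
  by (rule eq_matI) (auto simp: scalar_prod_def outer_prod_def sum_distrib_right mult.assoc)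

lemma outer_prod_mult: "dim_row M = dim_vec w \<Longrightarrow> outer_prod v w * M = outer_prod v (M\<^sup>T *\<^sub>v w)"
  by (rule eq_matI) (auto simp: scalar_prod_def outer_prod_def sum_distrib_left mult_ac)

lemma outer_prod_mult_vec: "dim_vec w = dim_vec x \<Longrightarrow> outer_prod v w *\<^sub>v x = (w \<bullet> x) \<cdot>\<^sub>v v"
  by (rule eq_vecI) (auto simp: scalar_prod_def outer_prod_def sum_distrib_left sum_distrib_right mult_ac)

lemma outer_prod_smult: "outer_prod (a \<cdot>\<^sub>v v) (b \<cdot>\<^sub>v w) = (a * b) \<cdot>\<^sub>m outer_prod v w"
  by (rule eq_matI) auto

text \<open>\<open>inv_mat\<close> is \<open>the\<close> of an option, so invertibility in the
  matrix ring first has to exclude \<open>None\<close>. For square matrices the one-sided hypothesis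
  already gives both sides.\<close>

lemma inv_mat_eqI:
  assumes A: "A \<in> carrier_mat n n" and B: "B \<in> carrier_mat n n" and AB: "A * B = 1\<^sub>m n"
  shows "inv_mat A = B"
proof -
  have BA: "B * A = 1\<^sub>m n" using mat_mult_left_right_inverse[OF A B AB] .
  have "A \<in> Units (ring_mat TYPE(real) n ())"
    using A B AB BA by (auto simp: Units_def ring_mat_def)
  then obtain C where C: "mat_inverse A = Some C"
    using mat_inverse(1)[OF A, of "()"] by (cases "mat_inverse A") auto
  have AC: "A * C = 1\<^sub>m n" "C \<in> carrier_mat n n" using mat_inverse(2)[OF A C] by auto
  have "C = (B * A) * C" using BA AC by simp
  also have "\<dots> = B * (A * C)" by (rule assoc_mult_mat[OF B A AC(2)])
  also have "\<dots> = B" using AC B by simp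
  finally show ?thesis using C by (simp add: inv_mat_def)
qed

text \<open>A kernel vector x would give x.Ax = 0, so the determinant is nonzero. Transposing
  \<open>B * A = 1\<close> shows that \<open>B\<^sup>T\<close> is again a right inverse, whence the
  inverse is symmetric.\<close>

lemma sym_pos_def_inv_mat:
  assumes A: "sym_pos_def n A"
  shows "inv_mat A \<in> carrier_mat n n" "A * inv_mat A = 1\<^sub>m n" "inv_mat A * A = 1\<^sub>m n"
    "(inv_mat A)\<^sup>T = inv_mat A"
proof -
  have Ac: "A \<in> carrier_mat n n" "A\<^sup>T = A" using A by (auto simp: sym_pos_def_def)
  have "det A \<noteq> 0"
  proof
    assume "det A = 0"
    then obtain x where "x \<in> carrier_vec n" "x \<noteq> 0\<^sub>v n" "A *\<^sub>v x = 0\<^sub>v n"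
      using det_0_iff_vec_prod_zero[OF Ac(1)] by auto
    then show False using A unfolding sym_pos_def_def by (metis less_irrefl scalar_prod_right_zero)
  qed
  then have "A \<in> Units (ring_mat TYPE(real) n ())" by (rule det_non_zero_imp_unit[OF Ac(1)])
  then obtain B where "mat_inverse A = Some B"
    using mat_inverse(1)[OF Ac(1), of "()"] by (cases "mat_inverse A") auto
  then have B: "B \<in> carrier_mat n n" "A * B = 1\<^sub>m n" "B * A = 1\<^sub>m n"
    using mat_inverse(2)[OF Ac(1)] by blast+
  note inv = inv_mat_eqI[OF Ac(1) B(1,2)]
  show "inv_mat A \<in> carrier_mat n n" "A * inv_mat A = 1\<^sub>m n" "inv_mat A * A = 1\<^sub>m n"
    using B inv by auto
  have "A * B\<^sup>T = 1\<^sub>m n"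
    using arg_cong[OF B(3), of transpose_mat] transpose_mult[OF B(1) Ac(1)] by (simp add: Ac(2))
  then have "inv_mat A = B\<^sup>T" using B by (intro inv_mat_eqI[OF Ac(1)]) auto
  then show "(inv_mat A)\<^sup>T = inv_mat A" using inv by (metis transpose_transpose)
qed

text \<open>At the i-th column of \<open>U\<close> the quadratic form takes the value
  \<open>l i\<close>.\<close>

lemma spectral_decomp_pos:
  assumes A: "sym_pos_def n A" and sd: "spectral_decomp n A U l" and i: "i < n"
  shows "0 < l i"
proof -
  have U: "U \<in> carrier_mat n n" "U\<^sup>T * U = 1\<^sub>m n" using sd by (auto simp: spectral_decomp_def)
  define x where "x = U *\<^sub>v unit_vec n i"
  have x: "x \<in> carrier_vec n" using U by (simp add: x_def)
  have Ux: "U\<^sup>T *\<^sub>v x = unit_vec n i"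
    unfolding x_def using U mult_vec_assoc_dim[of "U\<^sup>T" U "unit_vec n i"] by simp
  have "x \<noteq> 0\<^sub>v n"
  proof
    assume "x = 0\<^sub>v n"
    then have "U\<^sup>T *\<^sub>v x = 0\<^sub>v n" using U(1) by (intro eq_vecI) auto
    then show False using i Ux by simp
  qed
  then have "0 < x \<bullet> (A *\<^sub>v x)" using A x by (auto simp: sym_pos_def_def)
  also have "\<dots> = (\<Sum>j<n. l j * (unit_vec n i $ j)\<^sup>2)"
    using spectral_quadratic_form(1)[OF sd x] by (simp add: Ux)
  also have "\<dots> = (\<Sum>j<n. if j = i then l j else 0)" using i by (intro sum.cong) auto
  also have "\<dots> = l i" using i by simp
  finally show ?thesis .
qed

lemma mat_diag_dims [simp]: "dim_row (mat_diag n f) = n" "dim_col (mat_diag n f) = n"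
  by (auto simp: mat_diag_def)

lemma spectral_decomp_inv_mat:
  assumes sd: "spectral_decomp n A U l" and nz: "\<And>i. i < n \<Longrightarrow> l i \<noteq> 0"
  shows "spectral_decomp n (inv_mat A) U (\<lambda>i. 1 / l i)"
proof -
  have U: "U \<in> carrier_mat n n" "U\<^sup>T * U = 1\<^sub>m n" "U * U\<^sup>T = 1\<^sub>m n" "A = U * mat_diag n l * U\<^sup>T"
    using sd by (auto simp: spectral_decomp_def)
  let ?D = "mat_diag n l" and ?D' = "mat_diag n (\<lambda>i. 1 / l i)"
  have D: "?D \<in> carrier_mat n n" "?D' \<in> carrier_mat n n" by auto
  have D1: "?D * ?D' = 1\<^sub>m n" using nz by (subst mat_diag_diag) (auto simp: mat_diag_def)
  have "U\<^sup>T * (U * (?D' * U\<^sup>T)) = U\<^sup>T * U * (?D' * U\<^sup>T)"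
    by (rule mult_assoc_dim[symmetric]) (use U(1) in auto)
  also have "\<dots> = ?D' * U\<^sup>T"
    unfolding U(2) by (rule left_mult_one_mat') simp
  finally have "U\<^sup>T * (U * (?D' * U\<^sup>T)) = ?D' * U\<^sup>T" .
  then have "A * (U * ?D' * U\<^sup>T) = U * (?D * (?D' * U\<^sup>T))"
    using U(1) unfolding U(4) by (simp add: mult_assoc_dim)
  also have "?D * (?D' * U\<^sup>T) = ?D * ?D' * U\<^sup>T"
    by (rule mult_assoc_dim[symmetric]) (use U(1) in auto)
  also have "\<dots> = U\<^sup>T" unfolding D1 using U(1) by simp
  finally have "A * (U * ?D' * U\<^sup>T) = 1\<^sub>m n" using U(3) by simp
  moreover have "A \<in> carrier_mat n n" unfolding U(4) by (rule carrier_matI) (use U(1) in auto)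
  ultimately have "inv_mat A = U * ?D' * U\<^sup>T" using U(1) by (intro inv_mat_eqI[of _ n] carrier_matI) auto
  then show ?thesis using U(1-3) by (simp add: spectral_decomp_def)
qed

text \<open>Reciprocals reverse the order of positive numbers. The reciprocals of a nonincreasing
  list are therefore already sorted upwards, and the final reversal produces the index
  n-1-i.\<close>

lemma eigenvalues_desc_inv_mat:
  assumes A: "sym_pos_def n A"
  shows "length (eigenvalues_desc (inv_mat A)) = n"
    and "i < n \<Longrightarrow> eigenvalues_desc (inv_mat A) ! i = 1 / eigenvalues_desc A ! (n - 1 - i)"
    and "i < n \<Longrightarrow> 0 < eigenvalues_desc A ! i"
proof -
  let ?m = "eigenvalues_desc A"
  have Ac: "A \<in> carrier_mat n n" "A\<^sup>T = A" using A by (auto simp: sym_pos_def_def)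
  obtain U where U: "spectral_decomp n A U (\<lambda>i. ?m ! i)" using symmetric_spectral_decomp(1)[OF Ac] by auto
  have pos: "0 < ?m ! i" if "i < n" for i using spectral_decomp_pos[OF A U that] .
  show "i < n \<Longrightarrow> 0 < ?m ! i" by (rule pos)
  have "spectral_decomp n (inv_mat A) U (\<lambda>i. 1 / ?m ! i)"
    using pos by (intro spectral_decomp_inv_mat[OF U]) force
  from eigenvalues_desc_spectral[OF this]
  have e: "eigenvalues_desc (inv_mat A) = rev (sort (map (\<lambda>i. 1 / ?m ! i) [0..<n]))" .
  have "sorted (map (\<lambda>i. 1 / ?m ! i) [0..<n])"
    using symmetric_spectral_decomp(3)[OF Ac] pos
    by (auto simp: sorted_iff_nth_mono intro!: divide_left_mono)
  then have e': "eigenvalues_desc (inv_mat A) = rev (map (\<lambda>i. 1 / ?m ! i) [0..<n])"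
    using e by (simp add: sort_key_id_if_sorted)
  show "length (eigenvalues_desc (inv_mat A)) = n" by (simp add: e')
  show "i < n \<Longrightarrow> eigenvalues_desc (inv_mat A) ! i = 1 / ?m ! (n - 1 - i)"
    by (simp add: e' rev_nth)
qed

subsection \<open>The inverse through the Schur complement\<close>

text \<open>Block elimination for an arbitrary coupling block \<open>C\<close>; the rank-one form
  produced by Lanczos is inserted later. \<open>sum1\<close> says that the columns of
  \<open>Q\<close> and \<open>R\<close> together span the whole space.\<close>

locale orthogonal_splitting =
  fixes A Q R :: "real mat" and d m n :: nat
  assumes A: "sym_pos_def d A"
    and Q: "Q \<in> carrier_mat d m" "Q\<^sup>T * Q = 1\<^sub>m m"
    and R: "R \<in> carrier_mat d n" "R\<^sup>T * R = 1\<^sub>m n"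
    and QR: "Q\<^sup>T * R = 0\<^sub>m m n" and sum1: "Q * Q\<^sup>T + R * R\<^sup>T = 1\<^sub>m d"
begin

definition "T = Q\<^sup>T * A * Q"
definition "C = Q\<^sup>T * A * R"
text \<open>The A-orthogonal projection onto range(Q) is
  \<open>Q T\<^sup>-\<^sup>1 Q\<^sup>T A\<close>; applied to the columns of \<open>R\<close> it
  gives \<open>K\<close>. Hence the columns of \<open>R - K\<close> are A-orthogonal to
  range(Q).\<close>

definition "K = Q * inv_mat T * C"
definition "S = R\<^sup>T * A * R - C\<^sup>T * inv_mat T * C"

lemma A_carrier: "A \<in> carrier_mat d d" and A_sym: "A\<^sup>T = A"
  using A by (auto simp: sym_pos_def_def)

lemma dims [simp]:
  "dim_row A = d" "dim_col A = d" "dim_row Q = d" "dim_col Q = m" "dim_row R = d" "dim_col R = n"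
  using A_carrier Q R by auto

lemma T_spd: "sym_pos_def m T"
  unfolding sym_pos_def_def
proof (intro conjI ballI impI)
  show "T \<in> carrier_mat m m" by (rule carrier_matI) (simp_all add: T_def)
  show "T\<^sup>T = T" by (simp add: T_def transpose_mult_dim mult_assoc_dim A_sym)
  fix x :: "real vec" assume x: "x \<in> carrier_vec m" "x \<noteq> 0\<^sub>v m"
  have Qx: "Q *\<^sub>v x \<in> carrier_vec d" by (rule carrier_vecI) simp
  have "Q *\<^sub>v x \<noteq> 0\<^sub>v d"
    using isometry_scalar_prod[OF Q x(1) x(1)] scalar_self_pos[OF x] by auto
  then have "0 < (Q *\<^sub>v x) \<bullet> (A *\<^sub>v (Q *\<^sub>v x))" using A Qx by (auto simp: sym_pos_def_def)
  also have "\<dots> = x \<bullet> (T *\<^sub>v x)"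
    using scalar_mult_mat_vec[of "Q\<^sup>T" m d x "A *\<^sub>v (Q *\<^sub>v x)"] x Q(1) A_carrier Qx
    by (simp add: T_def mult_vec_assoc_dim)
  finally show "0 < x \<bullet> (T *\<^sub>v x)" .
qed

lemmas Ti = sym_pos_def_inv_mat[OF T_spd]

lemma dims' [simp]:
  "dim_row T = m" "dim_col T = m" "dim_row (inv_mat T) = m" "dim_col (inv_mat T) = m"
  "dim_row C = m" "dim_col C = n" "dim_row K = d" "dim_col K = n" "dim_row S = n" "dim_col S = n"
  using Ti(1) by (auto simp: T_def C_def K_def S_def)

lemma A_mult_Q: "A * Q = Q * T + R * C\<^sup>T"
proof -
  have "A * Q = (Q * Q\<^sup>T + R * R\<^sup>T) * (A * Q)"
    unfolding sum1 by (simp add: left_mult_one_mat')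
  also have "\<dots> = Q * T + R * C\<^sup>T"
    by (simp add: add_mult_dim mult_assoc_dim T_def C_def transpose_mult_dim A_sym)
  finally show ?thesis .
qed

lemma A_mult_R: "A * R = Q * C + R * (R\<^sup>T * A * R)"
proof -
  have "A * R = (Q * Q\<^sup>T + R * R\<^sup>T) * (A * R)"
    unfolding sum1 by (simp add: left_mult_one_mat')
  also have "\<dots> = Q * C + R * (R\<^sup>T * A * R)" by (simp add: add_mult_dim mult_assoc_dim C_def)
  finally show ?thesis .
qed

text \<open>Subtracting \<open>K\<close> cancels exactly the component of \<open>A R\<close> in
  range(Q); what remains in range(R) is the Schur complement.\<close>

lemma A_mult_RK: "A * (R - K) = R * S"
proof -
  have "A * K = (A * Q) * (inv_mat T * C)" by (simp add: K_def mult_assoc_dim)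
  also have "\<dots> = Q * (T * (inv_mat T * C)) + R * (C\<^sup>T * inv_mat T * C)"
    unfolding A_mult_Q by (simp add: add_mult_dim mult_assoc_dim)
  also have "T * (inv_mat T * C) = C"
    using mult_assoc_dim[of T "inv_mat T" C] Ti(2) by (simp add: left_mult_one_mat')
  finally have "A * (R - K) = (Q * C + R * (R\<^sup>T * A * R)) - (Q * C + R * (C\<^sup>T * inv_mat T * C))"
    by (simp add: mult_minus_dim A_mult_R)
  also have "\<dots> = R * (R\<^sup>T * A * R) - R * (C\<^sup>T * inv_mat T * C)"
    by (rule eq_matI) (auto simp del: index_mult_mat(1))
  finally show ?thesis by (simp add: S_def mult_minus_dim)
qed

lemma R_T_RK: "R\<^sup>T * (R - K) = 1\<^sub>m n"
proof -
  have "R\<^sup>T * Q = 0\<^sub>m n m" using arg_cong[OF QR, of transpose_mat] by (simp add: transpose_mult_dim)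
  then have "R\<^sup>T * K = 0\<^sub>m n n"
    using mult_assoc_dim[of "R\<^sup>T" Q "inv_mat T * C"] by (simp add: K_def mult_assoc_dim) 
  then show ?thesis using R(2) by (auto simp: mult_minus_dim)
qed

text \<open>This congruence is what makes \<open>S\<close> inherit positive definiteness from
  \<open>A\<close>: \<open>R - K\<close> is injective because \<open>R\<^sup>T\<close> is a left
  inverse of it.\<close>

lemma S_eq: "S = (R - K)\<^sup>T * A * (R - K)"
proof -
  have "(R - K)\<^sup>T * R = 1\<^sub>m n" using arg_cong[OF R_T_RK, of transpose_mat] by (simp add: transpose_mult_dim)
  then have "(R - K)\<^sup>T * (R * S) = S"
    using mult_assoc_dim[of "(R - K)\<^sup>T" R S] by (simp add: left_mult_one_mat')
  then show ?thesis using mult_assoc_dim[of "(R - K)\<^sup>T" A "R - K"] by (simp add: A_mult_RK)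
qed

lemma S_spd: "sym_pos_def n S"
  unfolding sym_pos_def_def
proof (intro conjI ballI impI)
  show "S \<in> carrier_mat n n" by (rule carrier_matI) simp_all
  show "S\<^sup>T = S" unfolding S_eq
    by (simp add: transpose_mult_dim mult_assoc_dim A_sym)
  fix x :: "real vec" assume x: "x \<in> carrier_vec n" "x \<noteq> 0\<^sub>v n"
  let ?y = "(R - K) *\<^sub>v x"
  have y: "?y \<in> carrier_vec d" by (rule carrier_vecI) simp
  have "R\<^sup>T *\<^sub>v ?y = x"
    using mult_vec_assoc_dim[of "R\<^sup>T" "R - K" x] x(1) R_T_RK by simp
  then have "?y \<noteq> 0\<^sub>v d"
    using scalar_mult_mat_vec[of "R" d n "?y" x] scalar_self_pos[OF x] x R(1) by auto
  then have "0 < ?y \<bullet> (A *\<^sub>v ?y)" using A y by (auto simp: sym_pos_def_def)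
  also have "\<dots> = x \<bullet> (S *\<^sub>v x)"
    using scalar_mult_mat_vec[of "(R - K)\<^sup>T" n d x "A *\<^sub>v ?y"] x A_carrier y
      carrier_matI[of "R - K" d n]
    by (simp add: S_eq mult_vec_assoc_dim)
  finally show "0 < x \<bullet> (S *\<^sub>v x)" .
qed

lemmas Si = sym_pos_def_inv_mat[OF S_spd]

lemma dims'' [simp]: "dim_row (inv_mat S) = n" "dim_col (inv_mat S) = n"
  using Si(1) by auto

text \<open>\<open>Q\<close> and \<open>R - K\<close> are A-orthogonal with Gram matrices
  \<open>T\<close> and \<open>S\<close>, so the inverse splits into one term for each. After
  multiplication by \<open>A\<close> the two terms \<open>R K\<^sup>T\<close> cancel and
  \<open>sum1\<close> remains.\<close>

lemma inv_mat_A: "inv_mat A = Q * inv_mat T * Q\<^sup>T + (R - K) * inv_mat S * (R - K)\<^sup>T"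
proof (rule inv_mat_eqI[OF A_carrier])
  show "Q * inv_mat T * Q\<^sup>T + (R - K) * inv_mat S * (R - K)\<^sup>T \<in> carrier_mat d d" by (rule carrier_matI) simp_all
  have KT: "K\<^sup>T = C\<^sup>T * (inv_mat T * Q\<^sup>T)"
    by (simp add: K_def transpose_mult_dim mult_assoc_dim Ti(4))
  have "A * (Q * inv_mat T * Q\<^sup>T) = (A * Q) * (inv_mat T * Q\<^sup>T)" by (simp add: mult_assoc_dim)
  also have "\<dots> = Q * (T * (inv_mat T * Q\<^sup>T)) + R * K\<^sup>T"
    unfolding A_mult_Q KT by (simp add: add_mult_dim mult_assoc_dim)
  also have "T * (inv_mat T * Q\<^sup>T) = Q\<^sup>T"
    using mult_assoc_dim[of T "inv_mat T" "Q\<^sup>T"] Ti(2) by (simp add: left_mult_one_mat')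
  finally have 1: "A * (Q * inv_mat T * Q\<^sup>T) = Q * Q\<^sup>T + R * K\<^sup>T" .
  have "A * ((R - K) * inv_mat S * (R - K)\<^sup>T) = A * (R - K) * (inv_mat S * (R - K)\<^sup>T)"
    using mult_assoc_dim[of A "R - K" "inv_mat S * (R - K)\<^sup>T"] mult_assoc_dim[of "R - K" "inv_mat S" "(R - K)\<^sup>T"] by simp
  also have "\<dots> = R * (S * (inv_mat S * (R - K)\<^sup>T))" unfolding A_mult_RK by (simp add: mult_assoc_dim)
  also have "S * (inv_mat S * (R - K)\<^sup>T) = (R - K)\<^sup>T"
    using mult_assoc_dim[of S "inv_mat S" "(R - K)\<^sup>T"] Si(2) by (simp add: left_mult_one_mat')
  finally have 2: "A * ((R - K) * inv_mat S * (R - K)\<^sup>T) = R * R\<^sup>T - R * K\<^sup>T"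
    by (simp add: transpose_minus_dim mult_minus_dim)
  have "A * (Q * inv_mat T * Q\<^sup>T + (R - K) * inv_mat S * (R - K)\<^sup>T) = (Q * Q\<^sup>T + R * K\<^sup>T) + (R * R\<^sup>T - R * K\<^sup>T)"
    using 1 2 by (simp add: mult_add_dim)
  also have "\<dots> = Q * Q\<^sup>T + R * R\<^sup>T" by (rule eq_matI) (auto simp del: index_mult_mat(1))
  finally show "A * (Q * inv_mat T * Q\<^sup>T + (R - K) * inv_mat S * (R - K)\<^sup>T) = 1\<^sub>m d" using sum1 by simp
qed

end

section \<open>Operator norm, Frobenius norm, trace and variance estimates\<close>

lemma trace_mult_comm_dim:
  "dim_col A = dim_row B \<Longrightarrow> dim_row A = dim_col B \<Longrightarrow> mat_trace (A * B) = mat_trace (B * A)"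
  by (rule trace_mult_comm[of _ "dim_row A" "dim_row B"]) auto

lemma mult_minus_vec_dim:
  "dim_vec x = dim_vec y \<Longrightarrow> dim_col A = dim_vec x \<Longrightarrow> A *\<^sub>v (x - y) = A *\<^sub>v x - A *\<^sub>v (y :: real vec)"
  by (intro mult_minus_distrib_mat_vec[of _ "dim_row A" "dim_col A"] carrier_matI carrier_vecI) simp_all

lemma mult_add_vec_dim:
  "dim_vec x = dim_vec y \<Longrightarrow> dim_col A = dim_vec x \<Longrightarrow> A *\<^sub>v (x + y) = A *\<^sub>v x + A *\<^sub>v (y :: real vec)"
  by (intro mult_add_distrib_mat_vec[of _ "dim_row A" "dim_col A"] carrier_matI carrier_vecI) simp_all

lemma one_mult_vec_dim: "dim_vec x = n \<Longrightarrow> 1\<^sub>m n *\<^sub>v x = (x :: real vec)"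
  by (intro one_mult_mat_vec carrier_vecI)

lemma cauchy_schwarz_vec:
  assumes "v \<in> carrier_vec n" "(w :: real vec) \<in> carrier_vec n"
  shows "(v \<bullet> w)\<^sup>2 \<le> (v \<bullet> v) * (w \<bullet> w)"
proof -
  have "\<bar>v \<bullet> w\<bar> \<le> (\<Sum>i<n. \<bar>v $ i\<bar> * \<bar>w $ i\<bar>)"
    using assms sum_abs[of "\<lambda>i. v $ i * w $ i" "{..<n}"]
    by (simp add: scalar_prod_def atLeast0LessThan abs_mult)
  also have "\<dots> \<le> l2_norm v * l2_norm w"
    using assms L2_set_mult_ineq[of "\<lambda>i. v $ i" "\<lambda>i. w $ i" "{..<n}"] by (simp add: l2_norm_eq_L2_set)
  finally have "\<bar>v \<bullet> w\<bar>\<^sup>2 \<le> (l2_norm v * l2_norm w)\<^sup>2" by (intro power_mono) auto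
  then show ?thesis by (simp add: power_mult_distrib l2_norm_sq)
qed

lemma spectral_norm_le:
  assumes "N \<in> carrier_mat k n" "0 \<le> b" "\<And>x. x \<in> carrier_vec n \<Longrightarrow> l2_norm (N *\<^sub>v x) \<le> b * l2_norm x"
  shows "spectral_norm N \<le> b"
  unfolding spectral_norm_def
proof (rule cSup_least)
  show "{l2_norm (N *\<^sub>v x) |x. x \<in> carrier_vec (dim_col N) \<and> l2_norm x \<le> 1} \<noteq> {}"
    by (auto intro!: exI[of _ "0\<^sub>v (dim_col N)"])
  fix z assume "z \<in> {l2_norm (N *\<^sub>v x) |x. x \<in> carrier_vec (dim_col N) \<and> l2_norm x \<le> 1}"
  then obtain x where x: "z = l2_norm (N *\<^sub>v x)" "x \<in> carrier_vec n" "l2_norm x \<le> 1" using assms(1) by auto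
  show "z \<le> b" using assms(3)[OF x(2)] mult_left_mono[OF x(3) assms(2)] x(1) by simp
qed

text \<open>The bound \<open>b\<close> enters only to make the set bounded above; without that, the
  supremum of a set of reals carries no information.\<close>

lemma spectral_norm_ge:
  assumes "N \<in> carrier_mat k n" "0 \<le> b" "\<And>x. x \<in> carrier_vec n \<Longrightarrow> l2_norm (N *\<^sub>v x) \<le> b * l2_norm x"
    and x: "x \<in> carrier_vec n" "l2_norm x \<le> 1"
  shows "l2_norm (N *\<^sub>v x) \<le> spectral_norm N"
  unfolding spectral_norm_def
proof (rule cSup_upper)
  show "l2_norm (N *\<^sub>v x) \<in> {l2_norm (N *\<^sub>v x) |x. x \<in> carrier_vec (dim_col N) \<and> l2_norm x \<le> 1}"
    using assms by auto
  show "bdd_above {l2_norm (N *\<^sub>v x) |x. x \<in> carrier_vec (dim_col N) \<and> l2_norm x \<le> 1}"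
  proof (rule bdd_aboveI[of _ b])
    fix z assume "z \<in> {l2_norm (N *\<^sub>v x) |x. x \<in> carrier_vec (dim_col N) \<and> l2_norm x \<le> 1}"
    then obtain x where x: "z = l2_norm (N *\<^sub>v x)" "x \<in> carrier_vec n" "l2_norm x \<le> 1" using assms(1) by auto
    show "z \<le> b" using assms(3)[OF x(2)] mult_left_mono[OF x(3) assms(2)] x(1) by simp
  qed
qed

text \<open>The squared norm is the trace of \<open>M\<^sup>T M\<close>, and cyclicity brings the
  outer factors together as \<open>R\<^sup>T R\<close>.\<close>

lemma frobenius_norm_conj_isometry:
  assumes R: "R \<in> carrier_mat d n" "R\<^sup>T * R = 1\<^sub>m n" and M: "M \<in> carrier_mat n n"
  shows "frobenius_norm (R * M * R\<^sup>T) = frobenius_norm M"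
proof -
  have d: "dim_row R = d" "dim_col R = n" "dim_row M = n" "dim_col M = n" using R M by auto
  have "(R * M * R\<^sup>T)\<^sup>T * (R * M * R\<^sup>T) = R * (M\<^sup>T * (R\<^sup>T * R * (M * R\<^sup>T)))"
    by (simp add: d transpose_mult_dim mult_assoc_dim)
  also have "\<dots> = R * (M\<^sup>T * M * R\<^sup>T)" unfolding R(2) by (simp add: d mult_assoc_dim)
  finally have "mat_trace ((R * M * R\<^sup>T)\<^sup>T * (R * M * R\<^sup>T)) = mat_trace (M\<^sup>T * M * R\<^sup>T * R)"
    using trace_mult_comm_dim[of R "M\<^sup>T * M * R\<^sup>T"] by (simp add: d)
  also have "M\<^sup>T * M * R\<^sup>T * R = M\<^sup>T * M * (R\<^sup>T * R)" by (rule mult_assoc_dim) (simp_all add: d)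
  also have "\<dots> = M\<^sup>T * M" unfolding R(2) by (simp add: d)
  finally show ?thesis by (simp add: frobenius_norm_eq_trace)
qed

lemma trace_conj_isometry:
  assumes R: "R \<in> carrier_mat d n" "R\<^sup>T * R = 1\<^sub>m n" and M: "M \<in> carrier_mat n n"
  shows "mat_trace (R * M * R\<^sup>T) = mat_trace M"
proof -
  have d: "dim_row R = d" "dim_col R = n" "dim_row M = n" "dim_col M = n" using R M by auto
  have "mat_trace (R * (M * R\<^sup>T)) = mat_trace (M * R\<^sup>T * R)"
    using trace_mult_comm_dim[of R "M * R\<^sup>T"] by (simp add: d)
  also have "M * R\<^sup>T * R = M * (R\<^sup>T * R)" by (rule mult_assoc_dim) (simp_all add: d)
  also have "\<dots> = M" unfolding R(2) by (simp add: d)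
  finally show ?thesis by (simp add: mult_assoc_dim d)
qed

lemma spectral_frobenius_norm:
  assumes sd: "spectral_decomp n X U l"
  shows "(frobenius_norm X)\<^sup>2 = (\<Sum>i<n. (l i)\<^sup>2)"
proof -
  have U: "U \<in> carrier_mat n n" "U\<^sup>T * U = 1\<^sub>m n" "X = U * mat_diag n l * U\<^sup>T"
    using sd by (auto simp: spectral_decomp_def)
  have "frobenius_norm X = frobenius_norm (mat_diag n l)"
    unfolding U(3) by (rule frobenius_norm_conj_isometry[OF U(1,2)]) simp
  also have "(\<dots>)\<^sup>2 = (\<Sum>i<n. \<Sum>j<n. (if i = j then l j else 0)\<^sup>2)"
    unfolding frobenius_norm_def by (simp add: sum_nonneg) (simp add: mat_diag_def)
  also have "\<dots> = (\<Sum>i<n. \<Sum>j<n. if i = j then (l j)\<^sup>2 else 0)"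
    by (intro sum.cong refl) auto
  finally show ?thesis by simp
qed

lemma spectral_decomp_shift:
  assumes sd: "spectral_decomp n X U l"
  shows "spectral_decomp n (a \<cdot>\<^sub>m 1\<^sub>m n - X) U (\<lambda>i. a - l i)"
proof -
  have U: "U \<in> carrier_mat n n" "U\<^sup>T * U = 1\<^sub>m n" "U * U\<^sup>T = 1\<^sub>m n" "X = U * mat_diag n l * U\<^sup>T"
    using sd by (auto simp: spectral_decomp_def)
  have d: "dim_row U = n" "dim_col U = n" using U by auto
  have "mat_diag n (\<lambda>i. a - l i) = a \<cdot>\<^sub>m 1\<^sub>m n - mat_diag n l" by (auto simp: mat_diag_def)
  then have "U * mat_diag n (\<lambda>i. a - l i) * U\<^sup>T = a \<cdot>\<^sub>m (U * U\<^sup>T) - X"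
    unfolding U(4) by (simp add: d mat_dim_distribs mult_assoc_dim)
  then show ?thesis using U(1-3) by (simp add: spectral_decomp_def)
qed

lemma spectral_bound:
  assumes sd: "spectral_decomp n X U l" and l: "\<And>i. i < n \<Longrightarrow> \<bar>l i\<bar> \<le> b" and b: "0 \<le> b" and x: "x \<in> carrier_vec n"
  shows "l2_norm (X *\<^sub>v x) \<le> b * l2_norm x"
proof -
  have "(X *\<^sub>v x) \<bullet> (X *\<^sub>v x) = (\<Sum>i<n. (l i)\<^sup>2 * ((U\<^sup>T *\<^sub>v x) $ i)\<^sup>2)"
    by (rule spectral_quadratic_form(2)[OF sd x])
  also have "\<dots> \<le> (\<Sum>i<n. b\<^sup>2 * ((U\<^sup>T *\<^sub>v x) $ i)\<^sup>2)"
    using l b by (intro sum_mono mult_right_mono) (auto simp: abs_le_square_iff[symmetric])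
  also have "\<dots> = b\<^sup>2 * (x \<bullet> x)"
    by (simp add: spectral_quadratic_form(3)[OF sd x] sum_distrib_left)
  finally have "(l2_norm (X *\<^sub>v x))\<^sup>2 \<le> (b * l2_norm x)\<^sup>2" by (simp add: l2_norm_sq power_mult_distrib)
  then show ?thesis by (rule power2_le_imp_le) (simp add: b)
qed

text \<open>Averaging \<open>(l\<^sub>i - a) (b - l\<^sub>i) \<ge> 0\<close> bounds the second moment by the first.\<close>

lemma popoviciu:
  fixes w l :: "nat \<Rightarrow> real"
  assumes w: "\<And>i. i < n \<Longrightarrow> 0 \<le> w i" and sw: "(\<Sum>i<n. w i) = 1" and l: "\<And>i. i < n \<Longrightarrow> a \<le> l i \<and> l i \<le> b"
  shows "(\<Sum>i<n. (l i)\<^sup>2 * w i) - (\<Sum>i<n. l i * w i)\<^sup>2 \<le> ((b - a) / 2)\<^sup>2"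
proof -
  define t where "t = (\<Sum>i<n. l i * w i)"
  have "0 \<le> (\<Sum>i<n. (l i - a) * (b - l i) * w i)"
    using w l by (intro sum_nonneg mult_nonneg_nonneg) auto
  also have "\<dots> = (\<Sum>i<n. (a + b) * (l i * w i) - a * b * w i - (l i)\<^sup>2 * w i)"
    by (intro sum.cong) (auto simp: algebra_simps power2_eq_square)
  also have "\<dots> = (a + b) * t - a * b - (\<Sum>i<n. (l i)\<^sup>2 * w i)"
    using sw by (simp add: sum_subtractf sum_distrib_left[symmetric] t_def)
  finally have "(\<Sum>i<n. (l i)\<^sup>2 * w i) - t\<^sup>2 \<le> (a + b) * t - a * b - t\<^sup>2" by simp
  also have "\<dots> = ((b - a) / 2)\<^sup>2 - (t - (a + b) / 2)\<^sup>2" by (simp add: power2_eq_square field_simps)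
  also have "\<dots> \<le> ((b - a) / 2)\<^sup>2" by simp
  finally show ?thesis by (simp add: t_def)
qed

subsection \<open>The error of a mean-field approximation\<close>

text \<open>The coordinate side of the problem: \<open>B\<close> will be the inverse Schur
  complement, \<open>h\<close> the vector \<open>u_hat\<close>, and k = d-m-1. \<open>W_orth\<close>
  contains the orthonormality of \<open>V\<close> as well as its orthogonality to
  \<open>h\<close>.\<close>

locale mean_field =
  fixes B V :: "real mat" and h :: "real vec" and k :: nat
  assumes B: "B \<in> carrier_mat (Suc k) (Suc k)" "B\<^sup>T = B"
    and h: "h \<in> carrier_vec (Suc k)"
    and V: "V \<in> carrier_mat (Suc k) k"
    and W_orth: "(mat_of_cols (Suc k) (h # cols V))\<^sup>T * mat_of_cols (Suc k) (h # cols V) = 1\<^sub>m (Suc k)"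
    and k: "0 < k"
begin

definition "W = mat_of_cols (Suc k) (h # cols V)"
definition "c = V\<^sup>T *\<^sub>v (B *\<^sub>v h)"
definition "D = V\<^sup>T * B * V"
text \<open>The Rayleigh quotient at the unit vector \<open>h\<close>. For \<open>h\<close>
  proportional to \<open>S\<^sup>-\<^sup>1 e\<^sub>1\<close> it is p_3 / p_2, which is the ratio
  called \<open>\<sigma>\<^sub>u\<close> in the theorem.\<close>

definition "\<sigma> = h \<bullet> (B *\<^sub>v h)"
definition "\<omega> = (mat_trace B - \<sigma>) / k"
definition "M = \<sigma> \<cdot>\<^sub>m outer_prod h h + \<omega> \<cdot>\<^sub>m (1\<^sub>m (Suc k) - outer_prod h h) - B"
definition "E = four_block_mat (0\<^sub>m 1 1) (mat_of_rows k [- c]) (mat_of_cols k [- c]) (\<omega> \<cdot>\<^sub>m 1\<^sub>m k - D)"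

lemma dims [simp]:
  "dim_row B = Suc k" "dim_col B = Suc k" "dim_vec h = Suc k" "dim_row V = Suc k" "dim_col V = k"
  "dim_row W = Suc k" "dim_col W = Suc k" "dim_vec c = k" "dim_row D = k" "dim_col D = k"
  "dim_row M = Suc k" "dim_col M = Suc k" "dim_row E = Suc k" "dim_col E = Suc k"
  using B h V by (auto simp: W_def c_def D_def M_def E_def)

lemma carriers: "W \<in> carrier_mat (Suc k) (Suc k)" "c \<in> carrier_vec k" "D \<in> carrier_mat k k"
  "M \<in> carrier_mat (Suc k) (Suc k)" "E \<in> carrier_mat (Suc k) (Suc k)"
  by (auto intro!: carrier_matI carrier_vecI)

lemma col_W: "col W 0 = h" "j < k \<Longrightarrow> col W (Suc j) = col V j"
  using h V by (auto simp: W_def)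

lemma WTW: "W\<^sup>T * W = 1\<^sub>m (Suc k)" using W_orth by (simp add: W_def)

lemma WWT: "W * W\<^sup>T = 1\<^sub>m (Suc k)"
  using mat_mult_left_right_inverse[OF _ carriers(1) WTW] carriers(1) by simp

lemma col_W_scalar: "i < Suc k \<Longrightarrow> j < Suc k \<Longrightarrow> col W i \<bullet> col W j = (if i = j then 1 else 0)"
  using arg_cong[OF WTW, of "\<lambda>M. M $$ (i,j)"] by simp

lemma hh: "h \<bullet> h = 1"
  using col_W_scalar[of 0 0] by (simp add: col_W)

lemma VTV: "V\<^sup>T * V = 1\<^sub>m k"
  by (rule eq_matI) (use col_W_scalar[of "Suc _" "Suc _"] in \<open>auto simp: col_W\<close>)

lemma VTh: "V\<^sup>T *\<^sub>v h = 0\<^sub>v k"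
  by (rule eq_vecI) (use col_W_scalar[of "Suc _" 0] in \<open>auto simp: col_W\<close>)

text \<open>This is \<open>W W\<^sup>T = 1\<close> with the contribution of the first column
  separated.\<close>

lemma sum_one: "outer_prod h h + V * V\<^sup>T = 1\<^sub>m (Suc k)"
proof (rule eq_matI)
  fix i j assume "i < dim_row (1\<^sub>m (Suc k))" "j < dim_col (1\<^sub>m (Suc k))"
  then have ij: "i < Suc k" "j < Suc k" by auto
  have "(1\<^sub>m (Suc k) :: real mat) $$ (i,j) = (\<Sum>l<Suc k. W $$ (i,l) * W $$ (j,l))"
    using ij by (simp add: WWT[symmetric] scalar_prod_def atLeast0LessThan)
  also have "\<dots> = col W 0 $ i * col W 0 $ j + (\<Sum>l<k. col W (Suc l) $ i * col W (Suc l) $ j)"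
    using ij by (simp add: sum.lessThan_Suc_shift del: sum.lessThan_Suc)
  also have "\<dots> = (outer_prod h h + V * V\<^sup>T) $$ (i,j)"
    using ij by (simp add: col_W scalar_prod_def atLeast0LessThan)
  finally show "(outer_prod h h + V * V\<^sup>T) $$ (i,j) = 1\<^sub>m (Suc k) $$ (i,j)" ..
qed auto

lemma expand:
  assumes "x \<in> carrier_vec (Suc k)"
  shows "x = (h \<bullet> x) \<cdot>\<^sub>v h + V *\<^sub>v (V\<^sup>T *\<^sub>v x)"
proof -
  have "x = (outer_prod h h + V * V\<^sup>T) *\<^sub>v x" using assms by (simp add: sum_one)
  then show ?thesis using assms by (simp add: add_mult_vec_dim outer_prod_mult_vec mult_vec_assoc_dim)
qed

lemma scalar_split:
  assumes y: "y \<in> carrier_vec k"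
  shows "(a \<cdot>\<^sub>v h + V *\<^sub>v y) \<bullet> (a \<cdot>\<^sub>v h + V *\<^sub>v y) = a\<^sup>2 + y \<bullet> y"
proof -
  have Vy: "V *\<^sub>v y \<in> carrier_vec (Suc k)" by (rule carrier_vecI) simp
  have 0: "h \<bullet> (V *\<^sub>v y) = 0" using scalar_mult_mat_vec[OF V h y] y by (simp add: VTh)
  then have "(V *\<^sub>v y) \<bullet> h = 0" using comm_scalar_prod[OF Vy h] by simp
  then show ?thesis
    using 0 h Vy isometry_scalar_prod[OF V VTV y y]
    by (simp add: scalar_prod_add_distrib[of _ "Suc k"] add_scalar_prod_distrib[of _ "Suc k"] hh power2_eq_square)
qed

lemma scalar_expand:
  assumes "x \<in> carrier_vec (Suc k)"
  shows "x \<bullet> x = (h \<bullet> x)\<^sup>2 + (V\<^sup>T *\<^sub>v x) \<bullet> (V\<^sup>T *\<^sub>v x)"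
proof -
  have y: "V\<^sup>T *\<^sub>v x \<in> carrier_vec k" by (rule carrier_vecI) simp
  show ?thesis using scalar_split[OF y, of "h \<bullet> x"] expand[OF assms] by simp
qed

lemma Bh: "B *\<^sub>v h = \<sigma> \<cdot>\<^sub>v h + V *\<^sub>v c"
  using expand[of "B *\<^sub>v h"] B h by (simp add: c_def \<sigma>_def)

text \<open>Pythagoras for \<open>B h = \<sigma> h + V c\<close>. The right-hand side is the
  variance of the spectral measure of \<open>B\<close> at \<open>h\<close>.\<close>

lemma c_norm: "(l2_norm c)\<^sup>2 = (B *\<^sub>v h) \<bullet> (B *\<^sub>v h) - \<sigma>\<^sup>2"
  using scalar_expand[of "B *\<^sub>v h"] B h by (simp add: l2_norm_sq c_def \<sigma>_def)

text \<open>Inserting the resolution \<open>sum_one\<close> of the identity splits the trace of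
  \<open>B\<close> into its value at \<open>h\<close> and, by cyclicity, the trace of the
  compression. It turns the definition of \<open>\<omega>\<close> into the mean of the spectrum of
  \<open>D\<close>.\<close>

lemma trace_D: "mat_trace D = mat_trace B - \<sigma>"
proof -
  have "mat_trace B = mat_trace (B * (outer_prod h h + V * V\<^sup>T))" by (simp add: sum_one)
  also have "\<dots> = mat_trace (outer_prod (B *\<^sub>v h) h + B * V * V\<^sup>T)"
    by (simp add: mult_add_dim mult_outer_prod mult_assoc_dim)
  also have "\<dots> = mat_trace (outer_prod (B *\<^sub>v h) h) + mat_trace (B * V * V\<^sup>T)"
    by (simp add: mat_trace_def sum.distrib del: index_mult_mat(1) sum.lessThan_Suc)
  also have "mat_trace (B * V * V\<^sup>T) = mat_trace D"
    using trace_mult_comm_dim[of "B * V" "V\<^sup>T"] by (simp add: D_def mult_assoc_dim)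
  also have "mat_trace (outer_prod (B *\<^sub>v h) h) = (B *\<^sub>v h) \<bullet> h"
    by (simp add: mat_trace_def scalar_prod_def atLeast0LessThan del: sum.lessThan_Suc)
  also have "\<dots> = \<sigma>" unfolding \<sigma>_def using B h by (intro comm_scalar_prod) auto
  finally show ?thesis by simp
qed

lemma \<omega>_eq: "\<omega> = mat_trace D / k"
  by (simp add: \<omega>_def trace_D)

lemma M_mult_vec:
  assumes x: "x \<in> carrier_vec (Suc k)"
  shows "M *\<^sub>v x = (\<sigma> * (h \<bullet> x)) \<cdot>\<^sub>v h + \<omega> \<cdot>\<^sub>v (V *\<^sub>v (V\<^sup>T *\<^sub>v x)) - B *\<^sub>v x"
proof -
  have "1\<^sub>m (Suc k) - outer_prod h h = V * V\<^sup>T"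
    unfolding sum_one[symmetric] by (rule eq_matI) (auto simp del: index_mult_mat(1))
  then have "M = \<sigma> \<cdot>\<^sub>m outer_prod h h + \<omega> \<cdot>\<^sub>m (V * V\<^sup>T) - B" by (simp add: M_def)
  then show ?thesis using x
    by (simp add: minus_mult_vec_dim add_mult_vec_dim smult_mult_vec_dim outer_prod_mult_vec mult_vec_assoc_dim smult_smult_assoc)
qed

lemma B_mult_vec:
  assumes x: "x \<in> carrier_vec (Suc k)"
  shows "h \<bullet> (B *\<^sub>v x) = \<sigma> * (h \<bullet> x) + c \<bullet> (V\<^sup>T *\<^sub>v x)"
    and "V\<^sup>T *\<^sub>v (B *\<^sub>v x) = (h \<bullet> x) \<cdot>\<^sub>v c + D *\<^sub>v (V\<^sup>T *\<^sub>v x)"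
proof -
  have y: "V\<^sup>T *\<^sub>v x \<in> carrier_vec k" by (rule carrier_vecI) simp
  have Vc: "V *\<^sub>v c \<in> carrier_vec (Suc k)" by (rule carrier_vecI) simp
  have "h \<bullet> (B *\<^sub>v x) = (B *\<^sub>v h) \<bullet> x" using scalar_mult_mat_vec[OF B(1) h x] B(2) by simp
  also have "\<dots> = \<sigma> * (h \<bullet> x) + (V *\<^sub>v c) \<bullet> x"
    unfolding Bh using h x Vc by (simp add: add_scalar_prod_distrib[of _ "Suc k"])
  also have "(V *\<^sub>v c) \<bullet> x = c \<bullet> (V\<^sup>T *\<^sub>v x)"
    using scalar_mult_mat_vec[of "V\<^sup>T" k "Suc k" c x] V carriers(2) x by simp
  finally show "h \<bullet> (B *\<^sub>v x) = \<sigma> * (h \<bullet> x) + c \<bullet> (V\<^sup>T *\<^sub>v x)" .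
  have "V\<^sup>T *\<^sub>v (B *\<^sub>v x) = (V\<^sup>T * B) *\<^sub>v ((h \<bullet> x) \<cdot>\<^sub>v h + V *\<^sub>v (V\<^sup>T *\<^sub>v x))"
    using x by (simp add: expand[OF x, symmetric] mult_vec_assoc_dim)
  also have "\<dots> = (V\<^sup>T * B) *\<^sub>v ((h \<bullet> x) \<cdot>\<^sub>v h) + (V\<^sup>T * B) *\<^sub>v (V *\<^sub>v (V\<^sup>T *\<^sub>v x))"
    by (rule mult_add_vec_dim) simp_all
  also have "\<dots> = (h \<bullet> x) \<cdot>\<^sub>v c + D *\<^sub>v (V\<^sup>T *\<^sub>v x)"
    by (simp add: mult_vec_smult_dim mult_vec_assoc_dim c_def D_def)
  finally show "V\<^sup>T *\<^sub>v (B *\<^sub>v x) = (h \<bullet> x) \<cdot>\<^sub>v c + D *\<^sub>v (V\<^sup>T *\<^sub>v x)" .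
qed

text \<open>The first summand is the action of the two off-diagonal blocks, the second that of the
  diagonal block. The grouping is made for the operator norm, where the two are estimated
  separately.\<close>

lemma M_mult_vec_split:
  assumes x: "x \<in> carrier_vec (Suc k)"
  shows "M *\<^sub>v x = ((- (c \<bullet> (V\<^sup>T *\<^sub>v x))) \<cdot>\<^sub>v h + V *\<^sub>v ((- (h \<bullet> x)) \<cdot>\<^sub>v c))
    + V *\<^sub>v ((\<omega> \<cdot>\<^sub>m 1\<^sub>m k - D) *\<^sub>v (V\<^sup>T *\<^sub>v x))"
proof -
  define y where "y = V\<^sup>T *\<^sub>v x"
  have y: "dim_vec y = k" by (simp add: y_def)
  have "B *\<^sub>v x = (\<sigma> * (h \<bullet> x) + c \<bullet> y) \<cdot>\<^sub>v h + V *\<^sub>v ((h \<bullet> x) \<cdot>\<^sub>v c + D *\<^sub>v y)"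
    using expand[of "B *\<^sub>v x"] B_mult_vec[OF x] B x by (simp add: y_def)
  also have "V *\<^sub>v ((h \<bullet> x) \<cdot>\<^sub>v c + D *\<^sub>v y) = (h \<bullet> x) \<cdot>\<^sub>v (V *\<^sub>v c) + V *\<^sub>v (D *\<^sub>v y)"
    using y by (simp add: mult_add_vec_dim mult_vec_smult_dim)
  finally have Bx: "B *\<^sub>v x = (\<sigma> * (h \<bullet> x) + c \<bullet> y) \<cdot>\<^sub>v h + ((h \<bullet> x) \<cdot>\<^sub>v (V *\<^sub>v c) + V *\<^sub>v (D *\<^sub>v y))" .
  have "(\<omega> \<cdot>\<^sub>m 1\<^sub>m k - D) *\<^sub>v y = \<omega> \<cdot>\<^sub>v y - D *\<^sub>v y"
    using y by (simp add: minus_mult_vec_dim smult_mult_vec_dim one_mult_vec_dim)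
  then have "V *\<^sub>v ((\<omega> \<cdot>\<^sub>m 1\<^sub>m k - D) *\<^sub>v y) = \<omega> \<cdot>\<^sub>v (V *\<^sub>v y) - V *\<^sub>v (D *\<^sub>v y)"
    using y by (simp add: mult_minus_vec_dim mult_vec_smult_dim)
  then show ?thesis unfolding M_mult_vec[OF x] Bx y_def[symmetric]
    by (intro eq_vecI) (auto simp: mult_vec_smult_dim algebra_simps simp del: index_mult_mat_vec)
qed

lemma W_mult_vCons:
  assumes "y \<in> carrier_vec k"
  shows "W *\<^sub>v vCons a y = a \<cdot>\<^sub>v h + V *\<^sub>v y"
proof (rule eq_vecI)
  fix i assume "i < dim_vec (a \<cdot>\<^sub>v h + V *\<^sub>v y)"
  then have i: "i < Suc k" by simp
  have "(W *\<^sub>v vCons a y) $ i = (\<Sum>l<Suc k. col W l $ i * vCons a y $ l)"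
    using i assms by (simp add: scalar_prod_def atLeast0LessThan)
  also have "\<dots> = h $ i * a + (\<Sum>l<k. col V l $ i * y $ l)"
    using assms by (simp add: sum.lessThan_Suc_shift col_W del: sum.lessThan_Suc)
  finally show "(W *\<^sub>v vCons a y) $ i = (a \<cdot>\<^sub>v h + V *\<^sub>v y) $ i"
    using i assms by (simp add: scalar_prod_def atLeast0LessThan mult.commute)
qed simp

lemma WT_mult_vec: "x \<in> carrier_vec (Suc k) \<Longrightarrow> W\<^sup>T *\<^sub>v x = vCons (h \<bullet> x) (V\<^sup>T *\<^sub>v x)"
proof (rule eq_vecI)
  fix i assume "i < dim_vec (vCons (h \<bullet> x) (V\<^sup>T *\<^sub>v x))"
  then show "(W\<^sup>T *\<^sub>v x) $ i = vCons (h \<bullet> x) (V\<^sup>T *\<^sub>v x) $ i"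
    by (cases i) (simp_all add: col_W)
qed simp

lemma E_index:
  "E $$ (0,0) = 0" "j < k \<Longrightarrow> E $$ (0,Suc j) = - c $ j" "j < k \<Longrightarrow> E $$ (Suc j,0) = - c $ j"
  "i < k \<Longrightarrow> j < k \<Longrightarrow> E $$ (Suc i,Suc j) = (\<omega> \<cdot>\<^sub>m 1\<^sub>m k - D) $$ (i,j)"
  by (simp_all add: E_def mat_of_rows_index mat_of_cols_index)

lemma E_mult_vCons:
  assumes "y \<in> carrier_vec k"
  shows "E *\<^sub>v vCons a y = vCons (- (c \<bullet> y)) ((- a) \<cdot>\<^sub>v c + (\<omega> \<cdot>\<^sub>m 1\<^sub>m k - D) *\<^sub>v y)"
proof (rule eq_vecI)
  fix i assume "i < dim_vec (vCons (- (c \<bullet> y)) ((- a) \<cdot>\<^sub>v c + (\<omega> \<cdot>\<^sub>m 1\<^sub>m k - D) *\<^sub>v y))"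
  then have i: "i < Suc k" by simp
  have "(E *\<^sub>v vCons a y) $ i = (\<Sum>l<Suc k. E $$ (i,l) * vCons a y $ l)"
    using i assms by (simp add: scalar_prod_def atLeast0LessThan)
  also have "\<dots> = E $$ (i,0) * a + (\<Sum>l<k. E $$ (i,Suc l) * y $ l)"
    using assms by (simp add: sum.lessThan_Suc_shift del: sum.lessThan_Suc)
  also have "\<dots> = vCons (- (c \<bullet> y)) ((- a) \<cdot>\<^sub>v c + (\<omega> \<cdot>\<^sub>m 1\<^sub>m k - D) *\<^sub>v y) $ i"
  proof (cases i)
    case 0
    then show ?thesis using assms
      by (simp add: E_index scalar_prod_def atLeast0LessThan sum_negf)
  next
    case (Suc j)
    then have "j < k" using i by simp
    then show ?thesis using assms unfolding Suc
      by (simp add: E_index scalar_prod_def atLeast0LessThan mult.commute)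
  qed
  finally show "(E *\<^sub>v vCons a y) $ i = \<dots>" .
qed simp

text \<open>In the coordinates (h.x, V^T x) given by \<open>W\<^sup>T\<close>, the block action of
  \<open>E\<close> is the split just computed, so both sides agree on every vector.\<close>

lemma M_eq: "M = W * E * W\<^sup>T"
proof (rule eq_mat_by_mult_vec[of _ "Suc k" "Suc k"])
  show "W * E * W\<^sup>T \<in> carrier_mat (Suc k) (Suc k)" by (rule carrier_matI) simp_all
  fix x :: "real vec" assume x: "x \<in> carrier_vec (Suc k)"
  define y where "y = V\<^sup>T *\<^sub>v x"
  have y: "y \<in> carrier_vec k" unfolding y_def by (rule carrier_vecI) simp
  have z: "(- (h \<bullet> x)) \<cdot>\<^sub>v c + (\<omega> \<cdot>\<^sub>m 1\<^sub>m k - D) *\<^sub>v y \<in> carrier_vec k" by (rule carrier_vecI) simp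
  have "W * E * W\<^sup>T *\<^sub>v x = W *\<^sub>v (E *\<^sub>v vCons (h \<bullet> x) y)"
    using x by (simp add: mult_vec_assoc_dim WT_mult_vec y_def)
  also have "\<dots> = (- (c \<bullet> y)) \<cdot>\<^sub>v h + V *\<^sub>v ((- (h \<bullet> x)) \<cdot>\<^sub>v c + (\<omega> \<cdot>\<^sub>m 1\<^sub>m k - D) *\<^sub>v y)"
    unfolding E_mult_vCons[OF y] W_mult_vCons[OF z] ..
  also have "\<dots> = M *\<^sub>v x"
    unfolding M_mult_vec_split[OF x] y_def[symmetric]
    by (subst mult_add_vec_dim; (intro eq_vecI)?) (auto simp del: index_mult_mat_vec)
  finally show "M *\<^sub>v x = W * E * W\<^sup>T *\<^sub>v x" ..
qed (rule carriers)

text \<open>\<open>\<omega>\<close> is the one value with this property: the projection orthogonal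
  to \<open>h\<close> has trace k, and \<open>\<omega>\<close> spreads the remaining trace of
  \<open>B\<close> evenly over it.\<close>

lemma trace_M: "mat_trace M = 0"
proof -
  have "mat_trace (outer_prod h h) = 1"
    using hh by (simp add: mat_trace_def scalar_prod_def atLeast0LessThan del: sum.lessThan_Suc)
  moreover have "mat_trace (1\<^sub>m (Suc k)) = Suc k" by (simp add: mat_trace_def)
  moreover have "mat_trace M = \<sigma> * mat_trace (outer_prod h h) + \<omega> * (mat_trace (1\<^sub>m (Suc k)) - mat_trace (outer_prod h h)) - mat_trace B"
    by (simp add: M_def mat_trace_def sum.distrib sum_subtractf sum_distrib_left right_diff_distrib del: sum.lessThan_Suc)
  ultimately show ?thesis using k by (simp add: \<omega>_def)
qed

lemma M_uu: "h \<bullet> (M *\<^sub>v h) = 0"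
proof -
  have Bh: "B *\<^sub>v h \<in> carrier_vec (Suc k)" by (rule carrier_vecI) simp
  have "M *\<^sub>v h = \<sigma> \<cdot>\<^sub>v h - B *\<^sub>v h"
    unfolding M_mult_vec[OF h] VTh hh by (rule eq_vecI) (auto simp: scalar_prod_def)
  then show ?thesis using h Bh hh by (simp add: scalar_prod_minus_distrib[of _ "Suc k"] \<sigma>_def)
qed

text \<open>The first column of \<open>E\<close> is (0, -c). Hence \<open>h\<close> is the test
  vector behind the lower bound of the spectral norm.\<close>

lemma M_mult_h: "l2_norm (M *\<^sub>v h) = l2_norm c"
proof -
  have "M *\<^sub>v h = 0 \<cdot>\<^sub>v h + V *\<^sub>v ((- 1) \<cdot>\<^sub>v c)"
    unfolding M_mult_vec_split[OF h] VTh hh by (rule eq_vecI) (auto simp: scalar_prod_def)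
  then show ?thesis using scalar_split[of "(- 1) \<cdot>\<^sub>v c" 0] carriers(2) by (simp add: l2_norm_def)
qed

lemma D_sym: "D\<^sup>T = D"
  by (simp add: D_def transpose_mult_dim mult_assoc_dim B(2))

lemma V_orth: "x \<in> carrier_vec k \<Longrightarrow> h \<bullet> (V *\<^sub>v x) = 0"
  using scalar_mult_mat_vec[OF V h] by (simp add: VTh)

text \<open>\<open>W\<close> is orthogonal, so \<open>M\<close> vanishes exactly when
  \<open>E\<close> does, and the entries of \<open>E\<close> can be read off.\<close>

lemma M_eq_0_iff: "M = 0\<^sub>m (Suc k) (Suc k) \<longleftrightarrow> c = 0\<^sub>v k \<and> D = \<omega> \<cdot>\<^sub>m 1\<^sub>m k"
proof
  assume M0: "M = 0\<^sub>m (Suc k) (Suc k)"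
  have "W\<^sup>T * M * W = W\<^sup>T * W * (E * (W\<^sup>T * W))" by (simp add: M_eq mult_assoc_dim)
  then have "E = W\<^sup>T * M * W" by (simp add: WTW)
  then have E0: "E = 0\<^sub>m (Suc k) (Suc k)" by (simp add: M0)
  have "c = 0\<^sub>v k"
    by (rule eq_vecI) (use E_index(2) in \<open>auto simp: E0\<close>)
  moreover have "D = \<omega> \<cdot>\<^sub>m 1\<^sub>m k"
    by (rule eq_matI) (use E_index(4) in \<open>auto simp: E0\<close>)
  ultimately show "c = 0\<^sub>v k \<and> D = \<omega> \<cdot>\<^sub>m 1\<^sub>m k" ..
next
  assume *: "c = 0\<^sub>v k \<and> D = \<omega> \<cdot>\<^sub>m 1\<^sub>m k"
  have "E $$ (i,j) = 0" if "i < Suc k" "j < Suc k" for i j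
    using that * by (cases i; cases j) (auto simp: E_index)
  then have "E = 0\<^sub>m (Suc k) (Suc k)" by (intro eq_matI) auto
  then show "M = 0\<^sub>m (Suc k) (Suc k)" by (simp add: M_eq)
qed

text \<open>\<open>V c\<close> is the component of \<open>B h\<close> orthogonal to
  \<open>h\<close>.\<close>

lemma c_eq_0_iff: "c = 0\<^sub>v k \<longleftrightarrow> (\<exists>l. B *\<^sub>v h = l \<cdot>\<^sub>v h)"
proof
  assume "c = 0\<^sub>v k"
  then have "B *\<^sub>v h = \<sigma> \<cdot>\<^sub>v h" unfolding Bh by (intro eq_vecI) (auto simp: scalar_prod_def)
  then show "\<exists>l. B *\<^sub>v h = l \<cdot>\<^sub>v h" ..
next
  assume "\<exists>l. B *\<^sub>v h = l \<cdot>\<^sub>v h"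
  then obtain l where "B *\<^sub>v h = l \<cdot>\<^sub>v h" ..
  then show "c = 0\<^sub>v k" by (auto simp: c_def mult_vec_smult_dim VTh)
qed

text \<open>When c = 0, the complement of \<open>h\<close> is invariant under \<open>B\<close>, and
  \<open>V\<close> identifies the restriction of \<open>B\<close> to it with
  \<open>D\<close>.\<close>

lemma D_scalar_iff:
  assumes c0: "c = 0\<^sub>v k"
  shows "D = \<omega> \<cdot>\<^sub>m 1\<^sub>m k \<longleftrightarrow> (\<exists>l. \<forall>x \<in> carrier_vec (Suc k). x \<bullet> h = 0 \<longrightarrow> B *\<^sub>v x = l \<cdot>\<^sub>v x)"
proof
  assume D: "D = \<omega> \<cdot>\<^sub>m 1\<^sub>m k"
  have "B *\<^sub>v x = \<omega> \<cdot>\<^sub>v x" if x: "x \<in> carrier_vec (Suc k)" "x \<bullet> h = 0" for x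
  proof -
    have hx: "h \<bullet> x = 0" using x comm_scalar_prod[OF h x(1)] by simp
    have "x = 0 \<cdot>\<^sub>v h + V *\<^sub>v (V\<^sup>T *\<^sub>v x)" using expand[OF x(1)] by (simp only: hx)
    also have "\<dots> = V *\<^sub>v (V\<^sup>T *\<^sub>v x)" by (rule eq_vecI) (auto simp del: index_mult_mat_vec)
    finally have x': "V *\<^sub>v (V\<^sup>T *\<^sub>v x) = x" ..
    have "B *\<^sub>v x = (h \<bullet> (B *\<^sub>v x)) \<cdot>\<^sub>v h + V *\<^sub>v (V\<^sup>T *\<^sub>v (B *\<^sub>v x))"
      by (rule expand) (rule carrier_vecI, simp)
    also have "h \<bullet> (B *\<^sub>v x) = 0"
      unfolding B_mult_vec(1)[OF x(1)] hx c0 by (simp add: scalar_prod_def)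
    also have "V\<^sup>T *\<^sub>v (B *\<^sub>v x) = \<omega> \<cdot>\<^sub>v (V\<^sup>T *\<^sub>v x)"
      unfolding B_mult_vec(2)[OF x(1)] hx c0 D 
      by (intro eq_vecI) (auto simp: smult_mult_vec_dim one_mult_vec_dim simp del: index_mult_mat_vec)
    also have "V *\<^sub>v (\<omega> \<cdot>\<^sub>v (V\<^sup>T *\<^sub>v x)) = \<omega> \<cdot>\<^sub>v x" by (simp add: mult_vec_smult_dim x')
    finally show ?thesis using x(1) by (auto intro!: eq_vecI)
  qed
  then show "\<exists>l. \<forall>x \<in> carrier_vec (Suc k). x \<bullet> h = 0 \<longrightarrow> B *\<^sub>v x = l \<cdot>\<^sub>v x" by blast
next
  assume "\<exists>l. \<forall>x \<in> carrier_vec (Suc k). x \<bullet> h = 0 \<longrightarrow> B *\<^sub>v x = l \<cdot>\<^sub>v x"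
  then obtain l where l: "\<And>x. x \<in> carrier_vec (Suc k) \<Longrightarrow> x \<bullet> h = 0 \<Longrightarrow> B *\<^sub>v x = l \<cdot>\<^sub>v x" by blast
  have Dl: "D = l \<cdot>\<^sub>m 1\<^sub>m k"
  proof (rule eq_mat_by_mult_vec[OF carriers(3)])
    show "l \<cdot>\<^sub>m 1\<^sub>m k \<in> carrier_mat k k" by simp
    fix x :: "real vec" assume x: "x \<in> carrier_vec k"
    have Vx: "V *\<^sub>v x \<in> carrier_vec (Suc k)" by (rule carrier_vecI) simp
    have "(V *\<^sub>v x) \<bullet> h = 0" using V_orth[OF x] comm_scalar_prod[OF Vx h] by simp
    then have "D *\<^sub>v x = l \<cdot>\<^sub>v (V\<^sup>T * V *\<^sub>v x)"
      using x l[OF Vx] by (simp add: D_def mult_vec_assoc_dim mult_vec_smult_dim)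
    then show "D *\<^sub>v x = l \<cdot>\<^sub>m 1\<^sub>m k *\<^sub>v x" using x by (simp add: VTV smult_mult_vec_dim)
  qed
  \<comment> \<open>The scalar cannot differ from \<open>\<omega>\<close>, which is the mean of the
    diagonal of \<open>D\<close>; here k > 0 matters.\<close>
  then have "\<omega> = l" using k by (simp add: \<omega>_eq mat_trace_def)
  then show "D = \<omega> \<cdot>\<^sub>m 1\<^sub>m k" using Dl by simp
qed

abbreviation "s \<equiv> \<lambda>i. eigenvalues_desc B ! i"
abbreviation "t \<equiv> \<lambda>i. eigenvalues_desc D ! i"

lemma spectral_D: "\<exists>Z. spectral_decomp k D Z t"
  by (rule symmetric_spectral_decomp(1)[OF carriers(3) D_sym])

text \<open>Cauchy interlacing with codimension 1: the index n - k + i becomes i + 1.\<close>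

lemma interlacing:
  assumes "i < k"
  shows "t i \<le> s i" "s (Suc i) \<le> t i"
proof -
  obtain U where U: "spectral_decomp (Suc k) B U s" using symmetric_spectral_decomp(1)[OF B] by blast
  obtain Z where Z: "spectral_decomp k (V\<^sup>T * B * V) Z t" using spectral_D by (auto simp: D_def)
  note il = cauchy_interlacing[OF U V VTV Z symmetric_spectral_decomp(3)[OF B] symmetric_spectral_decomp(3)[OF carriers(3) D_sym]]
  show "t i \<le> s i" "s (Suc i) \<le> t i" using il[of i] assms by auto
qed

lemma s_bounds: "i < Suc k \<Longrightarrow> s k \<le> s i \<and> s i \<le> s 0"
  using symmetric_spectral_decomp(3)[OF B] by auto

lemma t_bounds: "i < k \<Longrightarrow> s k \<le> t i \<and> t i \<le> s 0"
  using interlacing[of i] s_bounds[of i] s_bounds[of "Suc i"] by auto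

lemma \<omega>_mean: "\<omega> = (\<Sum>i<k. t i) / k"
  using spectral_D spectral_trace by (auto simp: \<omega>_eq)

lemma \<omega>_bounds: "s k \<le> \<omega>" "\<omega> \<le> s 0"
proof -
  have "(\<Sum>i<k. s k) \<le> (\<Sum>i<k. t i)" "(\<Sum>i<k. t i) \<le> (\<Sum>i<k. s 0)"
    by (intro sum_mono; simp add: t_bounds)+
  then show "s k \<le> \<omega>" "\<omega> \<le> s 0" using k by (auto simp: \<omega>_mean field_simps)
qed

lemma s_range_nonneg: "0 \<le> s 0 - s k"
  using s_bounds[of 0] by simp

text \<open>By \<open>c_norm\<close>, ||c||^2 is a variance. The weights for Popoviciu are the
  squared eigencoordinates of \<open>h\<close>, which sum to 1 because \<open>h\<close> is a unit
  vector.\<close>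

lemma c_le: "l2_norm c \<le> (s 0 - s k) / 2"
proof -
  obtain U where U: "spectral_decomp (Suc k) B U s" using symmetric_spectral_decomp(1)[OF B] by blast
  note q = spectral_quadratic_form[OF U h]
  have "(l2_norm c)\<^sup>2 \<le> ((s 0 - s k) / 2)\<^sup>2"
    unfolding c_norm q(2) \<sigma>_def q(1) by (rule popoviciu) (use q(3) hh s_bounds in auto)
  then show ?thesis by (rule power2_le_imp_le) (use s_range_nonneg in simp)
qed

lemma spectral_shift_D: "\<exists>Z. spectral_decomp k (\<omega> \<cdot>\<^sub>m 1\<^sub>m k - D) Z (\<lambda>i. \<omega> - t i)"
  using spectral_D spectral_decomp_shift by blast

lemma l2_norm_M_mult_vec_le:
  assumes x: "x \<in> carrier_vec (Suc k)"
  shows "l2_norm (M *\<^sub>v x) \<le> 3 / 2 * (s 0 - s k) * l2_norm x"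
proof -
  let ?r = "s 0 - s k"
  define y where "y = V\<^sup>T *\<^sub>v x"
  have y: "y \<in> carrier_vec k" unfolding y_def by (rule carrier_vecI) simp
  define v1 where "v1 = (- (c \<bullet> y)) \<cdot>\<^sub>v h + V *\<^sub>v ((- (h \<bullet> x)) \<cdot>\<^sub>v c)"
  define v2 where "v2 = V *\<^sub>v ((\<omega> \<cdot>\<^sub>m 1\<^sub>m k - D) *\<^sub>v y)"
  have xx: "x \<bullet> x = (h \<bullet> x)\<^sup>2 + y \<bullet> y" using scalar_expand[OF x] by (simp add: y_def)
  \<comment> \<open>The components along \<open>h\<close> and along range(V) are orthogonal;
    Cauchy-Schwarz for c.y then bounds the off-diagonal action by ||c|| |x|.\<close>
  have "(l2_norm v1)\<^sup>2 = (c \<bullet> y)\<^sup>2 + (h \<bullet> x)\<^sup>2 * (c \<bullet> c)"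
    unfolding v1_def l2_norm_sq using carriers(2) by (subst scalar_split) (auto simp: power2_eq_square)
  also have "\<dots> \<le> (c \<bullet> c) * (x \<bullet> x)"
    unfolding xx using cauchy_schwarz_vec[OF carriers(2) y] by (simp add: algebra_simps)
  also have "\<dots> = (l2_norm c * l2_norm x)\<^sup>2" by (simp add: power_mult_distrib l2_norm_sq)
  finally have "l2_norm v1 \<le> l2_norm c * l2_norm x" by (rule power2_le_imp_le) simp
  also have "\<dots> \<le> ?r / 2 * l2_norm x" using c_le by (rule mult_right_mono) simp
  finally have 1: "l2_norm v1 \<le> ?r / 2 * l2_norm x" .
  obtain Z where Z: "spectral_decomp k (\<omega> \<cdot>\<^sub>m 1\<^sub>m k - D) Z (\<lambda>i. \<omega> - t i)" using spectral_shift_D by blast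
  have "l2_norm v2 = l2_norm ((\<omega> \<cdot>\<^sub>m 1\<^sub>m k - D) *\<^sub>v y)"
    unfolding v2_def by (rule isometry_l2_norm[OF V VTV]) (rule carrier_vecI, simp)
  also have "\<dots> \<le> ?r * l2_norm y"
    using t_bounds \<omega>_bounds s_range_nonneg by (intro spectral_bound[OF Z _ _ y]) (force simp: abs_le_iff)+
  also have "\<dots> \<le> ?r * l2_norm x"
    unfolding y_def using isometry_transpose_l2_norm_le[OF V VTV x] s_range_nonneg by (rule mult_left_mono)
  finally have 2: "l2_norm v2 \<le> ?r * l2_norm x" .
  have "M *\<^sub>v x = v1 + v2" unfolding M_mult_vec_split[OF x] v1_def v2_def y_def ..
  also have "l2_norm \<dots> \<le> l2_norm v1 + l2_norm v2"
    by (rule l2_norm_triangle[of _ "Suc k"]) (auto simp: v1_def v2_def intro!: carrier_vecI)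
  finally show ?thesis using 1 2 by (simp add: algebra_simps)
qed

text \<open>Conjugation by \<open>W\<close> reduces the norm to the entries of \<open>E\<close>.
  These contribute two copies of ||c||^2 and the sum of squared deviations of the \<open>t i\<close>
  from their mean, which accounts for the factor k + 2.\<close>

lemma frobenius_norm_M_le: "frobenius_norm M \<le> 1 / 2 * (s 0 - s k) * sqrt (real (k + 2))"
proof -
  let ?r = "s 0 - s k"
  obtain Z where Z: "spectral_decomp k (\<omega> \<cdot>\<^sub>m 1\<^sub>m k - D) Z (\<lambda>i. \<omega> - t i)" using spectral_shift_D by blast
  have fsq: "(frobenius_norm X)\<^sup>2 = (\<Sum>i<dim_row X. \<Sum>j<dim_col X. (X $$ (i,j))\<^sup>2)" for X
    by (simp add: frobenius_norm_def sum_nonneg)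
  have "frobenius_norm M = frobenius_norm E"
    unfolding M_eq by (rule frobenius_norm_conj_isometry[OF carriers(1) WTW carriers(5)])
  also have "(\<dots>)\<^sup>2 = 2 * (\<Sum>j<k. (c $ j)\<^sup>2) + (\<Sum>i<k. \<Sum>j<k. ((\<omega> \<cdot>\<^sub>m 1\<^sub>m k - D) $$ (i,j))\<^sup>2)"
    unfolding fsq by (simp add: sum.lessThan_Suc_shift E_index sum.distrib del: sum.lessThan_Suc)
  also have "(\<Sum>i<k. \<Sum>j<k. ((\<omega> \<cdot>\<^sub>m 1\<^sub>m k - D) $$ (i,j))\<^sup>2) = (\<Sum>i<k. (\<omega> - t i)\<^sup>2)"
    using spectral_frobenius_norm[OF Z] fsq[of "\<omega> \<cdot>\<^sub>m 1\<^sub>m k - D"] by simp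
  also have "(\<Sum>j<k. (c $ j)\<^sup>2) = (l2_norm c)\<^sup>2"
    using l2_norm_sq[of c] by (simp add: scalar_prod_def atLeast0LessThan power2_eq_square)
  also have "(\<Sum>i<k. (\<omega> - t i)\<^sup>2) \<le> k * (?r / 2)\<^sup>2"
  proof -
    \<comment> \<open>Popoviciu again, now with the uniform weights 1/k: the mean is
      \<open>\<omega>\<close> and the variance is that of the spectrum of \<open>D\<close>.\<close>
    have "(\<Sum>i<k. (t i)\<^sup>2 * (1 / k)) - (\<Sum>i<k. t i * (1 / k))\<^sup>2 \<le> (?r / 2)\<^sup>2"
      by (rule popoviciu) (use k t_bounds in auto)
    then have "(\<Sum>i<k. (t i)\<^sup>2) / k - \<omega>\<^sup>2 \<le> (?r / 2)\<^sup>2"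
      by (simp add: \<omega>_mean sum_divide_distrib)
    then have "(\<Sum>i<k. (t i)\<^sup>2) - k * \<omega>\<^sup>2 \<le> k * (?r / 2)\<^sup>2"
      using k by (simp add: field_simps)
    moreover have "(\<Sum>i<k. (\<omega> - t i)\<^sup>2) = (\<Sum>i<k. \<omega>\<^sup>2 - 2 * \<omega> * t i + (t i)\<^sup>2)"
      by (intro sum.cong) (auto simp: power2_diff)
    moreover have "\<dots> = (\<Sum>i<k. (t i)\<^sup>2) - k * \<omega>\<^sup>2"
    proof -
      have "(\<Sum>i<k. t i) = k * \<omega>" using k by (simp add: \<omega>_mean)
      then show ?thesis
        by (simp add: sum.distrib sum_subtractf sum_distrib_left[symmetric] power2_eq_square algebra_simps)
    qed
    ultimately show ?thesis by simp
  qed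
  also have "(l2_norm c)\<^sup>2 \<le> (?r / 2)\<^sup>2" using c_le by (intro power_mono) auto
  finally have "(frobenius_norm M)\<^sup>2 \<le> (k + 2) * (?r / 2)\<^sup>2" by (simp add: algebra_simps)
  also have "\<dots> = (1 / 2 * ?r * sqrt (real (k + 2)))\<^sup>2"
    by (simp add: power_mult_distrib power_divide)
  finally show ?thesis by (rule power2_le_imp_le) (use s_range_nonneg in simp)
qed

end

section \<open>Orthogonal complements and rank-one terms in the inverse\<close>

text \<open>The concatenation \<open>Z\<close> of \<open>Q\<close> and \<open>R\<close> is square
  because d = m + n, so \<open>Z\<^sup>T Z = 1\<close> implies
  \<open>Z Z\<^sup>T = 1\<close>.\<close>

lemma orthonormal_completion:
  assumes Q: "(Q :: real mat) \<in> carrier_mat d m" "Q\<^sup>T * Q = 1\<^sub>m m"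
    and R: "R \<in> carrier_mat d n" "R\<^sup>T * R = 1\<^sub>m n" and QR: "Q\<^sup>T * R = 0\<^sub>m m n" and d: "d = m + n"
  shows "Q * Q\<^sup>T + R * R\<^sup>T = 1\<^sub>m d"
proof -
  define Z where "Z = mat d d (\<lambda>(i,j). if j < m then Q $$ (i,j) else R $$ (i,j - m))"
  have Z: "Z \<in> carrier_mat d d" by (simp add: Z_def)
  have colZ: "j < m \<Longrightarrow> col Z j = col Q j" "j < n \<Longrightarrow> col Z (m + j) = col R j" for j
    using Q R by (auto simp: Z_def d)
  have QQ: "i < m \<Longrightarrow> j < m \<Longrightarrow> col Q i \<bullet> col Q j = (if i = j then 1 else 0)" for i j
    using arg_cong[OF Q(2), of "\<lambda>M. M $$ (i,j)"] Q(1) by simp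
  have RR: "i < n \<Longrightarrow> j < n \<Longrightarrow> col R i \<bullet> col R j = (if i = j then 1 else 0)" for i j
    using arg_cong[OF R(2), of "\<lambda>M. M $$ (i,j)"] R(1) by simp
  have QR': "i < m \<Longrightarrow> j < n \<Longrightarrow> col Q i \<bullet> col R j = 0" for i j
    using arg_cong[OF QR, of "\<lambda>M. M $$ (i,j)"] Q(1) R(1) by simp
  have RQ': "i < n \<Longrightarrow> j < m \<Longrightarrow> col R i \<bullet> col Q j = 0" for i j
    using QR'[of j i] comm_scalar_prod[of "col R i" d "col Q j"] Q(1) R(1) by simp
  have "Z\<^sup>T * Z = 1\<^sub>m d"
  proof (rule eq_matI)
    fix i j assume "i < dim_row (1\<^sub>m d)" "j < dim_col (1\<^sub>m d)"
    then have ij: "i < d" "j < d" by auto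
    have "col Z i \<bullet> col Z j = (if i = j then 1 else 0)"
      using colZ(1)[of i] colZ(1)[of j] colZ(2)[of "i - m"] colZ(2)[of "j - m"] ij d
        QQ[of i j] RR[of "i - m" "j - m"] QR'[of i "j - m"] RQ'[of "i - m" j]
      by (cases "i < m"; cases "j < m") auto
    then show "(Z\<^sup>T * Z) $$ (i,j) = 1\<^sub>m d $$ (i,j)" using ij Z by simp
  qed (use Z in auto)
  then have ZZ: "Z * Z\<^sup>T = 1\<^sub>m d" using mat_mult_left_right_inverse[of "Z\<^sup>T" d Z] Z by simp
  have split: "(\<Sum>l<m + n. f l) = (\<Sum>l<m. f l) + (\<Sum>l<n. f (m + l))" for f :: "nat \<Rightarrow> real"
    by (induction n) (auto simp: add.assoc)
  show ?thesis
  proof (rule eq_matI)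
    fix i j assume "i < dim_row (1\<^sub>m d)" "j < dim_col (1\<^sub>m d)"
    then have ij: "i < m + n" "j < m + n" by (auto simp: d)
    have "(1\<^sub>m d :: real mat) $$ (i,j) = (Z * Z\<^sup>T) $$ (i,j)" by (simp only: ZZ)
    also have "\<dots> = (\<Sum>l<m + n. Z $$ (i,l) * Z $$ (j,l))"
      using ij Z by (simp add: scalar_prod_def atLeast0LessThan d)
    also have "\<dots> = (Q * Q\<^sup>T + R * R\<^sup>T) $$ (i,j)"
      unfolding split using ij Q(1) R(1) by (simp add: Z_def d scalar_prod_def atLeast0LessThan)
    finally show "(Q * Q\<^sup>T + R * R\<^sup>T) $$ (i,j) = 1\<^sub>m d $$ (i,j)" ..
  qed (use Q R in auto)
qed

text \<open>It transfers statements between \<open>S\<close> and its inverse in both directions.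
  \<open>X\<close> is a singleton for the eigenvector condition and the complement of
  \<open>u_hat\<close> for the scalar condition. The nonzero member \<open>x0\<close> guarantees
  that \<open>l\<close> can be inverted.\<close>

lemma inverse_acts_as_scalar:
  fixes S B :: "real mat"
  assumes S: "S \<in> carrier_mat n n" and B: "B \<in> carrier_mat n n" and BS: "B * S = 1\<^sub>m n"
    and X: "X \<subseteq> carrier_vec n" "x0 \<in> X" "x0 \<noteq> 0\<^sub>v n" and sc: "\<And>x. x \<in> X \<Longrightarrow> S *\<^sub>v x = l \<cdot>\<^sub>v x"
  shows "\<exists>r. \<forall>x\<in>X. B *\<^sub>v x = r \<cdot>\<^sub>v x"
proof -
  have *: "x = l \<cdot>\<^sub>v (B *\<^sub>v x)" if x: "x \<in> X" for x
  proof -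
    have xc: "x \<in> carrier_vec n" using x X by auto
    have "x = B * S *\<^sub>v x" using xc by (simp add: BS)
    also have "\<dots> = B *\<^sub>v (l \<cdot>\<^sub>v x)" using sc[OF x] xc S B by (simp add: mult_vec_assoc_dim)
    also have "\<dots> = l \<cdot>\<^sub>v (B *\<^sub>v x)" using xc B by (simp add: mult_vec_smult_dim)
    finally show ?thesis .
  qed
  have "l \<noteq> 0"
  proof
    assume "l = 0"
    then have "x0 = 0 \<cdot>\<^sub>v (B *\<^sub>v x0)" using *[OF X(2)] by simp
    also have "\<dots> = 0\<^sub>v n" using B by (intro eq_vecI) auto
    finally show False using X(3) by simp
  qed
  have "B *\<^sub>v x = (1 / l) \<cdot>\<^sub>v x" if "x \<in> X" for x
  proof -
    have "(1 / l) \<cdot>\<^sub>v x = (1 / l) \<cdot>\<^sub>v (l \<cdot>\<^sub>v (B *\<^sub>v x))" using *[OF that] by simp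
    also have "\<dots> = B *\<^sub>v x" using \<open>l \<noteq> 0\<close> by (simp add: smult_smult_assoc)
    finally show ?thesis ..
  qed
  then show ?thesis by blast
qed

text \<open>For K = v e_1^T, each factor \<open>K\<close> in the product (R - K) S^-1 (R - K)^T
  picks out the first column, row or corner of \<open>inv_mat S\<close>. With \<open>q_par\<close>
  for v and \<open>q_perp\<close> for w these are the boundary terms of \<open>Sig\<close>.\<close>

lemma (in orthogonal_splitting) inv_mat_A_expand:
  assumes n: "0 < n" and K: "K = outer_prod v (unit_vec n 0)" and v: "dim_vec v = d"
    and w: "w = R *\<^sub>v (inv_mat S *\<^sub>v unit_vec n 0)"
  shows "inv_mat A = Q * inv_mat T * Q\<^sup>T + (inv_mat S $$ (0,0)) \<cdot>\<^sub>m outer_prod v v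
    - outer_prod v w - outer_prod w v + R * inv_mat S * R\<^sup>T"
proof -
  let ?B = "inv_mat S" and ?e = "unit_vec n 0 :: real vec"
  have KT: "K\<^sup>T = outer_prod ?e v" by (simp add: K transpose_outer_prod)
  have KBR: "K * (?B * R\<^sup>T) = outer_prod v w"
    unfolding K w by (subst outer_prod_mult) (simp_all add: transpose_mult_dim Si(4) mult_vec_assoc_dim)
  have RBK: "R * (?B * K\<^sup>T) = outer_prod w v"
    unfolding KT w by (simp add: mult_outer_prod)
  have "?B * K\<^sup>T = outer_prod (?B *\<^sub>v ?e) v" unfolding KT by (simp add: mult_outer_prod)
  then have "K * (?B * K\<^sup>T) = outer_prod v (((?B *\<^sub>v ?e) \<bullet> ?e) \<cdot>\<^sub>v v)"
    unfolding K by (simp add: outer_prod_mult transpose_outer_prod outer_prod_mult_vec)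
  also have "(?B *\<^sub>v ?e) \<bullet> ?e = ?B $$ (0,0)"
    using mult_mat_unit_vec[OF Si(1) n] n by simp
  also have "outer_prod v (?B $$ (0,0) \<cdot>\<^sub>v v) = ?B $$ (0,0) \<cdot>\<^sub>m outer_prod v v"
    using outer_prod_smult[of 1 v "?B $$ (0,0)" v] by simp
  finally have KBK: "K * (?B * K\<^sup>T) = ?B $$ (0,0) \<cdot>\<^sub>m outer_prod v v" .
  have "(R - K) * ?B * (R - K)\<^sup>T
      = (R * (?B * R\<^sup>T) - K * (?B * R\<^sup>T)) - (R * (?B * K\<^sup>T) - K * (?B * K\<^sup>T))"
    by (simp add: transpose_minus_dim mat_dim_distribs mult_assoc_dim)
  also have "\<dots> = (R * (?B * R\<^sup>T) - outer_prod v w) - (outer_prod w v - ?B $$ (0,0) \<cdot>\<^sub>m outer_prod v v)"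
    unfolding KBR RBK KBK ..
  also have "R * (?B * R\<^sup>T) = R * ?B * R\<^sup>T" by (simp add: mult_assoc_dim)
  finally have X: "(R - K) * ?B * (R - K)\<^sup>T
      = (R * ?B * R\<^sup>T - outer_prod v w) - (outer_prod w v - ?B $$ (0,0) \<cdot>\<^sub>m outer_prod v v)" .
  have "dim_vec w = d" by (simp add: w)
  have rearrange: "X + ((N - Y) - (Z - P)) = X + P - Y - Z + N"
    if "X \<in> carrier_mat d d" "N \<in> carrier_mat d d" "Y \<in> carrier_mat d d" "Z \<in> carrier_mat d d" "P \<in> carrier_mat d d"
    for X N Y Z P :: "real mat"
    using that by (intro eq_matI) auto
  show ?thesis
    unfolding inv_mat_A X
    by (rule rearrange; rule carrier_matI) (simp_all only: index_mult_mat index_smult_mat index_transpose_mat outer_prod_dim dims dims' dims'' v \<open>dim_vec w = d\<close>)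
qed

subsection \<open>The Lanczos recurrence\<close>

context
  fixes A :: "real mat" and v_ref :: "real vec" and q :: "nat \<Rightarrow> real vec" and \<alpha> \<beta> :: "nat \<Rightarrow> real" and d m :: nat
  assumes A: "A \<in> carrier_mat d d" "A\<^sup>T = A" and m: "1 \<le> m"
    and v_ref: "v_ref \<in> carrier_vec d" "v_ref \<noteq> 0\<^sub>v d"
    and lanczos: "lanczos A v_ref m q \<alpha> \<beta>"
begin

lemma lanczos_step:
  assumes "1 \<le> j" "j \<le> m"
  shows "\<alpha> j = q j \<bullet> (A *\<^sub>v q j)"
    "\<beta> j = l2_norm (A *\<^sub>v q j - \<alpha> j \<cdot>\<^sub>v q j - \<beta> (j - 1) \<cdot>\<^sub>v q (j - 1))"
    "\<beta> j \<noteq> 0 \<Longrightarrow> q (j + 1) = (1 / \<beta> j) \<cdot>\<^sub>v (A *\<^sub>v q j - \<alpha> j \<cdot>\<^sub>v q j - \<beta> (j - 1) \<cdot>\<^sub>v q (j - 1))"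
    "j < m \<Longrightarrow> \<beta> j \<noteq> 0"
proof -
  have j: "j \<in> {1..m}" using assms by simp
  note * = lanczos[unfolded lanczos_def Let_def]
  show "\<alpha> j = q j \<bullet> (A *\<^sub>v q j)" using * j by blast
  show "\<beta> j = l2_norm (A *\<^sub>v q j - \<alpha> j \<cdot>\<^sub>v q j - \<beta> (j - 1) \<cdot>\<^sub>v q (j - 1))" using * j by blast
  show "\<beta> j \<noteq> 0 \<Longrightarrow> q (j + 1) = (1 / \<beta> j) \<cdot>\<^sub>v (A *\<^sub>v q j - \<alpha> j \<cdot>\<^sub>v q j - \<beta> (j - 1) \<cdot>\<^sub>v q (j - 1))"
    using * j by blast
  assume "j < m"
  then have "j \<in> {1..<m}" using assms by simp
  then show "\<beta> j \<noteq> 0" using * by blast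
qed

lemma lanczos_init: "q 0 = 0\<^sub>v d" "\<beta> 0 = 0" "q 1 = (1 / l2_norm v_ref) \<cdot>\<^sub>v v_ref"
  using lanczos A by (auto simp: lanczos_def)

lemma lanczos_breakdown:
  assumes "\<beta> m = 0"
  shows "q (m + 1) \<in> carrier_vec d" "l2_norm (q (m + 1)) = 1" "1 \<le> j \<Longrightarrow> j \<le> m \<Longrightarrow> q j \<bullet> q (m + 1) = 0"
  using lanczos A assms by (auto simp: lanczos_def)

lemma lanczos_carrier: "j \<le> m + 1 \<Longrightarrow> q j \<in> carrier_vec d"
proof (induction j rule: less_induct)
  case (less j)
  consider "j = 0" | "j = 1" | i where "j = Suc i" "1 \<le> i" "i \<le> m"
    using less.prems by (cases j) force+
  then show ?case
  proof cases
    case 3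
    show ?thesis
    proof (cases "\<beta> i = 0")
      case True
      \<comment> \<open>Breakdown is excluded before step m, so \<open>q (i + 1)\<close> can only be
        the freely chosen unit vector.\<close>
      then have "i = m" using lanczos_step(4)[of i] 3 by linarith
      then show ?thesis using lanczos_breakdown(1) True 3 by simp
    next
      case False
      then show ?thesis
        using lanczos_step(3)[of i] 3 less.IH[of i] less.IH[of "i - 1"] less.prems A(1) by simp
    qed
  qed (use lanczos_init v_ref in auto)
qed

text \<open>If \<open>\<beta> j = 0\<close>, the residual itself is zero, so the identity holds
  whatever \<open>q (j + 1)\<close> is. This is what lets the terminal case j = m be treated
  uniformly.\<close>

lemma lanczos_recurrence:
  assumes j: "1 \<le> j" "j \<le> m"
  shows "A *\<^sub>v q j = \<beta> j \<cdot>\<^sub>v q (j + 1) + (\<alpha> j \<cdot>\<^sub>v q j + \<beta> (j - 1) \<cdot>\<^sub>v q (j - 1))"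
proof -
  define r where "r = A *\<^sub>v q j - \<alpha> j \<cdot>\<^sub>v q j - \<beta> (j - 1) \<cdot>\<^sub>v q (j - 1)"
  have c: "q j \<in> carrier_vec d" "q (j - 1) \<in> carrier_vec d" "q (j + 1) \<in> carrier_vec d" "A *\<^sub>v q j \<in> carrier_vec d"
    using lanczos_carrier[of j] lanczos_carrier[of "j - 1"] lanczos_carrier[of "j + 1"] j A by auto
  then have r: "r \<in> carrier_vec d" by (simp add: r_def)
  have "\<beta> j \<cdot>\<^sub>v q (j + 1) = r"
  proof (cases "\<beta> j = 0")
    case True
    then have "r = 0\<^sub>v d" using lanczos_step(2)[OF j] l2_norm_eq_0_iff[OF r] by (simp add: r_def)
    then show ?thesis using True c by (auto intro!: eq_vecI)
  next
    case False
    then have "q (j + 1) = (1 / \<beta> j) \<cdot>\<^sub>v r" unfolding r_def by (rule lanczos_step(3)[OF j])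
    then show ?thesis using False by (simp add: smult_smult_assoc)
  qed
  then show ?thesis using c A(1) by (auto simp: r_def intro!: eq_vecI simp del: index_mult_mat_vec)
qed

text \<open>Induction on the number of vectors. The residual is orthogonal to q_k by the choice of
  alpha_k, to q_{k-1} because the subtracted beta term matches, and to earlier vectors because A is
  symmetric and the recurrence has three terms.\<close>

lemma lanczos_orthonormal:
  "1 \<le> i \<Longrightarrow> i \<le> m + 1 \<Longrightarrow> 1 \<le> j \<Longrightarrow> j \<le> m + 1 \<Longrightarrow> q i \<bullet> q j = (if i = j then 1 else 0)"
proof -
  have "\<forall>i\<in>{1..k}. \<forall>j\<in>{1..k}. q i \<bullet> q j = (if i = j then 1 else 0)" if "1 \<le> k" "k \<le> m + 1" for k
    using that
  proof (induction k rule: nat_induct_at_least)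
    case base
    have "l2_norm v_ref \<noteq> 0" using v_ref l2_norm_eq_0_iff by blast
    then have "q 1 \<bullet> q 1 = 1"
      unfolding lanczos_init(3) l2_norm_sq[symmetric] l2_norm_smult by simp
    then show ?case by auto
  next
    case (Suc k)
    then have k: "1 \<le> k" "k \<le> m"
      and IH: "\<And>i j. 1 \<le> i \<Longrightarrow> i \<le> k \<Longrightarrow> 1 \<le> j \<Longrightarrow> j \<le> k \<Longrightarrow> q i \<bullet> q j = (if i = j then 1 else 0)" by auto
    have car: "q j \<in> carrier_vec d" if "j \<le> Suc k" for j using lanczos_carrier that k by simp
    have Acar: "A *\<^sub>v q j \<in> carrier_vec d" for j using A(1) by (intro carrier_vecI) simp
    have q0: "x \<bullet> q 0 = 0" if "x \<in> carrier_vec d" for x using that by (simp add: lanczos_init(1))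
    have new: "q (Suc k) \<bullet> q (Suc k) = 1 \<and> (\<forall>j. 1 \<le> j \<and> j \<le> k \<longrightarrow> q (Suc k) \<bullet> q j = 0)"
    proof (cases "\<beta> k = 0")
      case True
      then have "k = m" using lanczos_step(4)[of k] k by linarith
      have \<beta>m: "\<beta> m = 0" using True \<open>k = m\<close> by simp
      have "q (Suc k) \<bullet> q j = 0" if j: "1 \<le> j" "j \<le> k" for j
      proof -
        have "q (Suc k) \<bullet> q j = q j \<bullet> q (Suc k)" by (rule comm_scalar_prod[OF car car]) (use j in auto)
        also have "\<dots> = 0" using lanczos_breakdown(3)[OF \<beta>m j(1)] j \<open>k = m\<close> by simp
        finally show ?thesis .
      qed
      moreover have "q (Suc k) \<bullet> q (Suc k) = 1"
        using lanczos_breakdown(2)[OF \<beta>m] l2_norm_sq[of "q (Suc k)"] \<open>k = m\<close> by simp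
      ultimately show ?thesis by blast
    next
      case False
      define r where "r = A *\<^sub>v q k - \<alpha> k \<cdot>\<^sub>v q k - \<beta> (k - 1) \<cdot>\<^sub>v q (k - 1)"
      have "q (k - 1) \<in> carrier_vec d" by (rule car) simp
      then have r: "r \<in> carrier_vec d" using car[of k] Acar[of k] by (simp add: r_def)
      have qr: "q (Suc k) = (1 / \<beta> k) \<cdot>\<^sub>v r" using lanczos_step(3)[OF k False] by (simp add: r_def)
      have "\<beta> k = l2_norm r" using lanczos_step(2)[OF k] by (simp add: r_def)
      then have "l2_norm (q (Suc k)) = 1" using False by (simp add: qr l2_norm_smult)
      then have 1: "q (Suc k) \<bullet> q (Suc k) = 1" using l2_norm_sq[of "q (Suc k)"] by simp
      have "r \<bullet> q j = 0" if j: "1 \<le> j" "j \<le> k" for j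
      proof -
        have rq: "r \<bullet> q j = (A *\<^sub>v q k) \<bullet> q j - \<alpha> k * (q k \<bullet> q j) - \<beta> (k - 1) * (q (k - 1) \<bullet> q j)"
          unfolding r_def using car[of k] car[of "k - 1"] car[of j] j Acar[of k]
          by (simp add: minus_scalar_prod_distrib[of _ d])
        \<comment> \<open>The subtracted term is felt only by q_{k-1}; for k = 1 it vanishes through
          the initial value \<open>\<beta> 0 = 0\<close>.\<close>
        have last: "\<beta> (k - 1) * (q (k - 1) \<bullet> q j) = (if j + 1 = k then \<beta> j else 0)"
        proof (cases "k = 1")
          case True
          then show ?thesis using lanczos_init(2) j by simp
        next
          case False
          then show ?thesis using IH[of "k - 1" j] k j by (auto simp: le_diff_conv)
        qed
        show ?thesis
        proof (cases "j = k")
          case True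
          then have "(A *\<^sub>v q k) \<bullet> q j = \<alpha> k"
            using lanczos_step(1)[OF k] comm_scalar_prod[OF Acar car, of k k] by simp
          then show ?thesis using rq last True IH[of k k] k by simp
        next
          case False
          then have jk: "j < k" using j by simp
          \<comment> \<open>With A moved to q_j, the recurrence involves only indices j-1, j and
            j+1. The sole possible survivor is beta_j for j + 1 = k, and \<open>last\<close> cancels
            it; for j = 1 the index 0 is harmless since \<open>q 0\<close> is zero.\<close>
          have "(A *\<^sub>v q k) \<bullet> q j = q k \<bullet> (A *\<^sub>v q j)"
            using scalar_mult_mat_vec[OF A(1), of "q k" "q j"] car[of k] car[of j] j A(2) by simp
          also have "\<dots> = \<beta> j * (q k \<bullet> q (j + 1)) + (\<alpha> j * (q k \<bullet> q j) + \<beta> (j - 1) * (q k \<bullet> q (j - 1)))"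
            unfolding lanczos_recurrence[OF j(1) order_trans[OF j(2) k(2)]]
            using car[of k] car[of "j + 1"] car[of j] car[of "j - 1"] jk
            by (simp add: scalar_prod_add_distrib[of _ d])
          also have "q k \<bullet> q (j - 1) = 0"
          proof (cases "j = 1")
            case True
            then show ?thesis using q0[of "q k"] car[of k] by simp
          next
            case False
            then show ?thesis using IH[of k "j - 1"] j jk by simp
          qed
          finally show ?thesis using rq last IH[of k j] IH[of k "j + 1"] j jk by auto
        qed
      qed
      then have "q (Suc k) \<bullet> q j = 0" if "1 \<le> j" "j \<le> k" for j
        using that r car[of j] by (simp add: qr)
      then show ?thesis using 1 by blast
    qed
    have sym: "q i \<bullet> q (Suc k) = 0" if "1 \<le> i" "i \<le> k" for i
      using new that comm_scalar_prod[OF car car, of i "Suc k"] by (metis le_Suc_eq order_refl)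
    show ?case
    proof (intro ballI)
      fix i j assume "i \<in> {1..Suc k}" "j \<in> {1..Suc k}"
      then show "q i \<bullet> q j = (if i = j then 1 else 0)"
        using new sym IH[of i j] by (cases "i = Suc k"; cases "j = Suc k") auto
    qed
  qed
  from this[of "m + 1"] show "1 \<le> i \<Longrightarrow> i \<le> m + 1 \<Longrightarrow> 1 \<le> j \<Longrightarrow> j \<le> m + 1 \<Longrightarrow> q i \<bullet> q j = (if i = j then 1 else 0)"
    using m by auto
qed

end

section \<open>Rank-one coupling and moments of the inverse Schur complement\<close>

text \<open>For v = e_m, w = e_1 and b = beta_m the scalar in the second claim is gamma, and the
  vector in the first is \<open>q_par\<close>.\<close>

lemma (in orthogonal_splitting) rank_one_coupling:
  assumes C: "C = b \<cdot>\<^sub>m outer_prod v w" and v: "dim_vec v = m" and w: "dim_vec w = n"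
  shows "K = outer_prod (b \<cdot>\<^sub>v (Q *\<^sub>v (inv_mat T *\<^sub>v v))) w"
    and "S = R\<^sup>T * A * R - (b\<^sup>2 * (v \<bullet> (inv_mat T *\<^sub>v v))) \<cdot>\<^sub>m outer_prod w w"
proof -
  have 1: "inv_mat T * C = b \<cdot>\<^sub>m outer_prod (inv_mat T *\<^sub>v v) w"
    by (simp add: C mult_smult_dim mult_outer_prod v)
  have "K = b \<cdot>\<^sub>m outer_prod (Q *\<^sub>v (inv_mat T *\<^sub>v v)) w"
    by (simp add: K_def mult_assoc_dim 1 mult_smult_dim mult_outer_prod)
  then show "K = outer_prod (b \<cdot>\<^sub>v (Q *\<^sub>v (inv_mat T *\<^sub>v v))) w"
    using outer_prod_smult[of b _ 1 w] by simp
  have "C\<^sup>T = b \<cdot>\<^sub>m outer_prod w v" unfolding C by (rule eq_matI) auto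
  then have "C\<^sup>T * (inv_mat T * C) = b \<cdot>\<^sub>m (b \<cdot>\<^sub>m outer_prod (outer_prod w v *\<^sub>v (inv_mat T *\<^sub>v v)) w)"
    unfolding 1 by (simp add: smult_mult_dim mult_smult_dim mult_outer_prod smult_mult_vec_dim outer_prod_smult[of _ _ 1, simplified] v w)
  also have "\<dots> = (b\<^sup>2 * (v \<bullet> (inv_mat T *\<^sub>v v))) \<cdot>\<^sub>m outer_prod w w"
    by (rule eq_matI) (auto simp: outer_prod_mult_vec v power2_eq_square)
  finally show "S = R\<^sup>T * A * R - (b\<^sup>2 * (v \<bullet> (inv_mat T *\<^sub>v v))) \<cdot>\<^sub>m outer_prod w w"
    by (simp add: S_def mult_assoc_dim)
qed

lemma pow_mat_mult_vec:
  assumes "B \<in> carrier_mat n n" "x \<in> carrier_vec n"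
  shows "(B ^\<^sub>m 2) *\<^sub>v x = B *\<^sub>v (B *\<^sub>v (x :: real vec))"
    "(B ^\<^sub>m 3) *\<^sub>v x = B *\<^sub>v (B *\<^sub>v (B *\<^sub>v x))"
    "(B ^\<^sub>m 4) *\<^sub>v x = B *\<^sub>v (B *\<^sub>v (B *\<^sub>v (B *\<^sub>v x)))"
proof -
  have d: "dim_row B = n" "dim_col B = n" "dim_vec x = n" using assms by auto
  have [simp]: "dim_col (B ^\<^sub>m j) = n" for j by (cases j) (simp_all add: d)
  show "(B ^\<^sub>m 2) *\<^sub>v x = B *\<^sub>v (B *\<^sub>v x)"
    "(B ^\<^sub>m 3) *\<^sub>v x = B *\<^sub>v (B *\<^sub>v (B *\<^sub>v x))"
    "(B ^\<^sub>m 4) *\<^sub>v x = B *\<^sub>v (B *\<^sub>v (B *\<^sub>v (B *\<^sub>v x)))"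
    by (simp_all add: eval_nat_numeral d mult_vec_assoc_dim)
qed

text \<open>Symmetry distributes the factors of the power over both sides of the scalar product. For
  e = e_1 these are the moments p_2, p_3, p_4, written through \<open>g\<close>, which is parallel
  to \<open>u_hat\<close>.\<close>

lemma unit_scalar_pow_mat:
  assumes B: "B \<in> carrier_mat n n" "B\<^sup>T = B" and e: "e \<in> carrier_vec n" and g: "g = B *\<^sub>v (e :: real vec)"
  shows "e \<bullet> (B ^\<^sub>m 2 *\<^sub>v e) = g \<bullet> g" "e \<bullet> (B ^\<^sub>m 3 *\<^sub>v e) = g \<bullet> (B *\<^sub>v g)"
    "e \<bullet> (B ^\<^sub>m 4 *\<^sub>v e) = (B *\<^sub>v g) \<bullet> (B *\<^sub>v g)"
proof -
  have gc: "g \<in> carrier_vec n" using B(1) e by (simp add: g)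
  have *: "x \<bullet> (B *\<^sub>v y) = (B *\<^sub>v x) \<bullet> y" if "x \<in> carrier_vec n" "y \<in> carrier_vec n" for x y
    using scalar_mult_mat_vec[OF B(1) that] B(2) by simp
  have c: "B *\<^sub>v y \<in> carrier_vec n" if "y \<in> carrier_vec n" for y using B(1) that by simp
  show "e \<bullet> (B ^\<^sub>m 2 *\<^sub>v e) = g \<bullet> g" "e \<bullet> (B ^\<^sub>m 3 *\<^sub>v e) = g \<bullet> (B *\<^sub>v g)"
    unfolding pow_mat_mult_vec[OF B(1) e] g by (rule *; intro e c)+
  show "e \<bullet> (B ^\<^sub>m 4 *\<^sub>v e) = (B *\<^sub>v g) \<bullet> (B *\<^sub>v g)"
    unfolding pow_mat_mult_vec[OF B(1) e] g[symmetric]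
    by (subst *) (use * e c gc in \<open>simp_all add: g[symmetric]\<close>)
qed

subsection \<open>Errors supported on the range of an isometry\<close>

locale supported_error =
  fixes R M :: "real mat" and d n :: nat
  assumes R: "R \<in> carrier_mat d n" "R\<^sup>T * R = 1\<^sub>m n" and M: "M \<in> carrier_mat n n"
begin

lemma dims [simp]: "dim_row R = d" "dim_col R = n" "dim_row M = n" "dim_col M = n"
  using R M by auto

definition "N = R * M * R\<^sup>T"

lemma N_carrier: "N \<in> carrier_mat d d"
  unfolding N_def by (rule carrier_matI) simp_all

lemma N_mult_vec: "x \<in> carrier_vec d \<Longrightarrow> N *\<^sub>v x = R *\<^sub>v (M *\<^sub>v (R\<^sup>T *\<^sub>v x))"
  by (simp add: N_def mult_vec_assoc_dim)

lemma RT_R: "y \<in> carrier_vec n \<Longrightarrow> R\<^sup>T *\<^sub>v (R *\<^sub>v y) = y"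
  using mult_vec_assoc_dim[of "R\<^sup>T" R y] R(2) by simp

lemma N_mult_R: "y \<in> carrier_vec n \<Longrightarrow> N *\<^sub>v (R *\<^sub>v y) = R *\<^sub>v (M *\<^sub>v y)"
  by (subst N_mult_vec) (auto simp: RT_R intro: carrier_vecI)

lemma N_eq_0_iff: "N = 0\<^sub>m d d \<longleftrightarrow> M = 0\<^sub>m n n"
proof
  assume N0: "N = 0\<^sub>m d d"
  have "R\<^sup>T * N * R = R\<^sup>T * R * (M * (R\<^sup>T * R))" by (simp add: N_def mult_assoc_dim)
  then have "M = R\<^sup>T * N * R" by (simp add: R(2))
  then show "M = 0\<^sub>m n n" by (simp add: N0)
next
  assume "M = 0\<^sub>m n n"
  then show "N = 0\<^sub>m d d" unfolding N_def by simp
qed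

text \<open>\<open>R R\<^sup>T\<close> fixes every \<open>R y\<close>, so its range is all of
  range(R) and range(P_m^perp) can be parametrised by coordinate vectors.\<close>

lemma col_space_projection: "vec_space.col_space d (R * R\<^sup>T) = {R *\<^sub>v y |y. y \<in> carrier_vec n}"
proof -
  have P: "R * R\<^sup>T \<in> carrier_mat d d" by (rule carrier_matI) simp_all
  show ?thesis
  proof (intro equalityI subsetI)
    fix z assume "z \<in> vec_space.col_space d (R * R\<^sup>T)"
    then obtain x where "x \<in> carrier_vec d" "z = R * R\<^sup>T *\<^sub>v x"
      unfolding vec_space.col_space_eq[OF P] by auto
    then have "z = R *\<^sub>v (R\<^sup>T *\<^sub>v x)" by (simp add: mult_vec_assoc_dim)
    moreover have "R\<^sup>T *\<^sub>v x \<in> carrier_vec n" by (rule carrier_vecI) simp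
    ultimately show "z \<in> {R *\<^sub>v y |y. y \<in> carrier_vec n}" by blast
  next
    fix z assume "z \<in> {R *\<^sub>v y |y. y \<in> carrier_vec n}"
    then obtain y where y: "y \<in> carrier_vec n" "z = R *\<^sub>v y" by blast
    have z: "z \<in> carrier_vec d" unfolding y(2) by (rule carrier_vecI) simp
    have "R * R\<^sup>T *\<^sub>v z = z" using y by (simp add: mult_vec_assoc_dim RT_R)
    then show "z \<in> vec_space.col_space d (R * R\<^sup>T)"
      unfolding vec_space.col_space_eq[OF P] using z by auto
  qed
qed

lemma col_space_N: "vec_space.col_space d N \<subseteq> vec_space.col_space d (R * R\<^sup>T)"
proof
  fix z assume "z \<in> vec_space.col_space d N"
  then obtain x where x: "x \<in> carrier_vec d" "z = N *\<^sub>v x"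
    unfolding vec_space.col_space_eq[OF N_carrier] using N_carrier by auto
  have "M *\<^sub>v (R\<^sup>T *\<^sub>v x) \<in> carrier_vec n" by (rule carrier_vecI) simp
  then show "z \<in> vec_space.col_space d (R * R\<^sup>T)"
    unfolding col_space_projection using x N_mult_vec by blast
qed

text \<open>Support on a subspace means range inside it and kernel containing its complement; this
  is the second half. Testing orthogonality against \<open>R (R\<^sup>T x)\<close> gives |R^T x|^2 =
  0.\<close>

lemma kernel_N:
  "vec_module.orthogonal_complement d (vec_space.col_space d (R * R\<^sup>T)) \<subseteq> mat_kernel N"
proof
  fix x assume "x \<in> vec_module.orthogonal_complement d (vec_space.col_space d (R * R\<^sup>T))"
  then have x: "x \<in> carrier_vec d" and orth: "\<And>y. y \<in> carrier_vec n \<Longrightarrow> x \<bullet> (R *\<^sub>v y) = 0"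
    unfolding vec_module.orthogonal_complement_def col_space_projection by auto
  have c: "R\<^sup>T *\<^sub>v x \<in> carrier_vec n" by (rule carrier_vecI) simp
  then have "(R\<^sup>T *\<^sub>v x) \<bullet> (R\<^sup>T *\<^sub>v x) = 0"
    using scalar_mult_mat_vec[OF R(1) x c] orth[OF c] by simp
  then have 0: "R\<^sup>T *\<^sub>v x = 0\<^sub>v n" using scalar_self_eq_0_iff[OF c] by simp
  have "N *\<^sub>v x = 0\<^sub>v d"
    unfolding N_mult_vec[OF x] 0 by (rule eq_vecI) (auto simp: scalar_prod_def)
  then show "x \<in> mat_kernel N" using x N_carrier by (auto simp: mat_kernel_def)
qed

lemma l2_norm_N_le:
  assumes M_le: "\<And>y. y \<in> carrier_vec n \<Longrightarrow> l2_norm (M *\<^sub>v y) \<le> b * l2_norm y" and b: "0 \<le> b"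
    and x: "x \<in> carrier_vec d"
  shows "l2_norm (N *\<^sub>v x) \<le> b * l2_norm x"
proof -
  have c: "R\<^sup>T *\<^sub>v x \<in> carrier_vec n" by (rule carrier_vecI) simp
  have "l2_norm (N *\<^sub>v x) = l2_norm (M *\<^sub>v (R\<^sup>T *\<^sub>v x))"
    unfolding N_mult_vec[OF x] by (rule isometry_l2_norm[OF R]) (rule carrier_vecI, simp)
  also have "\<dots> \<le> b * l2_norm (R\<^sup>T *\<^sub>v x)" by (rule M_le[OF c])
  also have "\<dots> \<le> b * l2_norm x" using isometry_transpose_l2_norm_le[OF R x] b by (rule mult_left_mono)
  finally show ?thesis .
qed

text \<open>\<open>R\<close> is an isometry from coordinate space onto the subspace, so
  orthogonality and the scalar equation transfer both ways. This yields the version of exactness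
  stated within range(P_m^perp).\<close>

lemma conj_scalar_iff:
  assumes S: "S \<in> carrier_mat n n" and h: "h \<in> carrier_vec n"
  shows "(\<forall>x \<in> vec_space.col_space d (R * R\<^sup>T). x \<bullet> (R *\<^sub>v h) = 0 \<longrightarrow> (R * S * R\<^sup>T) *\<^sub>v x = l \<cdot>\<^sub>v x)
    \<longleftrightarrow> (\<forall>y \<in> carrier_vec n. y \<bullet> h = 0 \<longrightarrow> S *\<^sub>v y = l \<cdot>\<^sub>v y)"
proof -
  have dS: "dim_row S = n" "dim_col S = n" using S by auto
  have "(R * S * R\<^sup>T) *\<^sub>v (R *\<^sub>v y) = l \<cdot>\<^sub>v (R *\<^sub>v y) \<longleftrightarrow> S *\<^sub>v y = l \<cdot>\<^sub>v y" if y: "y \<in> carrier_vec n" for y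
  proof -
    have Sy: "S *\<^sub>v y \<in> carrier_vec n" "l \<cdot>\<^sub>v y \<in> carrier_vec n" using S y by auto
    have 1: "(R * S * R\<^sup>T) *\<^sub>v (R *\<^sub>v y) = R *\<^sub>v (S *\<^sub>v y)"
      using y by (simp add: mult_vec_assoc_dim dS RT_R[OF y])
    have 2: "l \<cdot>\<^sub>v (R *\<^sub>v y) = R *\<^sub>v (l \<cdot>\<^sub>v y)" using y by (simp add: mult_vec_smult_dim)
    show ?thesis unfolding 1 2 using RT_R[OF Sy(1)] RT_R[OF Sy(2)] by metis
  qed
  moreover have "(R *\<^sub>v y) \<bullet> (R *\<^sub>v h) = y \<bullet> h" if "y \<in> carrier_vec n" for y
    using isometry_scalar_prod[OF R that h] .
  ultimately show ?thesis unfolding col_space_projection by auto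
qed

end

section \<open>The Lanczos basis as an orthogonal splitting, and transfer of the coordinate
  estimates\<close>

theorem proposition14:
  fixes A Q Qp T Tp S Pp P_rest Sig V W D E :: "real mat"
    and v_ref q_par q_perp u u_hat c e\<^sub>1 :: "real vec"
    and q :: "nat \<Rightarrow> real vec"
    and \<alpha> \<beta> p :: "nat \<Rightarrow> real"
    and \<gamma> \<sigma>\<^sub>u \<omega> \<kappa> :: real
    and \<mu> s \<delta> :: "real list"
    and d m :: nat
  assumes A: "sym_pos_def d A"
    and m: "1 \<le> m" "m < d" and dm: "2 \<le> d - m"
    and v_ref_nonzero: "v_ref \<in> carrier_vec d" "v_ref \<noteq> 0\<^sub>v d"
    and lanczos: "lanczos A v_ref m q \<alpha> \<beta>"
    and Q: "Q = mat_of_cols d (map q [1..<m + 1])"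
    and T: "T = Q\<^sup>T * A * Q"
    and Qperp: "Qp \<in> carrier_mat d (d - m)" "orthonormal_cols Qp"
      "vec_space.col_space d Qp = vec_module.orthogonal_complement d (vec_space.col_space d Q)"
      "col Qp 0 = q (m + 1)"
    and Pperp: "Pp = 1\<^sub>m d - Q * Q\<^sup>T"
    and Tperp: "Tp = Qp\<^sup>T * A * Qp"
    and e1: "e\<^sub>1 = unit_vec (d - m) 0"
    and \<gamma>: "\<gamma> = (\<beta> m)\<^sup>2 * inv_mat T $$ (m - 1, m - 1)"
    and S: "S = Tp - \<gamma> \<cdot>\<^sub>m outer_prod e\<^sub>1 e\<^sub>1"
    and \<mu>: "\<mu> = eigenvalues_desc S"
    and \<kappa>: "\<kappa> = \<mu> ! 0 / \<mu> ! (d - m - 1)"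
    and q_par_eq: "q_par = \<beta> m \<cdot>\<^sub>v (Q *\<^sub>v (inv_mat T *\<^sub>v unit_vec m (m - 1)))"
    and q_perp_eq: "q_perp = Qp *\<^sub>v (inv_mat S *\<^sub>v e\<^sub>1)"
    and u: "u = (1 / l2_norm q_perp) \<cdot>\<^sub>v q_perp"
    and \<sigma>u: "\<sigma>\<^sub>u = (e\<^sub>1 \<bullet> (inv_mat S ^\<^sub>m 3 *\<^sub>v e\<^sub>1)) / (e\<^sub>1 \<bullet> (inv_mat S ^\<^sub>m 2 *\<^sub>v e\<^sub>1))"
    and \<omega>: "\<omega> = (mat_trace (inv_mat S) - \<sigma>\<^sub>u) / real (d - m - 1)"
    and P_rest_eq: "P_rest = 1\<^sub>m d - Q * Q\<^sup>T - outer_prod u u"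
    and Sig: "Sig = Q * inv_mat T * Q\<^sup>T + (inv_mat S $$ (0,0)) \<cdot>\<^sub>m outer_prod q_par q_par
      - outer_prod q_par q_perp - outer_prod q_perp q_par + \<sigma>\<^sub>u \<cdot>\<^sub>m outer_prod u u + \<omega> \<cdot>\<^sub>m P_rest"
    and u_hat_eq: "u_hat = (1 / sqrt (e\<^sub>1 \<bullet> (inv_mat S ^\<^sub>m 2 *\<^sub>v e\<^sub>1))) \<cdot>\<^sub>v (inv_mat S *\<^sub>v e\<^sub>1)"
    and V: "V \<in> carrier_mat (d - m) (d - m - 1)" "orthonormal_cols V"
    and W: "W = mat_of_cols (d - m) (u_hat # cols V)" "orthonormal_cols W"
    and c: "c = V\<^sup>T *\<^sub>v (inv_mat S *\<^sub>v u_hat)"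
    and D: "D = V\<^sup>T * inv_mat S * V"
    and E: "E = four_block_mat (0\<^sub>m 1 1) (mat_of_rows (d - m - 1) [- c])
                  (mat_of_cols (d - m - 1) [- c]) (\<omega> \<cdot>\<^sub>m 1\<^sub>m (d - m - 1) - D)"
    and s: "s = eigenvalues_desc (inv_mat S)"
    and \<delta>: "\<delta> = eigenvalues_desc D"
    and p: "p = (\<lambda>k. (inv_mat S ^\<^sub>m k) $$ (0,0))"
  shows
    "u = Qp *\<^sub>v u_hat \<and>
    \<comment> \<open>(i)\<close>
    (Q\<^sup>T * Sig * Q = Q\<^sup>T * inv_mat A * Q \<and>
     Q\<^sup>T * Sig * Qp = Q\<^sup>T * inv_mat A * Qp \<and>
     Sig - inv_mat A = Qp * W * E * W\<^sup>T * Qp\<^sup>T \<and>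
     vec_space.col_space d (Sig - inv_mat A) \<subseteq> vec_space.col_space d Pp \<and>
     vec_module.orthogonal_complement d (vec_space.col_space d Pp) \<subseteq> mat_kernel (Sig - inv_mat A) \<and>
     u \<bullet> ((Sig - inv_mat A) *\<^sub>v u) = 0 \<and>
     mat_trace (Sig - inv_mat A) = 0) \<and>
    \<comment> \<open>(ii)\<close>
    (length s = d - m \<and> length \<delta> = d - m - 1 \<and>
     (\<forall>i < d - m - 1. 0 < \<delta> ! i \<and>
        s ! i \<ge> \<delta> ! i \<and> \<delta> ! i \<ge> s ! (i + 1) \<and>
        \<delta> ! i \<in> {1 / \<mu> ! 0 .. 1 / \<mu> ! (d - m - 1)}) \<and>
     \<omega> = mat_trace D / real (d - m - 1) \<and>
     \<omega> = (\<Sum>i < d - m - 1. \<delta> ! i) / real (d - m - 1)) \<and>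
    \<comment> \<open>(iii)\<close>
    ((l2_norm c)\<^sup>2 = p 4 / p 2 - (p 3 / p 2)\<^sup>2 \<and>
     l2_norm c \<le> 1 / 2 * \<omega> * (\<kappa> - 1)) \<and>
    \<comment> \<open>(iv)\<close>
    (spectral_norm (Sig - inv_mat A) \<le> 3 / 2 * \<omega> * (\<kappa> - 1) \<and>
     frobenius_norm (Sig - inv_mat A) \<le> 1 / 2 * \<omega> * (\<kappa> - 1) * sqrt (real (d - m + 1)) \<and>
     l2_norm c \<le> spectral_norm (Sig - inv_mat A)) \<and>
    \<comment> \<open>(v)\<close>
    ((Sig = inv_mat A \<longleftrightarrow> c = 0\<^sub>v (d - m - 1) \<and> D = \<omega> \<cdot>\<^sub>m 1\<^sub>m (d - m - 1)) \<and>
     (Sig = inv_mat A \<longleftrightarrow>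
        (\<exists>k. eigenvector S u_hat k) \<and>
        (\<exists>k. \<forall>x \<in> carrier_vec (d - m). x \<bullet> u_hat = 0 \<longrightarrow> S *\<^sub>v x = k \<cdot>\<^sub>v x)) \<and>
     (Sig = inv_mat A \<longleftrightarrow>
        (\<exists>k. eigenvector S u_hat k) \<and>
        (\<exists>k. \<forall>x \<in> vec_space.col_space d Pp. x \<bullet> u = 0 \<longrightarrow>
           (Qp * S * Qp\<^sup>T) *\<^sub>v x = k \<cdot>\<^sub>v x)) \<and>
     (\<kappa> = 1 \<longrightarrow> Sig = inv_mat A))"
proof -
  \<comment> \<open>\<open>d - m\<close> becomes \<open>Suc k\<close>, the size used by the locales.
    The assumption \<open>dm\<close> makes k positive, so that the mean over k eigenvalues makes
    sense.\<close>
  define k where "k = d - m - 1"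
  have n: "d - m = Suc k" and k: "0 < k" and nk: "d - m - 1 = k" and d_eq: "d = m + Suc k"
    using dm m by (auto simp: k_def)
  note Qp = Qperp(1,2)[unfolded n orthonormal_cols_def]
  have Ac: "A \<in> carrier_mat d d" "A\<^sup>T = A" using A by (auto simp: sym_pos_def_def)
  note lz = Ac m(1) v_ref_nonzero lanczos
  let ?B = "inv_mat S" and ?Ti = "inv_mat T"

  have q_carrier: "q j \<in> carrier_vec d" if "j \<le> m + 1" for j
    using lanczos_carrier[OF lz that] .
  have Qc: "Q \<in> carrier_mat d m" by (auto simp: Q)
  have colQ: "col Q j = q (Suc j)" if "j < m" for j
  proof -
    have *: "map q [1..<m + 1] ! j = q (Suc j)" using that by (simp del: upt_Suc)
    have "col Q j = map q [1..<m + 1] ! j"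
      unfolding Q by (rule col_mat_of_cols) (use that q_carrier[of "Suc j"] * in \<open>simp_all del: upt_Suc\<close>)
    then show ?thesis by (simp only: *)
  qed
  have QQ: "Q\<^sup>T * Q = 1\<^sub>m m"
  proof (rule eq_matI)
    fix i j assume "i < dim_row (1\<^sub>m m)" "j < dim_col (1\<^sub>m m)"
    then have "i < m" "j < m" by auto
    then show "(Q\<^sup>T * Q) $$ (i,j) = 1\<^sub>m m $$ (i,j)"
      using Qc colQ lanczos_orthonormal[OF lz, of "Suc i" "Suc j"] by simp
  qed (use Qc in auto)
  have R: "Qp \<in> carrier_mat d (Suc k)" "Qp\<^sup>T * Qp = 1\<^sub>m (Suc k)" using Qp by auto
  have colQp: "col Qp j \<in> carrier_vec d" "i < m \<Longrightarrow> col Q i \<bullet> col Qp j = 0" if j: "j < Suc k" for i j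
  proof -
    show c: "col Qp j \<in> carrier_vec d" using R(1) by (auto simp: carrier_dim_vec)
    assume i: "i < m"
    have "col Qp j = Qp *\<^sub>v unit_vec (Suc k) j" using mult_mat_unit_vec[OF R(1) j] ..
    then have "col Qp j \<in> vec_space.col_space d Qp"
      unfolding vec_space.col_space_eq[OF R(1)] using R(1) c
      by (metis (mono_tags, lifting) carrier_matD mem_Collect_eq unit_vec_carrier)
    moreover have "col Q i = Q *\<^sub>v unit_vec m i" using mult_mat_unit_vec[OF Qc i] ..
    then have "col Q i \<in> vec_space.col_space d Q"
      unfolding vec_space.col_space_eq[OF Qc] using Qc colQ[OF i] q_carrier[of "Suc i"] i
      by (metis (mono_tags, lifting) carrier_matD mem_Collect_eq unit_vec_carrier Suc_leI add.commute le_SucI plus_1_eq_Suc)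
    ultimately have "col Qp j \<bullet> col Q i = 0"
      unfolding Qperp(3) vec_module.orthogonal_complement_def by blast
    then show "col Q i \<bullet> col Qp j = 0"
      using comm_scalar_prod[OF c, of "col Q i"] colQ[OF i] q_carrier[of "Suc i"] i by simp
  qed
  have QR: "Q\<^sup>T * Qp = 0\<^sub>m m (Suc k)"
    by (rule eq_matI) (use Qc R(1) colQp(2) in auto)
  have sum1: "Q * Q\<^sup>T + Qp * Qp\<^sup>T = 1\<^sub>m d"
    by (rule orthonormal_completion[OF Qc QQ R QR d_eq])
  interpret os: orthogonal_splitting A Q Qp d m "Suc k"
    by unfold_locales (fact A Qc QQ R QR sum1)+
  have osT: "os.T = T" unfolding os.T_def T ..

  \<comment> \<open>The entry is (A q_{i+1}).r_j, as column i of \<open>Q\<close> is q_{i+1}. By the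
    recurrence it involves only q_i, q_{i+1} and q_{i+2}, and r_j is orthogonal to q_0 = 0 and to
    q_1, ..., q_m. Only q_{m+1} survives, for i = m-1, and it is the first column of
    \<open>Qp\<close>.\<close>
  have osC: "os.C = \<beta> m \<cdot>\<^sub>m outer_prod (unit_vec m (m - 1)) (unit_vec (Suc k) 0)"
  proof (rule eq_matI)
    fix i j assume "i < dim_row (\<beta> m \<cdot>\<^sub>m outer_prod (unit_vec m (m - 1)) (unit_vec (Suc k) 0))"
      "j < dim_col (\<beta> m \<cdot>\<^sub>m outer_prod (unit_vec m (m - 1)) (unit_vec (Suc k) 0))"
    then have i: "i < m" and j: "j < Suc k" by auto
    let ?r = "col Qp j"
    have qr: "q l \<bullet> ?r = 0" if "l \<le> m" for l
    proof (cases l)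
      case 0
      then show ?thesis using lanczos_init(1)[OF lz] colQp(1)[OF j] by simp
    next
      case (Suc l')
      then show ?thesis using colQp(2)[OF j, of l'] colQ[of l'] that by simp
    qed
    have "os.C $$ (i,j) = (Q\<^sup>T * (A * Qp)) $$ (i,j)" by (simp add: os.C_def mult_assoc_dim)
    also have "\<dots> = q (Suc i) \<bullet> (A *\<^sub>v ?r)"
      using i j colQ[OF i] col_mult2[OF Ac(1) R(1) j] by simp
    also have "\<dots> = (A *\<^sub>v q (Suc i)) \<bullet> ?r"
      using scalar_mult_mat_vec[OF Ac(1), of "q (Suc i)" ?r] q_carrier[of "Suc i"] i colQp(1)[OF j] Ac(2) by simp
    also have "\<dots> = \<beta> (Suc i) * (q (Suc i + 1) \<bullet> ?r) + (\<alpha> (Suc i) * (q (Suc i) \<bullet> ?r) + \<beta> (Suc i - 1) * (q (Suc i - 1) \<bullet> ?r))"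
      using lanczos_recurrence[OF lz, of "Suc i"] i q_carrier[of "Suc i"] q_carrier[of i] q_carrier[of "Suc i + 1"] colQp(1)[OF j]
      by (simp add: add_scalar_prod_distrib[of _ d])
    also have "\<dots> = \<beta> (Suc i) * (q (Suc i + 1) \<bullet> ?r)" using qr[of "Suc i"] qr[of i] i by simp
    also have "\<dots> = (if i = m - 1 \<and> j = 0 then \<beta> m else 0)"
    proof (cases "i = m - 1")
      case True
      then have "Suc i = m" using i by simp
      moreover have "q (m + 1) \<bullet> ?r = (if j = 0 then 1 else 0)"
        using arg_cong[OF R(2), of "\<lambda>M. M $$ (0,j)"] R(1) j Qperp(4) by simp
      ultimately show ?thesis using True by simp
    next
      case False
      then show ?thesis using qr[of "Suc i + 1"] i by simp
    qed
    finally show "os.C $$ (i,j) = (\<beta> m \<cdot>\<^sub>m outer_prod (unit_vec m (m - 1)) (unit_vec (Suc k) 0)) $$ (i,j)"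
      using i j by simp
  qed simp_all
  note rank_one = os.rank_one_coupling[OF osC, unfolded osT]
  have Tc: "?Ti \<in> carrier_mat m m" using os.Ti(1) by (simp add: osT)
  have e1': "e\<^sub>1 = unit_vec (Suc k) 0" by (simp add: e1 n)
  have osK: "os.K = outer_prod q_par (unit_vec (Suc k) 0)"
    using rank_one(1) by (simp add: q_par_eq)
  have "unit_vec m (m - 1) \<bullet> (?Ti *\<^sub>v unit_vec m (m - 1)) = ?Ti $$ (m - 1, m - 1)"
    using mult_mat_unit_vec[OF Tc, of "m - 1"] Tc m col_dim[of ?Ti "m - 1"]
    by (subst scalar_prod_left_unit[of _ m]) (auto simp: carrier_dim_vec)
  then have osS: "os.S = S"
    using rank_one(2) by (simp add: S Tperp \<gamma> e1')

  have S_spd: "sym_pos_def (Suc k) S" using os.S_spd by (simp add: osS)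
  have Sc: "S \<in> carrier_mat (Suc k) (Suc k)" using S_spd by (simp add: sym_pos_def_def)
  note Si = sym_pos_def_inv_mat[OF S_spd]
  define g where "g = ?B *\<^sub>v e\<^sub>1"
  have e1c: "e\<^sub>1 \<in> carrier_vec (Suc k)" by (simp add: e1')
  have gc: "g \<in> carrier_vec (Suc k)" using Si(1) e1c by (simp add: g_def)
  note pw = unit_scalar_pow_mat[OF Si(1,4) e1c g_def]
  have pk: "p j = e\<^sub>1 \<bullet> (?B ^\<^sub>m j *\<^sub>v e\<^sub>1)" for j
  proof -
    have M: "?B ^\<^sub>m j \<in> carrier_mat (Suc k) (Suc k)" using Si(1) by simp
    then have "col (?B ^\<^sub>m j) 0 \<in> carrier_vec (Suc k)" by (auto simp: carrier_dim_vec)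
    then show ?thesis using M Si(1) mult_mat_unit_vec[OF M, of 0] by (simp add: p e1')
  qed
  \<comment> \<open>\<open>S g = e\<^sub>1\<close> is nonzero; hence p_2 = g.g is positive and the
    normalisation of \<open>u_hat\<close> is legitimate.\<close>
  have "g \<noteq> 0\<^sub>v (Suc k)"
  proof
    assume "g = 0\<^sub>v (Suc k)"
    then have "S *\<^sub>v g = 0\<^sub>v (Suc k)" using Sc by (intro eq_vecI) (auto simp: scalar_prod_def)
    moreover have "S *\<^sub>v g = e\<^sub>1"
      using mult_vec_assoc_dim[of S ?B e\<^sub>1] Sc Si(1,2) e1c by (simp add: g_def)
    ultimately show False by (simp add: e1')
  qed
  then have gg: "0 < g \<bullet> g" using scalar_self_pos[OF gc] by simp
  define r where "r = sqrt (g \<bullet> g)"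
  have r: "0 < r" "r\<^sup>2 = g \<bullet> g" using gg by (auto simp: r_def)
  have uh: "u_hat = (1 / r) \<cdot>\<^sub>v g" by (simp add: u_hat_eq pw(1) r_def g_def)
  have uhc: "u_hat \<in> carrier_vec (Suc k)" using gc by (simp add: uh)
  have u_eq: "u = Qp *\<^sub>v u_hat"
  proof -
    have "l2_norm q_perp = r"
      unfolding q_perp_eq g_def[symmetric] isometry_l2_norm[OF R gc] by (simp add: l2_norm_def r_def)
    then have "u = (1 / r) \<cdot>\<^sub>v (Qp *\<^sub>v g)" unfolding u by (simp add: q_perp_eq g_def)
    then show ?thesis using R(1) gc by (simp add: uh mult_vec_smult_dim)
  qed

  have Vc: "V \<in> carrier_mat (Suc k) k" using V(1) unfolding nk unfolding n .
  have Wm: "W = mat_of_cols (Suc k) (u_hat # cols V)" using W(1) by (simp only: n)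
  have "dim_col W = Suc k" using Vc by (simp add: Wm)
  then have Wo: "W\<^sup>T * W = 1\<^sub>m (Suc k)" using W(2) by (simp add: orthonormal_cols_def)
  interpret mf: mean_field ?B V u_hat k
    by unfold_locales (use Si uhc Vc Wo k in \<open>simp_all add: Wm\<close>)
  have mf_c: "mf.c = c" and mf_D: "mf.D = D" and mf_W: "mf.W = W"
    by (simp_all add: mf.c_def c mf.D_def D mf.W_def Wm)
  have Buh: "?B *\<^sub>v u_hat = (1 / r) \<cdot>\<^sub>v (?B *\<^sub>v g)"
    using Si(1) gc by (simp add: uh mult_vec_smult_dim)
  have Bgc: "?B *\<^sub>v g \<in> carrier_vec (Suc k)" using Si(1) gc by simp
  have mf_\<sigma>': "mf.\<sigma> = (g \<bullet> (?B *\<^sub>v g)) / (g \<bullet> g)"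
    unfolding mf.\<sigma>_def Buh unfolding uh using gc Bgc r by (simp add: power2_eq_square[symmetric] field_simps)
  have mf_\<sigma>: "mf.\<sigma> = \<sigma>\<^sub>u" by (simp add: mf_\<sigma>' \<sigma>u pw)
  have mf_\<omega>: "mf.\<omega> = \<omega>" unfolding mf.\<omega>_def mf_\<sigma> \<omega> nk ..
  have mf_E: "mf.E = E" unfolding mf.E_def E mf_\<omega> mf_c mf_D nk ..

  interpret se: supported_error Qp mf.M d "Suc k"
    by unfold_locales (fact R mf.carriers(4))+
  have Pp: "Pp = Qp * Qp\<^sup>T"
    unfolding Pperp sum1[symmetric] by (rule eq_matI) (auto simp del: index_mult_mat(1))

  have q_par_c: "dim_vec q_par = d" using Qc by (simp add: q_par_eq)
  have q_perp_c: "dim_vec q_perp = d" using R(1) by (simp add: q_perp_eq)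
  have u_c: "dim_vec u = d" using R(1) by (simp add: u_eq)
  have invA: "inv_mat A = Q * ?Ti * Q\<^sup>T + (?B $$ (0,0)) \<cdot>\<^sub>m outer_prod q_par q_par
    - outer_prod q_par q_perp - outer_prod q_perp q_par + Qp * ?B * Qp\<^sup>T"
    using os.inv_mat_A_expand[OF _ osK q_par_c, of q_perp] by (simp add: osT osS q_perp_eq e1')
  \<comment> \<open>\<open>P_rest\<close> equals \<open>Qp Qp\<^sup>T\<close> minus the projection
    on u, so the last two terms of \<open>Sig\<close> form the mean-field matrix conjugated by
    \<open>Qp\<close>.\<close>
  have N_eq: "se.N = \<sigma>\<^sub>u \<cdot>\<^sub>m outer_prod u u + \<omega> \<cdot>\<^sub>m P_rest - Qp * ?B * Qp\<^sup>T"
  proof -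
    have "Qp * outer_prod u_hat u_hat * Qp\<^sup>T = outer_prod u u"
      by (simp add: u_eq mult_outer_prod outer_prod_mult)
    then have o: "Qp * (outer_prod u_hat u_hat * Qp\<^sup>T) = outer_prod u u"
      by (simp add: mult_assoc_dim)
    have "se.N = \<sigma>\<^sub>u \<cdot>\<^sub>m outer_prod u u + \<omega> \<cdot>\<^sub>m (Qp * Qp\<^sup>T - outer_prod u u) - Qp * (?B * Qp\<^sup>T)"
      unfolding se.N_def unfolding mf.M_def mf_\<sigma> mf_\<omega>
      by (simp add: mat_dim_distribs mult_assoc_dim o)
    then show ?thesis unfolding P_rest_eq Pperp[symmetric] Pp by (simp add: mult_assoc_dim)
  qed
  have invA_c: "inv_mat A \<in> carrier_mat d d" using sym_pos_def_inv_mat(1)[OF A] .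
  \<comment> \<open>The first four terms of \<open>Sig\<close> are literally those of the expansion
    \<open>invA\<close> and cancel.\<close>
  have Sig_eq: "Sig - inv_mat A = se.N"
  proof -
    have *: "X + Y + Y' - (X + Z) = Y + Y' - Z"
      if "X \<in> carrier_mat d d" "Y \<in> carrier_mat d d" "Y' \<in> carrier_mat d d" "Z \<in> carrier_mat d d"
      for X Y Y' Z :: "real mat"
      using that by (intro eq_matI) auto
    show ?thesis
      unfolding Sig invA N_eq
      by (rule *; rule carrier_matI) (use Qc R(1) in \<open>simp_all add: P_rest_eq q_par_c q_perp_c u_c\<close>)
  qed
  have Sig_c: "Sig \<in> carrier_mat d d"
    unfolding Sig by (rule carrier_matI) (simp_all add: P_rest_eq u_c)
  have Sig_add: "Sig = inv_mat A + se.N"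
    unfolding Sig_eq[symmetric] using Sig_c invA_c by (intro eq_matI) auto
  have Sig_iff: "Sig = inv_mat A \<longleftrightarrow> c = 0\<^sub>v k \<and> D = \<omega> \<cdot>\<^sub>m 1\<^sub>m k"
  proof -
    have "Sig = inv_mat A \<longleftrightarrow> se.N = 0\<^sub>m d d"
    proof
      assume "Sig = inv_mat A"
      then show "se.N = 0\<^sub>m d d" using Sig_eq invA_c by (metis minus_r_inv_mat)
    next
      assume "se.N = 0\<^sub>m d d"
      then show "Sig = inv_mat A" using Sig_add invA_c by simp
    qed
    then show ?thesis by (simp only: se.N_eq_0_iff mf.M_eq_0_iff mf_c mf_D mf_\<omega>)
  qed

  \<comment> \<open>The error is annihilated from the left by \<open>Q\<^sup>T\<close>, since
    \<open>Q\<^sup>T Qp = 0\<close>. This single identity gives exactness of both the resolved block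
    and the coupling.\<close>
  have QT_Sig: "Q\<^sup>T * Sig = Q\<^sup>T * inv_mat A"
  proof -
    have "Q\<^sup>T * se.N = Q\<^sup>T * Qp * (mf.M * Qp\<^sup>T)" by (simp add: se.N_def mult_assoc_dim)
    also have "\<dots> = 0\<^sub>m m d" unfolding QR by simp
    finally have "Q\<^sup>T * Sig = Q\<^sup>T * inv_mat A + 0\<^sub>m m d"
      unfolding Sig_add using invA_c se.N_carrier by (simp add: mult_add_dim)
    then show ?thesis using invA_c Qc by auto
  qed
  have part_i: "Q\<^sup>T * Sig * Q = Q\<^sup>T * inv_mat A * Q \<and>
     Q\<^sup>T * Sig * Qp = Q\<^sup>T * inv_mat A * Qp \<and>
     Sig - inv_mat A = Qp * W * E * W\<^sup>T * Qp\<^sup>T \<and>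
     vec_space.col_space d (Sig - inv_mat A) \<subseteq> vec_space.col_space d Pp \<and>
     vec_module.orthogonal_complement d (vec_space.col_space d Pp) \<subseteq> mat_kernel (Sig - inv_mat A) \<and>
     u \<bullet> ((Sig - inv_mat A) *\<^sub>v u) = 0 \<and>
     mat_trace (Sig - inv_mat A) = 0"
  proof (intro conjI)
    show "Sig - inv_mat A = Qp * W * E * W\<^sup>T * Qp\<^sup>T"
      unfolding Sig_eq se.N_def unfolding mf.M_eq mf_W mf_E using mf.dims[unfolded mf_W mf_E] by (simp add: mult_assoc_dim)
    show "vec_space.col_space d (Sig - inv_mat A) \<subseteq> vec_space.col_space d Pp"
      unfolding Sig_eq Pp by (rule se.col_space_N)
    show "vec_module.orthogonal_complement d (vec_space.col_space d Pp) \<subseteq> mat_kernel (Sig - inv_mat A)"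
      unfolding Sig_eq Pp by (rule se.kernel_N)
    have "mf.M *\<^sub>v u_hat \<in> carrier_vec (Suc k)" by (rule carrier_vecI) simp
    then show "u \<bullet> ((Sig - inv_mat A) *\<^sub>v u) = 0"
      unfolding Sig_eq u_eq se.N_mult_R[OF uhc] using isometry_scalar_prod[OF R uhc] mf.M_uu by simp
    show "mat_trace (Sig - inv_mat A) = 0"
      unfolding Sig_eq se.N_def trace_conj_isometry[OF R mf.carriers(4)] by (rule mf.trace_M)
  qed (simp_all only: QT_Sig)

  note ev = eigenvalues_desc_inv_mat[OF S_spd, folded \<mu> s]
  \<comment> \<open>Lists are indexed from 0, so entry k is the smallest eigenvalue; inversion
    exchanges the two ends.\<close>
  have s_ends: "s ! 0 = 1 / \<mu> ! k" "s ! k = 1 / \<mu> ! 0" using ev(2)[of 0] ev(2)[of k] by auto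
  have \<mu>_pos: "0 < \<mu> ! 0" "0 < \<mu> ! k" using ev(3)[of 0] ev(3)[of k] by auto
  note il = mf.interlacing[unfolded mf_D, folded s \<delta>] and tb = mf.t_bounds[unfolded mf_D, folded s \<delta>]
  have part_ii: "length s = d - m \<and> length \<delta> = d - m - 1 \<and>
     (\<forall>i < d - m - 1. 0 < \<delta> ! i \<and>
        s ! i \<ge> \<delta> ! i \<and> \<delta> ! i \<ge> s ! (i + 1) \<and>
        \<delta> ! i \<in> {1 / \<mu> ! 0 .. 1 / \<mu> ! (d - m - 1)}) \<and>
     \<omega> = mat_trace D / real (d - m - 1) \<and>
     \<omega> = (\<Sum>i < d - m - 1. \<delta> ! i) / real (d - m - 1)"
    unfolding nk unfolding n
  proof (intro conjI allI impI)
    show "length s = Suc k" by (rule ev(1))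
    show "length \<delta> = k"
      unfolding \<delta> using symmetric_spectral_decomp(2)[OF mf.carriers(3) mf.D_sym] by (simp only: mf_D)
    fix i assume i: "i < k"
    show "s ! i \<ge> \<delta> ! i" "\<delta> ! i \<ge> s ! (i + 1)" using il[OF i] by simp_all
    show "\<delta> ! i \<in> {1 / \<mu> ! 0 .. 1 / \<mu> ! k}" using tb[OF i] by (simp add: s_ends)
    then show "0 < \<delta> ! i" using \<mu>_pos by (auto intro: less_le_trans[rotated])
  next
    show "\<omega> = mat_trace D / real k" using mf.\<omega>_eq by (simp only: mf_\<omega> mf_D)
    show "\<omega> = (\<Sum>i<k. \<delta> ! i) / real k" using mf.\<omega>_mean by (simp only: mf_\<omega> mf_D \<delta>)
  qed

  \<comment> \<open>The length equals \<open>s ! k * (\<kappa> - 1)\<close>, and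
    \<open>s ! k\<close>, which is 1/mu_1, is at most the mean \<open>\<omega>\<close>. The
    comparison needs kappa >= 1, obtained from the nonnegative length.\<close>
  have range_le: "s ! 0 - s ! k \<le> \<omega> * (\<kappa> - 1)" and range_nonneg: "0 \<le> s ! 0 - s ! k"
  proof -
    show nn: "0 \<le> s ! 0 - s ! k" using mf.s_range_nonneg by (simp only: s)
    have "s ! 0 - s ! k = s ! k * (\<kappa> - 1)"
      using \<mu>_pos unfolding \<kappa> nk s_ends by (simp add: field_simps)
    moreover have "0 < s ! k" using \<mu>_pos by (simp add: s_ends)
    ultimately have "0 \<le> \<kappa> - 1" using nn by (simp add: zero_le_mult_iff)
    moreover have "s ! k \<le> \<omega>" using mf.\<omega>_bounds(1) by (simp only: s mf_\<omega>)
    ultimately have "s ! k * (\<kappa> - 1) \<le> \<omega> * (\<kappa> - 1)" by (simp add: mult_right_mono)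
    then show "s ! 0 - s ! k \<le> \<omega> * (\<kappa> - 1)" using \<open>s ! 0 - s ! k = s ! k * (\<kappa> - 1)\<close> by simp
  qed

  have c_sq: "(l2_norm c)\<^sup>2 = p 4 / p 2 - (p 3 / p 2)\<^sup>2"
  proof -
    have "(?B *\<^sub>v u_hat) \<bullet> (?B *\<^sub>v u_hat) = p 4 / p 2"
      unfolding Buh pk pw using Bgc r by (simp add: power2_eq_square[symmetric] power_divide)
    moreover have "mf.\<sigma> = p 3 / p 2" by (simp add: mf_\<sigma>' pk pw)
    ultimately show ?thesis using mf.c_norm by (simp add: mf_c)
  qed
  have part_iii: "(l2_norm c)\<^sup>2 = p 4 / p 2 - (p 3 / p 2)\<^sup>2 \<and> l2_norm c \<le> 1 / 2 * \<omega> * (\<kappa> - 1)"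
    using c_sq mf.c_le[unfolded mf_c, folded s] range_le by simp

  let ?b = "3 / 2 * (s ! 0 - s ! k)"
  have N_le: "l2_norm (se.N *\<^sub>v x) \<le> ?b * l2_norm x" if "x \<in> carrier_vec d" for x
    by (rule se.l2_norm_N_le[OF _ _ that]) (use mf.l2_norm_M_mult_vec_le range_nonneg in \<open>auto simp: s\<close>)
  have b0: "0 \<le> ?b" using range_nonneg by simp
  have part_iv: "spectral_norm (Sig - inv_mat A) \<le> 3 / 2 * \<omega> * (\<kappa> - 1) \<and>
     frobenius_norm (Sig - inv_mat A) \<le> 1 / 2 * \<omega> * (\<kappa> - 1) * sqrt (real (d - m + 1)) \<and>
     l2_norm c \<le> spectral_norm (Sig - inv_mat A)"
    unfolding Sig_eq
  proof (intro conjI)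
    have "spectral_norm se.N \<le> ?b" by (rule spectral_norm_le[OF se.N_carrier b0 N_le])
    then show "spectral_norm se.N \<le> 3 / 2 * \<omega> * (\<kappa> - 1)" using range_le by simp
    have "frobenius_norm se.N \<le> 1 / 2 * (s ! 0 - s ! k) * sqrt (real (k + 2))"
      unfolding se.N_def frobenius_norm_conj_isometry[OF R mf.carriers(4)] s by (rule mf.frobenius_norm_M_le)
    also have "\<dots> \<le> 1 / 2 * (\<omega> * (\<kappa> - 1)) * sqrt (real (k + 2))"
      using range_le by (intro mult_right_mono) auto
    finally show "frobenius_norm se.N \<le> 1 / 2 * \<omega> * (\<kappa> - 1) * sqrt (real (d - m + 1))"
      by (simp add: n)
    \<comment> \<open>The unit vector u is the image of \<open>u_hat\<close>, on which the error has
      norm exactly ||c||; the upper bound \<open>N_le\<close> supplies the boundedness of the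
      supremum.\<close>
    have "l2_norm (se.N *\<^sub>v u) \<le> spectral_norm se.N"
    proof (rule spectral_norm_ge[OF se.N_carrier b0 N_le])
      show "u \<in> carrier_vec d" by (rule carrier_vecI) (rule u_c)
      show "l2_norm u \<le> 1" unfolding u_eq isometry_l2_norm[OF R uhc] by (simp add: l2_norm_def mf.hh)
    qed
    moreover have "mf.M *\<^sub>v u_hat \<in> carrier_vec (Suc k)" by (rule carrier_vecI) simp
    then have "l2_norm (se.N *\<^sub>v u) = l2_norm c"
      unfolding u_eq se.N_mult_R[OF uhc] by (subst isometry_l2_norm[OF R]) (simp_all add: mf.M_mult_h mf_c)
    ultimately show "l2_norm c \<le> spectral_norm se.N" by simp
  qed

  have uh_nz: "u_hat \<noteq> 0\<^sub>v (Suc k)" using mf.hh uhc by auto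
  have eig_iff: "(\<exists>l. eigenvector S u_hat l) \<longleftrightarrow> c = 0\<^sub>v k"
  proof -
    have "(\<exists>l. eigenvector S u_hat l) \<longleftrightarrow> (\<exists>l. S *\<^sub>v u_hat = l \<cdot>\<^sub>v u_hat)"
      using Sc uhc uh_nz by (auto simp: eigenvector_def)
    also have "\<dots> \<longleftrightarrow> (\<exists>l. ?B *\<^sub>v u_hat = l \<cdot>\<^sub>v u_hat)"
      using inverse_acts_as_scalar[OF Sc Si(1,3), of "{u_hat}" u_hat]
        inverse_acts_as_scalar[OF Si(1) Sc Si(2), of "{u_hat}" u_hat] uhc uh_nz by auto
    finally show ?thesis using mf.c_eq_0_iff by (simp add: mf_c)
  qed
  let ?X = "{x \<in> carrier_vec (Suc k). x \<bullet> u_hat = 0}"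
  have scal_iff: "(\<exists>l. \<forall>x \<in> carrier_vec (Suc k). x \<bullet> u_hat = 0 \<longrightarrow> S *\<^sub>v x = l \<cdot>\<^sub>v x) \<longleftrightarrow>
      (\<exists>l. \<forall>x \<in> carrier_vec (Suc k). x \<bullet> u_hat = 0 \<longrightarrow> ?B *\<^sub>v x = l \<cdot>\<^sub>v x)"
  proof -
    \<comment> \<open>A nonzero vector orthogonal to \<open>u_hat\<close>, available since k > 0:
      the first column of \<open>V\<close>.\<close>
    define x0 where "x0 = V *\<^sub>v unit_vec k 0"
    have x0c: "x0 \<in> carrier_vec (Suc k)" using Vc by (simp add: x0_def)
    have "x0 \<bullet> x0 = 1"
      unfolding x0_def using isometry_scalar_prod[OF Vc mf.VTV, of "unit_vec k 0" "unit_vec k 0"] k by simp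
    then have x0nz: "x0 \<noteq> 0\<^sub>v (Suc k)" using x0c by auto
    have "x0 \<bullet> u_hat = 0"
      using mf.V_orth[of "unit_vec k 0"] comm_scalar_prod[OF uhc x0c] by (simp add: x0_def)
    then have x0: "x0 \<in> ?X" using x0c by simp
    have X: "?X \<subseteq> carrier_vec (Suc k)" by auto
    show ?thesis
      using inverse_acts_as_scalar[OF Sc Si(1,3) X x0 x0nz] inverse_acts_as_scalar[OF Si(1) Sc Si(2) X x0 x0nz]
      by (smt (verit) mem_Collect_eq)
  qed
  have iff1: "Sig = inv_mat A \<longleftrightarrow> (\<exists>l. eigenvector S u_hat l) \<and>
      (\<exists>l. \<forall>x \<in> carrier_vec (Suc k). x \<bullet> u_hat = 0 \<longrightarrow> S *\<^sub>v x = l \<cdot>\<^sub>v x)"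
    unfolding Sig_iff eig_iff scal_iff using mf.D_scalar_iff[unfolded mf_c mf_D mf_\<omega>] by blast
  have iff2: "(\<exists>l. \<forall>x \<in> vec_space.col_space d Pp. x \<bullet> u = 0 \<longrightarrow> (Qp * S * Qp\<^sup>T) *\<^sub>v x = l \<cdot>\<^sub>v x) \<longleftrightarrow>
      (\<exists>l. \<forall>x \<in> carrier_vec (Suc k). x \<bullet> u_hat = 0 \<longrightarrow> S *\<^sub>v x = l \<cdot>\<^sub>v x)"
    unfolding Pp u_eq se.conj_scalar_iff[OF Sc uhc] ..
  \<comment> \<open>For kappa = 1 the interval has length 0, so the Frobenius bound forces every
    entry of the coordinate error to vanish.\<close>
  have "Sig = inv_mat A" if "\<kappa> = 1"
  proof -
    have "s ! 0 = s ! k" using range_le range_nonneg that by simp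
    then have "frobenius_norm mf.M \<le> 0" using mf.frobenius_norm_M_le by (simp add: s)
    then have f0: "(\<Sum>i<Suc k. \<Sum>j<Suc k. (mf.M $$ (i,j))\<^sup>2) \<le> 0"
      by (simp add: frobenius_norm_def del: sum.lessThan_Suc)
    have "mf.M $$ (i,j) = 0" if ij: "i < Suc k" "j < Suc k" for i j
    proof -
      have "(mf.M $$ (i,j))\<^sup>2 \<le> (\<Sum>j<Suc k. (mf.M $$ (i,j))\<^sup>2)"
        by (rule member_le_sum) (use ij in auto)
      also have "\<dots> \<le> (\<Sum>i<Suc k. \<Sum>j<Suc k. (mf.M $$ (i,j))\<^sup>2)"
        by (rule member_le_sum[of i _ "\<lambda>i. \<Sum>j<Suc k. (mf.M $$ (i,j))\<^sup>2"]) (use ij in \<open>auto intro!: sum_nonneg simp del: sum.lessThan_Suc\<close>)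
      finally have "(mf.M $$ (i,j))\<^sup>2 \<le> 0" using f0 by linarith
      then show ?thesis by simp
    qed
    then have "mf.M = 0\<^sub>m (Suc k) (Suc k)" by (intro eq_matI) auto
    then show ?thesis unfolding Sig_iff using mf.M_eq_0_iff by (simp only: mf_c mf_D mf_\<omega>)
  qed
  then have part_v: "(Sig = inv_mat A \<longleftrightarrow> c = 0\<^sub>v (d - m - 1) \<and> D = \<omega> \<cdot>\<^sub>m 1\<^sub>m (d - m - 1)) \<and>
     (Sig = inv_mat A \<longleftrightarrow>
        (\<exists>k. eigenvector S u_hat k) \<and>
        (\<exists>k. \<forall>x \<in> carrier_vec (d - m). x \<bullet> u_hat = 0 \<longrightarrow> S *\<^sub>v x = k \<cdot>\<^sub>v x)) \<and>
     (Sig = inv_mat A \<longleftrightarrow>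
        (\<exists>k. eigenvector S u_hat k) \<and>
        (\<exists>k. \<forall>x \<in> vec_space.col_space d Pp. x \<bullet> u = 0 \<longrightarrow>
           (Qp * S * Qp\<^sup>T) *\<^sub>v x = k \<cdot>\<^sub>v x)) \<and>
     (\<kappa> = 1 \<longrightarrow> Sig = inv_mat A)"
    unfolding iff2 unfolding nk unfolding n using Sig_iff iff1 by blast
  show ?thesis by (rule conjI[OF u_eq conjI[OF part_i conjI[OF part_ii conjI[OF part_iii conjI[OF part_iv part_v]]]]])
qed

end
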